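(* Let $n\in\mathbb{N}$, $\alpha,\beta\in(0,1]$, $\lambda>0$, and $\mathbf{a}\in\mathbb{R}^n_+$ with $\|\mathbf{a}\|=1$. The stochastic solution to $$\frac{\partial^\beta\mathsf{w}}{\partial t^\beta}(\mathbf{x},t)=-\Big((\mathbf{a}\cdot\nabla)^\alpha+\lambda\left(I-e^{-\mathbf{1}\cdot\nabla}\right)\Big)\mathsf{w}(\mathbf{x},t),\qquad(\mathbf{x},t)\in\mathbb{R}^n_+\times(0,+\infty),$$ where $e^{-\mathbf{1}\cdot\nabla}\mathsf{w}(\mathbf{x},t)=\mathsf{w}(\mathbf{x}-\mathbf{1},t)$ is the shift operator, is the process $$\mathbf{Y}_t=\mathbf{N}(\mathfrak{L}^\beta_t)+\mathbf{a}\,\mathfrak{H}^\alpha_{\mathfrak{L}^\beta_t},\qquad t>0.$$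
   Context: A process is the stochastic solution of the equation if its law $\mathsf{w}(\cdot,t)$ solves the equation with initial datum $\mathsf{w}(\cdot,0)=\delta$. $\mathbb{R}^n_+$ is the non-negative orthant, $\mathbf{1}=(1,\dots,1)\in\mathbb{R}^n$, $I$ is the identity, and $\mathbf{a}\cdot\nabla=\sum_ka_k\partial_{x_k}$. For $\alpha\in(0,1)$, $(\mathbf{a}\cdot\nabla)^\alpha=\frac{(\mathbf{a}\cdot\nabla)}{\Gamma(1-\alpha)}\int_0^\infty ds\,s^{-\alpha}e^{-s(\mathbf{a}\cdot\nabla)}$ with $e^{-s(\mathbf{a}\cdot\nabla)}f(\mathbf{x})=f(\mathbf{x}-s\mathbf{a})$, functions on $\mathbb{R}^n_+$ being extended by zero; for $\alpha=1$ it is $\mathbf{a}\cdot\nabla$. For $\beta\in(0,1)$, $\frac{\partial^\beta f}{\partial t^\beta}(t)=\frac{1}{\Gamma(1-\beta)}\int_0^t\frac{f'(s)}{(t-s)^\beta}ds$ is the Dzerbayshan-Caputo derivative; for $\beta=1$ it is the ordinary derivative. $\mathbf{N}(t)=N(t)\,\mathbf{1}$, where $N(t)$ is a Poisson process of rate $\lambda$, so that $\mathbb{E}e^{i\boldsymbol{\xi}\cdot\mathbf{N}(t)}=\exp(-\lambda t(1-e^{i\boldsymbol{\xi}\cdot\mathbf{1}}))$. $\mathfrak{H}^\alpha_t$ is the $\alpha$-stable subordinator with $\mathbb{E}e^{-\xi\mathfrak{H}^\alpha_t}=e^{-t\xi^\alpha}$ ($\mathfrak{H}^1_t=t$). $\mathfrak{L}^\beta_t=\inf\{s\ge0:\mathfrak{H}^\beta_s\notin(0,t)\}$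 is the inverse of a $\beta$-stable subordinator ($\mathfrak{L}^1_t=t$). The processes $N$, $\mathfrak{H}^\alpha$ and $\mathfrak{L}^\beta$ are independent.
   Formalization: The infimum defining the inverse subordinator is taken over s > 0 instead of s ≥ 0, since the stable subordinator starts at 0, which lies outside (0,t), so the infimum over s ≥ 0 would always be 0, contradicting that the inverse is t when β = 1. *)

theory Defs
  imports "HOL-Probability.Probability"
begin

section \<open>Processes\<close>

definition (in prob_space) indep_increments :: "(real \<Rightarrow> 'a \<Rightarrow> real) \<Rightarrow> bool" where
  "indep_increments X \<longleftrightarrow>
     (\<forall>(ts :: nat \<Rightarrow> real) m. 0 \<le> ts 0 \<and> strict_mono ts \<longrightarrow>
        indep_vars (\<lambda>_. borel) (\<lambda>i \<omega>. X (ts (Suc i)) \<omega> - X (ts i) \<omega>) {..<m})"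

text \<open>Path properties are required of every path, i.e. the processes are taken in their
  right-continuous monotone version, so that no completion of \<open>M\<close> is needed.\<close>

definition (in prob_space) poisson_process :: "real \<Rightarrow> (real \<Rightarrow> 'a \<Rightarrow> nat) \<Rightarrow> bool" where
  "poisson_process lam N \<longleftrightarrow>
     (\<forall>t\<ge>0. random_variable (count_space UNIV) (N t)) \<and>
     (\<forall>\<omega>\<in>space M. N 0 \<omega> = 0 \<and> mono_on {0..} (\<lambda>t. N t \<omega>) \<and>
        (\<forall>t\<ge>0. continuous (at_right t) (\<lambda>s. N s \<omega>))) \<and>
     indep_increments (\<lambda>t \<omega>. real (N t \<omega>)) \<and>
     (\<forall>s t. 0 \<le> s \<and> s < t \<longrightarrow>
        distr M (count_space UNIV) (\<lambda>\<omega>. N t \<omega> - N s \<omega>)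
          = measure_pmf (poisson_pmf (lam * (t - s))))"

text \<open>For \<open>\<alpha> = 1\<close> the Laplace transform forces \<open>H t = t\<close> almost surely.\<close>

definition (in prob_space) stable_subordinator :: "real \<Rightarrow> (real \<Rightarrow> 'a \<Rightarrow> real) \<Rightarrow> bool" where
  "stable_subordinator \<alpha> H \<longleftrightarrow>
     (\<forall>t\<ge>0. random_variable borel (H t)) \<and>
     (\<forall>\<omega>\<in>space M. H 0 \<omega> = 0 \<and> mono_on {0..} (\<lambda>t. H t \<omega>) \<and>
        (\<forall>t\<ge>0. continuous (at_right t) (\<lambda>s. H s \<omega>))) \<and>
     indep_increments H \<and>
     (\<forall>s t. 0 \<le> s \<and> s < t \<longrightarrow>
        distr M borel (\<lambda>\<omega>. H t \<omega> - H s \<omega>) = distr M borel (H (t - s))) \<and>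
     (\<forall>t\<ge>0. \<forall>\<xi>\<ge>0. expectation (\<lambda>\<omega>. exp (- \<xi> * H t \<omega>)) = exp (- t * \<xi> powr \<alpha>))"

text \<open>The infimum runs over \<open>s > 0\<close>: since \<open>H 0 = 0\<close> lies outside \<open>{0<..<t}\<close>, including
  \<open>s = 0\<close> would make the infimum identically zero. The set is empty only on the null event
  that the path of \<open>H\<close> stays below \<open>t\<close>; there the value is set to \<open>0\<close>, because
  \<open>Inf {}\<close> is an unspecified real.\<close>

definition inverse_subordinator :: "(real \<Rightarrow> 'a \<Rightarrow> real) \<Rightarrow> real \<Rightarrow> 'a \<Rightarrow> real" where
  "inverse_subordinator H t \<omega> =
     (let S = {s. 0 < s \<and> H s \<omega> \<notin> {0<..<t}} in if S = {} then 0 else Inf S)"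

definition (in prob_space) indep_processes :: "(real \<Rightarrow> 'a \<Rightarrow> real) list \<Rightarrow> bool" where
  "indep_processes Xs \<longleftrightarrow>
     indep_vars (\<lambda>_. \<Pi>\<^sub>M t\<in>{0..}. borel) (\<lambda>i \<omega>. \<lambda>t\<in>{0..}. (Xs ! i) t \<omega>) {..<length Xs}"

section \<open>Test functions and distributions\<close>

definition partial :: "'n \<Rightarrow> (real ^ 'n \<Rightarrow> real) \<Rightarrow> real ^ 'n \<Rightarrow> real" where
  "partial k \<phi> x = frechet_derivative \<phi> (at x) (axis k 1)"

primrec k_smooth :: "nat \<Rightarrow> (real ^ 'n \<Rightarrow> real) \<Rightarrow> bool" where
  "k_smooth 0 \<phi> \<longleftrightarrow> continuous_on UNIV \<phi>"
| "k_smooth (Suc m) \<phi> \<longleftrightarrow> \<phi> differentiable_on UNIV \<and> (\<forall>k. k_smooth m (partial k \<phi>))"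

definition test_function :: "(real ^ 'n \<Rightarrow> real) \<Rightarrow> bool" where
  "test_function \<phi> \<longleftrightarrow> (\<forall>m. k_smooth m \<phi>) \<and> compact (closure {x. \<phi> x \<noteq> 0})"

text \<open>The laws involved are in general singular, so the operators act on them in the sense of
  distributions. A distribution is represented by its pairing with test functions (values of the
  functional at other functions are irrelevant), and each operator acts by transposition: the
  transpose of \<open>f \<mapsto> f (\<cdot> - b)\<close> is \<open>\<phi> \<mapsto> \<phi> (\<cdot> + b)\<close> and that of \<open>a \<bullet> \<nabla>\<close> is \<open>- (a \<bullet> \<nabla>)\<close>.
  A measure on the orthant, regarded as a measure on the whole space, is extended by zero.\<close>

type_synonym 'n distribution = "(real ^ 'n \<Rightarrow> real) \<Rightarrow> real"

definition dist_of :: "(real ^ 'n) measure \<Rightarrow> 'n distribution" where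
  "dist_of \<mu> = (\<lambda>\<phi>. \<integral>x. \<phi> x \<partial>\<mu>)"

definition shift_op :: "real ^ 'n \<Rightarrow> 'n distribution \<Rightarrow> 'n distribution" where
  "shift_op b T = (\<lambda>\<phi>. T (\<lambda>x. \<phi> (x + b)))"

definition dir_deriv :: "real ^ 'n \<Rightarrow> 'n distribution \<Rightarrow> 'n distribution" where
  "dir_deriv a T = (\<lambda>\<phi>. - T (\<lambda>x. \<Sum>k\<in>UNIV. a $ k * partial k \<phi> x))"

definition frac_dir_deriv :: "real \<Rightarrow> real ^ 'n \<Rightarrow> 'n distribution \<Rightarrow> 'n distribution" where
  "frac_dir_deriv \<alpha> a T =
     (if \<alpha> = 1 then dir_deriv a T
      else dir_deriv a
        (\<lambda>\<phi>. 1 / Gamma (1 - \<alpha>) * (LBINT s:{0<..}. s powr (- \<alpha>) * shift_op (s *\<^sub>R a) T \<phi>)))"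

definition frac_dir_deriv_exists :: "real \<Rightarrow> real ^ 'n \<Rightarrow> 'n distribution \<Rightarrow> bool" where
  "frac_dir_deriv_exists \<alpha> a T \<longleftrightarrow>
     (\<alpha> \<noteq> 1 \<longrightarrow> (\<forall>\<phi>. test_function \<phi> \<longrightarrow>
        set_integrable lborel {0<..} (\<lambda>s. s powr (- \<alpha>) * shift_op (s *\<^sub>R a) T \<phi>)))"

section \<open>The equation\<close>

definition caputo_deriv :: "real \<Rightarrow> (real \<Rightarrow> real) \<Rightarrow> real \<Rightarrow> real" where
  "caputo_deriv \<beta> f t =
     (if \<beta> = 1 then deriv f t
      else 1 / Gamma (1 - \<beta>) * (LBINT s:{0<..<t}. deriv f s / (t - s) powr \<beta>))"

definition caputo_deriv_exists :: "real \<Rightarrow> (real \<Rightarrow> real) \<Rightarrow> real \<Rightarrow> bool" where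
  "caputo_deriv_exists \<beta> f t \<longleftrightarrow>
     (\<forall>s. 0 < s \<and> s \<le> t \<longrightarrow> f differentiable (at s)) \<and>
     (\<beta> \<noteq> 1 \<longrightarrow> set_integrable lborel {0<..<t} (\<lambda>s. deriv f s / (t - s) powr \<beta>))"

text \<open>The equation is understood pointwise in time and in the sense of distributions in space.
  Weak continuity on \<open>{0..}\<close> ties the solution for positive times to its initial datum
  \<open>\<delta>\<close>.\<close>

definition solves_equation ::
  "real \<Rightarrow> real \<Rightarrow> real \<Rightarrow> real ^ 'n \<Rightarrow> (real \<Rightarrow> (real ^ 'n) measure) \<Rightarrow> bool" where
  "solves_equation \<alpha> \<beta> lam a w \<longleftrightarrow>
     (\<forall>t\<ge>0. AE x in w t. \<forall>k. 0 \<le> x $ k) \<and>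
     w 0 = return borel 0 \<and>
     (\<forall>t>0. frac_dir_deriv_exists \<alpha> a (dist_of (w t))) \<and>
     (\<forall>\<phi>. test_function \<phi> \<longrightarrow>
        continuous_on {0..} (\<lambda>t. dist_of (w t) \<phi>) \<and>
        (\<forall>t>0. caputo_deriv_exists \<beta> (\<lambda>t. dist_of (w t) \<phi>) t \<and>
           caputo_deriv \<beta> (\<lambda>t. dist_of (w t) \<phi>) t =
             - (frac_dir_deriv \<alpha> a (dist_of (w t)) \<phi>
                + lam * (dist_of (w t) \<phi> - shift_op 1 (dist_of (w t)) \<phi>))))"

definition (in prob_space) stochastic_solution ::
  "real \<Rightarrow> real \<Rightarrow> real \<Rightarrow> real ^ 'n \<Rightarrow> (real \<Rightarrow> 'a \<Rightarrow> real ^ 'n) \<Rightarrow> bool" where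
  "stochastic_solution \<alpha> \<beta> lam a Y \<longleftrightarrow>
     (\<forall>t\<ge>0. random_variable borel (Y t)) \<and>
     solves_equation \<alpha> \<beta> lam a (\<lambda>t. distr M borel (Y t))"

end

theory Submission
  imports Defs "HOL-Real_Asymp.Real_Asymp"
begin

text \<open>
  Fix a test function \<open>\<phi>\<close> and put \<open>U s = E \<phi> (N\<^sub>s 1 + H\<^sub>s a)\<close>. Conditioning on the independent
  clock \<open>L\<close> gives \<open>E \<phi> (Y\<^sub>t) = E U (L\<^sub>t)\<close>, so the equation separates into two statements, one about
  \<open>U\<close> and one about \<open>L\<close>.

  In space, \<open>U\<close> is differentiable on \<open>s > 0\<close> and \<open>U' = V\<close>, where \<open>V\<close> is the same mean with
  \<open>\<phi>\<close> replaced by the transpose of the right-hand operator of the equation applied to \<open>\<phi>\<close>. Since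
  \<open>\<phi>\<close> has compact support and both processes are nonnegative, \<open>U\<close> is a finite sum over the values \<open>k\<close> of \<open>N\<^sub>s\<close> of Poisson weights times
  \<open>h\<^sub>k s = E \<phi> (k 1 + H\<^sub>s a)\<close>. The weights produce the shift term. By scaling \<open>H\<^sub>s\<close> has the law of
  \<open>s powr (1 / \<alpha>) * H\<^sub>1\<close>, so \<open>h\<^sub>k\<close> can be differentiated under the expectation; what comes out,
  \<open>E (H\<^sub>s \<psi> (H\<^sub>s)) / (\<alpha> s)\<close> with \<open>\<psi>\<close> the derivative of \<open>\<phi>\<close> along \<open>a\<close>, is the expectation of the fractional
  integral of \<open>\<psi>\<close> at \<open>H\<^sub>s\<close> (\<open>stable_integration_by_parts\<close>).

  In time, \<open>L\<^sub>t\<close> has the law of \<open>t powr \<beta> * Z\<close> with \<open>Z = K\<^sub>1 powr (- \<beta>)\<close>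
  (\<open>inverse_stable_subordinator_law\<close>), because \<open>L\<^sub>t \<le> l\<close> means \<open>K\<^sub>l \<ge> t\<close>. So \<open>f t = E U (t powr \<beta> * Z)\<close> has
  the derivative \<open>\<beta> t powr (\<beta> - 1) E (Z V (t powr \<beta> * Z))\<close>, which is integrable at \<open>0\<close>, and its
  Caputo derivative is \<open>E V (t powr \<beta> * Z)\<close> (\<open>caputo_inverse_stable\<close>). This is \<open>E V (L\<^sub>t)\<close>, the
  expectation at \<open>Y\<^sub>t\<close> of that transposed operator applied to \<open>\<phi>\<close>, which is the right-hand side.

  Scaling and both integral identities are statements that two weighted laws on the half line
  coincide. Each is proved by comparing Laplace transforms: stable laws are given by their Laplace
  transforms, and after substituting \<open>y = exp (- x)\<close> the Weierstrass theorem turns equality of these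
  into equality of all the integrals (\<open>laplace_unique_vanishing\<close>, \<open>laplace_unique_bounded\<close>).
\<close>

section \<open>Uniqueness of Laplace transforms and differentiation of integrals\<close>

text \<open>The measures and the variables \<open>XA\<close>, \<open>XB\<close> are kept apart so that the lemma also compares a law
  with an integral over a product space; the weights \<open>wA\<close>, \<open>wB\<close> may be non-integrable, since a
  factor \<open>exp (- X)\<close> can be taken out of a function that vanishes near infinity. With \<open>y = exp (- x)\<close>
  the remaining function extends continuously to \<open>{0..1}\<close>, and a uniform polynomial approximation
  there is an approximation by the exponentials \<open>exp (- n x)\<close>, \<open>n \<ge> 1\<close>.\<close>

lemma laplace_unique_vanishing:
  fixes A :: "'a measure" and B :: "'b measure"
    and wA XA :: "'a \<Rightarrow> real" and wB XB :: "'b \<Rightarrow> real" and \<psi> :: "real \<Rightarrow> real"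
  assumes meas [measurable]: "wA \<in> borel_measurable A" "XA \<in> borel_measurable A"
      "wB \<in> borel_measurable B" "XB \<in> borel_measurable B"
    and nnA: "AE x in A. 0 \<le> wA x \<and> 0 \<le> XA x"
    and nnB: "AE x in B. 0 \<le> wB x \<and> 0 \<le> XB x"
    and intA: "integrable A (\<lambda>x. wA x * exp (- XA x))"
    and intB: "integrable B (\<lambda>x. wB x * exp (- XB x))"
    and eq: "\<And>\<xi>. \<xi> \<ge> 1 \<Longrightarrow> (\<integral>x. wA x * exp (- \<xi> * XA x) \<partial>A) = (\<integral>x. wB x * exp (- \<xi> * XB x) \<partial>B)"
    and cont: "continuous_on UNIV \<psi>" and van: "\<And>x. x \<ge> R \<Longrightarrow> \<psi> x = 0"
  shows "(\<integral>x. wA x * \<psi> (XA x) \<partial>A) = (\<integral>x. wB x * \<psi> (XB x) \<partial>B)"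
proof -
  have [measurable]: "\<psi> \<in> borel_measurable borel"
    using cont by (simp add: borel_measurable_continuous_onI)
  \<comment> \<open>This is \<open>\<psi> x * exp x\<close> in the variable \<open>y = exp (- x)\<close>, extended by \<open>0\<close> at \<open>y = 0\<close>.\<close>
  define q where "q y = (if y \<le> exp (- R) then 0 else \<psi> (- ln y) / y)" for y :: real
  have contq: "continuous_on {0..1} q"
  proof -
    have "continuous_on ({..exp (- R)} \<union> {exp (- R)..}) q"
      unfolding q_def
    proof (rule continuous_on_If)
      show "continuous_on {exp (- R)..} (\<lambda>y. \<psi> (- ln y) / y)"
      proof -
        have p: "y > 0" if "y \<in> {exp (- R)..}" for y
          using that by (simp add: less_le_trans[OF exp_gt_zero])
        show ?thesis
          by (intro continuous_intros continuous_on_compose2[OF cont]) (auto dest: p)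
      qed
    qed (auto simp: van)
    then show ?thesis
      by (rule continuous_on_subset) auto
  qed
  have q_exp: "exp (- x) * q (exp (- x)) = \<psi> x" if "x \<ge> 0" for x
    using that van[of x] by (auto simp: q_def)
  define CA where "CA = (\<integral>x. wA x * exp (- XA x) \<partial>A)"
  define CB where "CB = (\<integral>x. wB x * exp (- XB x) \<partial>B)"
  have CAB: "CA = CB" using eq[of 1] by (simp add: CA_def CB_def)
  have approx: "\<bar>(\<integral>x. w x * \<psi> (X x) \<partial>D) - (\<Sum>i\<le>n. c i * (\<integral>x. w x * exp (- real (Suc i) * X x) \<partial>D))\<bar>
       \<le> e * (\<integral>x. w x * exp (- X x) \<partial>D)"
    if m [measurable]: "w \<in> borel_measurable D" "X \<in> borel_measurable D"
      and nn: "AE x in D. 0 \<le> w x \<and> 0 \<le> X x"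
      and int: "integrable D (\<lambda>x. w x * exp (- X x))" and e: "e > 0"
      and pq: "\<And>y. y \<in> {0..1} \<Longrightarrow> \<bar>q y - (\<Sum>i\<le>n. c i * y ^ i)\<bar> < e"
    for D :: "'c measure" and w X n c e
  proof -
    have int_k: "integrable D (\<lambda>x. w x * exp (- real (Suc i) * X x))" for i
    proof (rule Bochner_Integration.integrable_bound[OF int])
      show "AE x in D. norm (w x * exp (- real (Suc i) * X x)) \<le> norm (w x * exp (- X x))"
        using nn by eventually_elim (auto simp: abs_mult algebra_simps intro!: mult_left_mono)
    qed simp
    have int_s: "integrable D (\<lambda>x. \<Sum>i\<le>n. c i * (w x * exp (- real (Suc i) * X x)))"
      by (intro Bochner_Integration.integrable_sum integrable_mult_right int_k)
    have bd: "AE x in D. \<bar>w x * \<psi> (X x) - (\<Sum>i\<le>n. c i * (w x * exp (- real (Suc i) * X x)))\<bar>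
       \<le> e * (w x * exp (- X x))"
      using nn
    proof eventually_elim
      fix x assume x: "0 \<le> w x \<and> 0 \<le> X x"
      have "w x * \<psi> (X x) - (\<Sum>i\<le>n. c i * (w x * exp (- real (Suc i) * X x)))
          = w x * exp (- X x) * (q (exp (- X x)) - (\<Sum>i\<le>n. c i * exp (- X x) ^ i))"
      proof -
        have "exp (- real (Suc i) * X x) = exp (- X x) * exp (- X x) ^ i" for i
          by (simp add: exp_of_nat_mult[symmetric] exp_add[symmetric] algebra_simps)
        then show ?thesis
          using q_exp[of "X x"] x
          by (simp add: right_diff_distrib sum_distrib_left mult_ac)
      qed
      moreover have "\<bar>q (exp (- X x)) - (\<Sum>i\<le>n. c i * exp (- X x) ^ i)\<bar> \<le> e"
        using pq[of "exp (- X x)"] x by auto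
      ultimately show "\<bar>w x * \<psi> (X x) - (\<Sum>i\<le>n. c i * (w x * exp (- real (Suc i) * X x)))\<bar>
         \<le> e * (w x * exp (- X x))"
        using x by (auto simp: abs_mult mult.commute[of e] intro!: mult_left_mono)
    qed
    have int_d: "integrable D (\<lambda>x. w x * \<psi> (X x) - (\<Sum>i\<le>n. c i * (w x * exp (- real (Suc i) * X x))))"
      by (rule Bochner_Integration.integrable_bound[OF integrable_mult_right[OF int, of e]])
         (use bd nn e in \<open>auto elim!: eventually_elim2\<close>)
    have int_p: "integrable D (\<lambda>x. w x * \<psi> (X x))"
      using Bochner_Integration.integrable_add[OF int_d int_s] by simp
    have "(\<integral>x. w x * \<psi> (X x) \<partial>D) - (\<Sum>i\<le>n. c i * (\<integral>x. w x * exp (- real (Suc i) * X x) \<partial>D))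
      = (\<integral>x. w x * \<psi> (X x) - (\<Sum>i\<le>n. c i * (w x * exp (- real (Suc i) * X x))) \<partial>D)"
      using int_p int_s int_k by (simp add: integral_sum)
    also have "\<bar>\<dots>\<bar> \<le> (\<integral>x. e * (w x * exp (- X x)) \<partial>D)"
      using bd int int_d by (intro order_trans[OF integral_abs_bound] integral_mono_AE) auto
    finally show ?thesis by simp
  qed
  have "\<bar>(\<integral>x. wA x * \<psi> (XA x) \<partial>A) - (\<integral>x. wB x * \<psi> (XB x) \<partial>B)\<bar> \<le> e" if "e > 0" for e
  proof -
    have CA0: "CA \<ge> 0" unfolding CA_def using nnA by (intro integral_nonneg_AE) auto
    \<comment> \<open>The two approximation errors add up to \<open>2 * d * CA\<close>; the \<open>1\<close> covers \<open>CA = 0\<close>.\<close>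
    define d where "d = e / (2 * CA + 1)"
    have d: "d > 0" using that CA0 by (simp add: d_def)
    obtain g where g: "real_polynomial_function g" "\<And>x. x \<in> {0..1} \<Longrightarrow> \<bar>q x - g x\<bar> < d"
      using Stone_Weierstrass_real_polynomial_function[OF _ contq d] by auto
    then obtain c n where gc: "g = (\<lambda>x. \<Sum>i\<le>n. c i * x ^ i)"
      by (auto simp: real_polynomial_function_iff_sum)
    have pq: "\<bar>q x - (\<Sum>i\<le>n. c i * x ^ i)\<bar> < d" if "x \<in> {0..1}" for x
      using g(2)[OF that] by (simp add: gc)
    have "(\<Sum>i\<le>n. c i * (\<integral>x. wA x * exp (- real (Suc i) * XA x) \<partial>A))
       = (\<Sum>i\<le>n. c i * (\<integral>x. wB x * exp (- real (Suc i) * XB x) \<partial>B))"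
      by (intro sum.cong refl arg_cong2[of _ _ _ _ "(*)"] eq) auto
    then have "\<bar>(\<integral>x. wA x * \<psi> (XA x) \<partial>A) - (\<integral>x. wB x * \<psi> (XB x) \<partial>B)\<bar> \<le> d * CA + d * CB"
      using approx[OF meas(1,2) nnA intA d pq] approx[OF meas(3,4) nnB intB d pq]
      unfolding CA_def CB_def by linarith
    also have "\<dots> = e * (2 * CA / (2 * CA + 1))" by (simp add: CAB d_def field_simps)
    also have "\<dots> \<le> e * 1" using CA0 that by (intro mult_left_mono) auto
    finally show ?thesis by simp
  qed
  then have "\<bar>(\<integral>x. wA x * \<psi> (XA x) \<partial>A) - (\<integral>x. wB x * \<psi> (XB x) \<partial>B)\<bar> \<le> 0"
    by (rule field_le_epsilon[of _ 0, simplified])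
  then show ?thesis by simp
qed

text \<open>With integrable weights and strictly positive variables, dominated convergence removes the
  vanishing condition: \<open>\<psi>\<close> is cut off both near \<open>0\<close>, where it need not have a limit, and near
  infinity. This matters for \<open>\<psi> x = v (x powr (- \<beta>))\<close>.\<close>

lemma laplace_unique_bounded:
  fixes A :: "'a measure" and B :: "'b measure"
    and wA XA :: "'a \<Rightarrow> real" and wB XB :: "'b \<Rightarrow> real" and \<psi> :: "real \<Rightarrow> real"
  assumes meas [measurable]: "wA \<in> borel_measurable A" "XA \<in> borel_measurable A"
      "wB \<in> borel_measurable B" "XB \<in> borel_measurable B" "\<psi> \<in> borel_measurable borel"
    and nnA: "AE x in A. 0 \<le> wA x \<and> 0 < XA x"
    and nnB: "AE x in B. 0 \<le> wB x \<and> 0 < XB x"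
    and intA: "integrable A wA" and intB: "integrable B wB"
    and eq: "\<And>\<xi>. \<xi> \<ge> 1 \<Longrightarrow> (\<integral>x. wA x * exp (- \<xi> * XA x) \<partial>A) = (\<integral>x. wB x * exp (- \<xi> * XB x) \<partial>B)"
    and cont: "continuous_on {0<..} \<psi>" and bd: "\<And>x. x > 0 \<Longrightarrow> \<bar>\<psi> x\<bar> \<le> C"
  shows "(\<integral>x. wA x * \<psi> (XA x) \<partial>A) = (\<integral>x. wB x * \<psi> (XB x) \<partial>B)"
proof -
  \<comment> \<open>Zero outside \<open>{1 / n..n}\<close> and one on \<open>{2 / n..n - 1}\<close>.\<close>
  define cut :: "nat \<Rightarrow> real \<Rightarrow> real"
    where "cut n x = max 0 (min 1 (real n * x - 1)) * max 0 (min 1 (real n - x))" for n x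
  \<comment> \<open>Already \<open>cut n\<close> vanishes up to \<open>1 / (n + 1)\<close>; the case distinction makes continuity at \<open>x \<le> 0\<close> visible,
    where nothing is known about \<open>\<psi>\<close>.\<close>
  define \<psi>n where "\<psi>n n x = (if x \<le> 1 / (real n + 1) then 0 else cut n x * \<psi> x)" for n x
  have cut_le: "0 \<le> cut n x" "cut n x \<le> 1" for n x
    unfolding cut_def by (auto intro!: mult_le_one mult_nonneg_nonneg)
  have cont_n: "continuous_on UNIV (\<psi>n n)" for n
  proof -
    have "continuous_on ({..1 / (real n + 1)} \<union> {1 / (real n + 1)..}) (\<psi>n n)"
      unfolding \<psi>n_def
    proof (rule continuous_on_If)
      have "x > 0" if "x \<in> {1 / (real n + 1)..}" for x
        using that by (simp add: less_le_trans[of 0 "1 / (real n + 1)"])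
      then show "continuous_on {1 / (real n + 1)..} (\<lambda>x. cut n x * \<psi> x)"
        unfolding cut_def by (intro continuous_intros continuous_on_subset[OF cont]) auto
      have c0: "cut n (1 / (real n + 1)) = 0"
        by (simp add: cut_def min_def max_def field_simps)
      show "0 = cut n x * \<psi> x" if "x \<in> {1 / (real n + 1)..}" "x \<le> 1 / (real n + 1)" for x
        using that c0 by (simp add: order_antisym)
      show "0 = cut n x * \<psi> x" if "x \<in> {..1 / (real n + 1)}" "\<not> x \<le> 1 / (real n + 1)" for x
        using that by simp
    qed auto
    moreover have "{..1 / (real n + 1)} \<union> {1 / (real n + 1)..} = (UNIV :: real set)" by auto
    ultimately show ?thesis by simp
  qed
  have van_n: "\<psi>n n x = 0" if "x \<ge> real n" for n x
    using that by (auto simp: \<psi>n_def cut_def)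
  have lim_n: "(\<lambda>n. \<psi>n n x) \<longlonglongrightarrow> \<psi> x" if "x > 0" for x
  proof (rule tendsto_eventually)
    obtain n0 :: nat where n0: "real n0 \<ge> max (2 / x) (x + 1)" using real_arch_simple by blast
    have "\<psi>n n x = \<psi> x" if "n \<ge> n0" for n
    proof -
      have a: "real n \<ge> 2 / x" "real n \<ge> x + 1" using n0 that by auto
      have "real n * x \<ge> 2" using a(1) \<open>x > 0\<close> by (simp add: field_simps)
      moreover have "\<not> x \<le> 1 / (real n + 1)" using calculation \<open>x > 0\<close> by (simp add: field_simps)
      ultimately show ?thesis using a(2) by (simp add: \<psi>n_def cut_def)
    qed
    then show "\<forall>\<^sub>F n in sequentially. \<psi>n n x = \<psi> x"
      unfolding eventually_sequentially by blast
  qed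
  have bd_n: "\<bar>\<psi>n n x\<bar> \<le> C" if "x > 0" for n x
    using bd[OF that] cut_le[of n x] order_trans[OF abs_ge_zero bd[OF that]]
    by (auto simp: \<psi>n_def abs_mult intro: order_trans[OF mult_left_le_one_le])
  have [measurable]: "\<psi>n n \<in> borel_measurable borel" for n
    using cont_n by (simp add: borel_measurable_continuous_onI)
  have lim: "(\<lambda>n. \<integral>x. w x * \<psi>n n (X x) \<partial>D) \<longlonglongrightarrow> (\<integral>x. w x * \<psi> (X x) \<partial>D)"
    if m [measurable]: "w \<in> borel_measurable D" "X \<in> borel_measurable D"
      and nn: "AE x in D. 0 \<le> w x \<and> 0 < X x" and int: "integrable D w"
    for D :: "'c measure" and w X
  proof (rule integral_dominated_convergence[where w="\<lambda>x. C * w x"])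
    show "AE x in D. (\<lambda>n. w x * \<psi>n n (X x)) \<longlonglongrightarrow> w x * \<psi> (X x)"
      using nn by eventually_elim (auto intro!: tendsto_intros lim_n)
    show "AE x in D. norm (w x * \<psi>n n (X x)) \<le> C * w x" for n
      using nn by eventually_elim (auto simp: abs_mult mult.commute[of C] intro!: mult_left_mono bd_n)
  qed (use int in auto)
  have expint: "integrable D (\<lambda>x. w x * exp (- X x))"
    if m [measurable]: "w \<in> borel_measurable D" "X \<in> borel_measurable D"
      and nn: "AE x in D. 0 \<le> w x \<and> 0 < X x" and int: "integrable D w"
    for D :: "'c measure" and w X :: "'c \<Rightarrow> real"
  proof (rule Bochner_Integration.integrable_bound[OF int])
    show "AE x in D. norm (w x * exp (- X x)) \<le> norm (w x)"
      using nn by eventually_elim (simp add: abs_mult mult_left_le)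
  qed simp
  have nnA': "AE x in A. 0 \<le> wA x \<and> 0 \<le> XA x" and nnB': "AE x in B. 0 \<le> wB x \<and> 0 \<le> XB x"
    using nnA nnB by (auto elim: eventually_mono)
  have "(\<integral>x. wA x * \<psi>n n (XA x) \<partial>A) = (\<integral>x. wB x * \<psi>n n (XB x) \<partial>B)" for n
    by (rule laplace_unique_vanishing[OF meas(1-4) nnA' nnB' expint[OF meas(1,2) nnA intA] expint[OF meas(3,4) nnB intB] eq cont_n van_n])
  then show ?thesis
    using lim[OF meas(1,2) nnA intA] lim[OF meas(3,4) nnB intB] LIMSEQ_unique by auto
qed

lemma nn_integral_gamma_scaled:
  assumes p: "p > 0" and k: "k > (0::real)"
  shows "(\<integral>\<^sup>+y\<in>{0<..}. ennreal (y powr (p - 1) * exp (- k * y)) \<partial>lborel) = ennreal (Gamma p * k powr (- p))"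
proof -
  have "ennreal (Gamma p) = (\<integral>\<^sup>+t. ennreal (indicator {0..} t * t powr (p - 1) / exp t) \<partial>lborel)"
    by (rule Gamma_conv_nn_integral_real[OF p])
  also have "\<dots> = ennreal \<bar>k\<bar> * (\<integral>\<^sup>+y. ennreal (indicator {0..} (0 + k * y) * (0 + k * y) powr (p - 1) / exp (0 + k * y)) \<partial>lborel)"
    using k by (intro nn_integral_real_affine) auto
  also have "\<dots> = (\<integral>\<^sup>+y. ennreal (k powr p) * (ennreal (y powr (p - 1) * exp (- k * y)) * indicator {0<..} y) \<partial>lborel)"
    unfolding abs_of_pos[OF k]
    by (subst nn_integral_cmult[symmetric], simp, intro nn_integral_cong_AE, use AE_lborel_singleton[of 0] in eventually_elim)
       (use k in \<open>auto simp: indicator_def ennreal_mult'[symmetric] powr_mult powr_diff exp_minus field_simps zero_le_mult_iff split: if_splits\<close>)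
  also have "\<dots> = ennreal (k powr p) * (\<integral>\<^sup>+y\<in>{0<..}. ennreal (y powr (p - 1) * exp (- k * y)) \<partial>lborel)"
    by (rule nn_integral_cmult) simp
  finally have "ennreal (k powr (- p)) * ennreal (Gamma p) = ennreal (k powr (- p)) * (ennreal (k powr p) * (\<integral>\<^sup>+y\<in>{0<..}. ennreal (y powr (p - 1) * exp (- k * y)) \<partial>lborel))"
    by simp
  then show ?thesis
    using k p by (simp add: mult.assoc[symmetric] ennreal_mult'[symmetric] ennreal_mult''[symmetric] powr_add[symmetric] mult.commute)
qed

text \<open>Difference quotients are bounded by \<open>b\<close> through the mean value theorem, so dominated convergence
  along sequences applies.\<close>

lemma has_real_derivative_integral:
  fixes g g' :: "real \<Rightarrow> 'a \<Rightarrow> real"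
  assumes r: "r > 0"
    and int: "\<And>t. \<bar>t - t0\<bar> < r \<Longrightarrow> integrable D (g t)"
    and m: "g' t0 \<in> borel_measurable D"
    and der: "AE x in D. \<forall>t. \<bar>t - t0\<bar> < r \<longrightarrow> ((\<lambda>t. g t x) has_real_derivative g' t x) (at t) \<and> \<bar>g' t x\<bar> \<le> b x"
    and b: "integrable D b"
  shows "((\<lambda>t. \<integral>x. g t x \<partial>D) has_real_derivative (\<integral>x. g' t0 x \<partial>D)) (at t0)"
proof -
  have "((\<lambda>h. ((\<integral>x. g (t0 + h) x \<partial>D) - (\<integral>x. g t0 x \<partial>D)) / h) \<longlongrightarrow> (\<integral>x. g' t0 x \<partial>D)) (at 0)"
    unfolding tendsto_at_iff_sequentially comp_def
  proof (intro allI impI)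
    fix X :: "nat \<Rightarrow> real" assume X0: "\<forall>i. X i \<in> UNIV - {0}" and X: "X \<longlonglongrightarrow> 0"
    then have "\<forall>\<^sub>F i in sequentially. \<bar>X i\<bar> < r"
      using r by (auto simp: tendsto_iff dist_real_def)
    then obtain n where n: "\<And>i. i \<ge> n \<Longrightarrow> \<bar>X i\<bar> < r"
      by (auto simp: eventually_sequentially)
    define Y where "Y i = X (i + n)" for i
    have Y: "Y \<longlonglongrightarrow> 0" and Yr: "\<bar>Y i\<bar> < r" and Y0: "Y i \<noteq> 0" for i
      using LIMSEQ_ignore_initial_segment[OF X, of n] n X0 by (auto simp: Y_def[abs_def])
    have "(\<lambda>i. \<integral>x. (g (t0 + Y i) x - g t0 x) / Y i \<partial>D) \<longlonglongrightarrow> (\<integral>x. g' t0 x \<partial>D)"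
    proof (rule integral_dominated_convergence[where w=b])
      show "AE x in D. (\<lambda>i. (g (t0 + Y i) x - g t0 x) / Y i) \<longlonglongrightarrow> g' t0 x"
        using der
      proof eventually_elim
        fix x assume "\<forall>t. \<bar>t - t0\<bar> < r \<longrightarrow> ((\<lambda>t. g t x) has_real_derivative g' t x) (at t) \<and> \<bar>g' t x\<bar> \<le> b x"
        then have "((\<lambda>t. g t x) has_real_derivative g' t0 x) (at t0)" using r by simp
        then have "((\<lambda>h. (g (t0 + h) x - g t0 x) / h) \<longlongrightarrow> g' t0 x) (at 0)" by (simp add: DERIV_def)
        then show "(\<lambda>i. (g (t0 + Y i) x - g t0 x) / Y i) \<longlonglongrightarrow> g' t0 x"
          using Y Y0 by (auto simp: tendsto_at_iff_sequentially comp_def)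
      qed
      show "AE x in D. norm ((g (t0 + Y i) x - g t0 x) / Y i) \<le> b x" for i
        using der
      proof eventually_elim
        fix x assume *: "\<forall>t. \<bar>t - t0\<bar> < r \<longrightarrow> ((\<lambda>t. g t x) has_real_derivative g' t x) (at t) \<and> \<bar>g' t x\<bar> \<le> b x"
        have "norm (g (t0 + Y i) x - g t0 x) \<le> b x * norm (t0 + Y i - t0)"
        proof (rule field_differentiable_bound[of "ball t0 r" "\<lambda>t. g t x" "\<lambda>t. g' t x"])
          show "t0 \<in> ball t0 r" "t0 + Y i \<in> ball t0 r" using r Yr[of i] by (auto simp: dist_real_def)
        qed (use * in \<open>auto simp: dist_real_def abs_minus_commute intro: has_field_derivative_at_within\<close>)
        then show "norm ((g (t0 + Y i) x - g t0 x) / Y i) \<le> b x"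
          using Y0[of i] by (simp add: field_simps)
      qed
      show "(\<lambda>x. (g (t0 + Y i) x - g t0 x) / Y i) \<in> borel_measurable D" for i
        using int[of "t0 + Y i"] int[of t0] Yr[of i] r by auto
    qed (use m b in auto)
    moreover have "(\<integral>x. (g (t0 + Y i) x - g t0 x) / Y i \<partial>D) = ((\<integral>x. g (t0 + Y i) x \<partial>D) - (\<integral>x. g t0 x \<partial>D)) / Y i" for i
      using int[of "t0 + Y i"] int[of t0] Yr[of i] r by simp
    ultimately have "(\<lambda>i. ((\<integral>x. g (t0 + Y i) x \<partial>D) - (\<integral>x. g t0 x \<partial>D)) / Y i) \<longlonglongrightarrow> (\<integral>x. g' t0 x \<partial>D)"
      by (simp only:)
    then have "(\<lambda>i. ((\<integral>x. g (t0 + X (i + n)) x \<partial>D) - (\<integral>x. g t0 x \<partial>D)) / X (i + n)) \<longlonglongrightarrow> (\<integral>x. g' t0 x \<partial>D)"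
      by (simp add: Y_def)
    then show "(\<lambda>i. ((\<integral>x. g (t0 + X i) x \<partial>D) - (\<integral>x. g t0 x \<partial>D)) / X i) \<longlonglongrightarrow> (\<integral>x. g' t0 x \<partial>D)"
      by (rule LIMSEQ_offset)
  qed
  then show ?thesis by (simp add: DERIV_def)
qed

section \<open>The fractional integral and stable laws\<close>

lemma vanishing_bounded:
  fixes \<psi> :: "real \<Rightarrow> real"
  assumes "continuous_on UNIV \<psi>" "\<And>x. x \<ge> R \<Longrightarrow> \<psi> x = 0"
  obtains C where "C \<ge> 0" "\<And>x. x \<ge> 0 \<Longrightarrow> \<bar>\<psi> x\<bar> \<le> C"
proof -
  have "compact (\<psi> ` {0..R})"
    by (intro compact_continuous_image continuous_on_subset[OF assms(1)]) auto
  then obtain C where C: "\<And>x. x \<in> {0..R} \<Longrightarrow> \<bar>\<psi> x\<bar> \<le> C"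
    by (force dest!: compact_imp_bounded simp: bounded_iff)
  have "\<bar>\<psi> x\<bar> \<le> max 0 C" if "x \<ge> 0" for x
    using C[of x] assms(2)[of x] that by (cases "x \<le> R") auto
  then show ?thesis using that[of "max 0 C"] by auto
qed

lemma has_bochner_integral_gamma:
  assumes p: "p > 0" and k: "k > (0::real)"
  shows "has_bochner_integral lborel (\<lambda>y. indicator {0<..} y * (y powr (p - 1) * exp (- k * y))) (Gamma p * k powr (- p))"
proof (rule has_bochner_integral_nn_integral)
  show "(\<integral>\<^sup>+y. ennreal (indicator {0<..} y * (y powr (p - 1) * exp (- k * y))) \<partial>lborel) = ennreal (Gamma p * k powr (- p))"
    by (subst nn_integral_gamma_scaled[OF p k, symmetric], intro nn_integral_cong) (auto simp: indicator_def)
qed (use p in auto)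

text \<open>On \<open>{0<..R}\<close> the integrand is at most \<open>exp R\<close> times the Gamma integrand.\<close>

lemma integrable_powr_cutoff:
  assumes "\<alpha> < (1::real)"
  shows "integrable lborel (\<lambda>r. indicator {0<..R} r * r powr (- \<alpha>))"
proof (rule Bochner_Integration.integrable_bound)
  show "integrable lborel (\<lambda>y. exp R * (indicator {0<..} y * (y powr ((1 - \<alpha>) - 1) * exp (- 1 * y))))"
    using has_bochner_integral_gamma[of "1 - \<alpha>" 1] assms
    by (intro integrable_mult_right) (auto simp: has_bochner_integral_iff)
  show "AE r in lborel. norm (indicator {0<..R} r * r powr - \<alpha>)
     \<le> norm (exp R * (indicator {0<..} r * (r powr (1 - \<alpha> - 1) * exp (- 1 * r))))"
  proof (intro AE_I2)
    fix r :: real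
    have "1 \<le> exp R * exp (- r)" if "r \<le> R" using that by (simp add: exp_add[symmetric])
    then show "norm (indicator {0<..R} r * r powr - \<alpha>)
     \<le> norm (exp R * (indicator {0<..} r * (r powr (1 - \<alpha> - 1) * exp (- 1 * r))))"
      using mult_right_mono[of 1 "exp R * exp (- r)" "r powr - \<alpha>"]
      by (auto simp: indicator_def abs_mult mult_ac)
  qed
qed simp

text \<open>The Weyl fractional integral of order \<open>1 - \<alpha>\<close>. Applied to the derivative of \<open>f\<close> it is, on the
  half line, the generator of the \<open>\<alpha>\<close>-stable subordinator at \<open>f\<close>; along a line it is minus the
  transpose of the fractional directional derivative. For \<open>\<alpha> < 1\<close> the argument is frozen at \<open>0\<close> on the
  left, so that only the values of \<open>\<psi>\<close> on the half line enter and the continuity of the integral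
  there extends to the whole line.\<close>

definition weyl_integral :: "real \<Rightarrow> (real \<Rightarrow> real) \<Rightarrow> real \<Rightarrow> real" where
  "weyl_integral \<alpha> \<psi> x = (if \<alpha> = 1 then \<psi> x
     else 1 / Gamma (1 - \<alpha>) * (LBINT r:{0<..}. r powr (- \<alpha>) * \<psi> (max 0 x + r)))"

lemma weyl_integrand_bound:
  assumes "\<And>x. x \<ge> 0 \<Longrightarrow> \<bar>\<psi> x\<bar> \<le> C" "\<And>x. x \<ge> R \<Longrightarrow> \<psi> x = (0::real)" "0 \<le> y"
  shows "\<bar>indicator {0<..} r * (r powr (- \<alpha>) * \<psi> (y + r))\<bar> \<le> C * (indicator {0<..R} r * r powr (- \<alpha>))"
  using assms(1)[of "y + r"] assms(2)[of "y + r"] assms(3)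
  by (auto simp: indicator_def abs_mult mult.commute[of C] intro!: mult_left_mono)

lemma weyl_integral_vanishes:
  assumes "\<And>x. x \<ge> R \<Longrightarrow> \<psi> x = 0" "x \<ge> R"
  shows "weyl_integral \<alpha> \<psi> x = 0"
proof -
  have "indicator {0<..} r *\<^sub>R (r powr (- \<alpha>) * \<psi> (max 0 x + r)) = 0" for r :: real
    using assms(1)[of "max 0 x + r"] assms(2) by (cases "r > 0") (auto simp: max_def)
  then have "(LBINT r:{0<..}. r powr (- \<alpha>) * \<psi> (max 0 x + r)) = 0"
    unfolding set_lebesgue_integral_def by (simp only: integral_zero)
  then show ?thesis
    using assms by (simp add: weyl_integral_def)
qed

lemma continuous_weyl_integral:
  assumes \<alpha>: "\<alpha> \<le> 1" and cont: "continuous_on UNIV \<psi>" and van: "\<And>x. x \<ge> R \<Longrightarrow> \<psi> x = 0"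
  shows "continuous_on UNIV (weyl_integral \<alpha> \<psi>)"
proof (cases "\<alpha> = 1")
  case False
  then have \<alpha>: "\<alpha> < 1" using \<alpha> by simp
  obtain C where C: "C \<ge> 0" "\<And>x. x \<ge> 0 \<Longrightarrow> \<bar>\<psi> x\<bar> \<le> C" using vanishing_bounded[OF cont van] by metis
  have [measurable]: "\<psi> \<in> borel_measurable borel"
    using cont by (simp add: borel_measurable_continuous_onI)
  have "continuous_on UNIV (\<lambda>x. LBINT r:{0<..}. r powr (- \<alpha>) * \<psi> (max 0 x + r))"
    unfolding set_lebesgue_integral_def continuous_on_sequentially comp_def real_scaleR_def
  proof (intro allI ballI impI, elim conjE)
    fix X :: "nat \<Rightarrow> real" and x assume X: "X \<longlonglongrightarrow> x"
    show "(\<lambda>n. \<integral>r. indicator {0<..} r * (r powr (- \<alpha>) * \<psi> (max 0 (X n) + r)) \<partial>lborel)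
      \<longlonglongrightarrow> (\<integral>r. indicator {0<..} r * (r powr (- \<alpha>) * \<psi> (max 0 x + r)) \<partial>lborel)"
    proof (rule integral_dominated_convergence[where w="\<lambda>r. C * (indicator {0<..R} r * r powr (- \<alpha>))"])
      show "AE r in lborel. (\<lambda>n. indicator {0<..} r * (r powr (- \<alpha>) * \<psi> (max 0 (X n) + r)))
         \<longlonglongrightarrow> indicator {0<..} r * (r powr (- \<alpha>) * \<psi> (max 0 x + r))"
        by (intro AE_I2 tendsto_intros continuous_on_tendsto_compose[OF cont] X) auto
      show "AE r in lborel. norm (indicator {0<..} r * (r powr - \<alpha> * \<psi> (max 0 (X n) + r)))
         \<le> C * (indicator {0<..R} r * r powr - \<alpha>)" for n
        using weyl_integrand_bound[of \<psi> C R "max 0 (X n)"] C van by auto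
    qed (use integrable_powr_cutoff[OF \<alpha>] in auto)
  qed
  from continuous_on_mult_left[OF this, of "1 / Gamma (1 - \<alpha>)"] show ?thesis
    unfolding weyl_integral_def[abs_def] by (simp only: False if_False)
qed (use cont in \<open>simp add: weyl_integral_def[abs_def]\<close>)

context prob_space
begin

lemma integrable_exp_nonneg:
  fixes X :: "'a \<Rightarrow> real"
  assumes [measurable]: "X \<in> borel_measurable M" and X0: "AE \<omega> in M. 0 \<le> X \<omega>" and "0 \<le> (\<xi>::real)"
  shows "integrable M (\<lambda>\<omega>. exp (- \<xi> * X \<omega>))"
  by (rule integrable_const_bound[where B=1]) (use X0 assms(3) in \<open>auto elim!: eventually_mono\<close>)

text \<open>Differentiate the Laplace transform \<open>exp (- s * \<xi> powr \<alpha>)\<close> under the expectation; near \<open>\<xi> > 0\<close> the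
  derivative is dominated by a constant because \<open>y * exp (- y) \<le> 1\<close>.\<close>

lemma stable_laplace_deriv:
  fixes X :: "'a \<Rightarrow> real"
  assumes [measurable]: "X \<in> borel_measurable M" and X0: "AE \<omega> in M. 0 \<le> X \<omega>"
    and lap: "\<And>\<xi>. \<xi> \<ge> 0 \<Longrightarrow> expectation (\<lambda>\<omega>. exp (- \<xi> * X \<omega>)) = exp (- s * \<xi> powr \<alpha>)"
    and \<xi>: "\<xi> > (0::real)"
  shows "has_bochner_integral M (\<lambda>\<omega>. X \<omega> * exp (- \<xi> * X \<omega>)) (s * \<alpha> * \<xi> powr (\<alpha> - 1) * exp (- s * \<xi> powr \<alpha>))"
proof -
  have bound: "\<bar>X \<omega> * exp (- t * X \<omega>)\<bar> \<le> 2 / \<xi>" if "X \<omega> \<ge> 0" "t > \<xi> / 2" for \<omega> t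
  proof -
    have "X \<omega> * t \<le> exp (t * X \<omega>)" using exp_ge_add_one_self[of "t * X \<omega>"] by (subst mult.commute) linarith
    then have "X \<omega> * exp (- t * X \<omega>) \<le> 1 / t"
      using that \<xi> by (simp add: exp_minus field_simps)
    also have "\<dots> \<le> 2 / \<xi>" using that \<xi> by (simp add: field_simps)
    finally show ?thesis using that by simp
  qed
  have int: "integrable M (\<lambda>\<omega>. X \<omega> * exp (- \<xi> * X \<omega>))"
    by (rule integrable_const_bound[where B="2 / \<xi>"])
       (use X0 bound[of _ \<xi>] \<xi> in \<open>auto elim!: eventually_mono\<close>)
  have "((\<lambda>t. expectation (\<lambda>\<omega>. exp (- t * X \<omega>))) has_real_derivative (\<integral>\<omega>. - X \<omega> * exp (- \<xi> * X \<omega>) \<partial>M)) (at \<xi>)"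
  proof (rule has_real_derivative_integral[where r="\<xi> / 2" and b="\<lambda>_. 2 / \<xi>" and g'="\<lambda>t \<omega>. - X \<omega> * exp (- t * X \<omega>)"])
    show "integrable M (\<lambda>\<omega>. exp (- t * X \<omega>))" if "\<bar>t - \<xi>\<bar> < \<xi> / 2" for t
      using that by (intro integrable_exp_nonneg X0) (auto simp: abs_if split: if_splits)
    show "AE \<omega> in M. \<forall>t. \<bar>t - \<xi>\<bar> < \<xi> / 2 \<longrightarrow>
      ((\<lambda>t. exp (- t * X \<omega>)) has_real_derivative - X \<omega> * exp (- t * X \<omega>)) (at t) \<and> \<bar>- X \<omega> * exp (- t * X \<omega>)\<bar> \<le> 2 / \<xi>"
      using X0
    proof (eventually_elim, intro allI impI conjI)
      fix \<omega> t assume *: "0 \<le> X \<omega>" "\<bar>t - \<xi>\<bar> < \<xi> / 2"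
      show "((\<lambda>t. exp (- t * X \<omega>)) has_real_derivative - X \<omega> * exp (- t * X \<omega>)) (at t)"
        by (auto intro!: derivative_eq_intros)
      show "\<bar>- X \<omega> * exp (- t * X \<omega>)\<bar> \<le> 2 / \<xi>"
        using bound[of \<omega> t] * by (auto simp: abs_if split: if_splits)
    qed
  qed (use \<xi> in auto)
  moreover have "((\<lambda>t. expectation (\<lambda>\<omega>. exp (- t * X \<omega>))) has_real_derivative - (s * \<alpha> * \<xi> powr (\<alpha> - 1) * exp (- s * \<xi> powr \<alpha>))) (at \<xi>)"
  proof (rule has_field_derivative_transform_within_open[where S="{0<..}" and f="\<lambda>t. exp (- s * t powr \<alpha>)"])
    show "((\<lambda>t. exp (- s * t powr \<alpha>)) has_real_derivative - (s * \<alpha> * \<xi> powr (\<alpha> - 1) * exp (- s * \<xi> powr \<alpha>))) (at \<xi>)"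
      using \<xi> by (auto intro!: derivative_eq_intros)
  qed (use \<xi> lap in auto)
  ultimately have "(\<integral>\<omega>. - X \<omega> * exp (- \<xi> * X \<omega>) \<partial>M) = - (s * \<alpha> * \<xi> powr (\<alpha> - 1) * exp (- s * \<xi> powr \<alpha>))"
    by (rule DERIV_unique)
  then show ?thesis using int by (simp add: has_bochner_integral_iff)
qed

text \<open>Both sides are integrals of \<open>\<psi>\<close> against measures with the Laplace transform
  \<open>\<xi> powr (\<alpha> - 1) * exp (- s * \<xi> powr \<alpha>)\<close>: on the left it is a derivative of the transform of \<open>X\<close>,
  on the right it is the product of that transform with the transform of the kernel
  \<open>r powr (- \<alpha>) / Gamma (1 - \<alpha>)\<close>. For \<open>\<alpha> < 1\<close> both measures are infinite, which is why
  \<open>\<psi>\<close> has to vanish near infinity.\<close>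

lemma stable_integration_by_parts:
  fixes X :: "'a \<Rightarrow> real"
  assumes [measurable]: "X \<in> borel_measurable M" and X0: "AE \<omega> in M. 0 \<le> X \<omega>"
    and lap: "\<And>\<xi>. \<xi> \<ge> 0 \<Longrightarrow> expectation (\<lambda>\<omega>. exp (- \<xi> * X \<omega>)) = exp (- s * \<xi> powr \<alpha>)"
    and \<alpha>: "0 < \<alpha>" "\<alpha> \<le> 1" and s: "s > 0"
    and cont: "continuous_on UNIV \<psi>" and van: "\<And>x. x \<ge> R \<Longrightarrow> \<psi> x = 0"
  shows "expectation (\<lambda>\<omega>. X \<omega> / (\<alpha> * s) * \<psi> (X \<omega>)) = expectation (\<lambda>\<omega>. weyl_integral \<alpha> \<psi> (X \<omega>))"
proof -
  have lapX: "has_bochner_integral M (\<lambda>\<omega>. X \<omega> / (\<alpha> * s) * exp (- \<xi> * X \<omega>)) (\<xi> powr (\<alpha> - 1) * exp (- s * \<xi> powr \<alpha>))" if "\<xi> > 0" for \<xi>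
    using has_bochner_integral_mult_right[OF stable_laplace_deriv[OF assms(1) X0 lap that], of "1 / (\<alpha> * s)"] \<alpha> s
    by simp
  have nnX: "AE \<omega> in M. 0 \<le> X \<omega> / (\<alpha> * s) \<and> 0 \<le> X \<omega>"
    using X0 by eventually_elim (use \<alpha> s in auto)
  have intX: "integrable M (\<lambda>\<omega>. X \<omega> / (\<alpha> * s) * exp (- X \<omega>))"
    using lapX[of 1] by (simp add: has_bochner_integral_iff)
  have [measurable]: "\<psi> \<in> borel_measurable borel"
    using cont by (simp add: borel_measurable_continuous_onI)
  show ?thesis
  proof (cases "\<alpha> = 1")
    case True
    have "expectation (\<lambda>\<omega>. X \<omega> / (\<alpha> * s) * \<psi> (X \<omega>)) = expectation (\<lambda>\<omega>. 1 * \<psi> (X \<omega>))"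
    proof (rule laplace_unique_vanishing[OF _ _ _ _ nnX _ intX _ _ cont van])
      show "integrable M (\<lambda>\<omega>. 1 * exp (- X \<omega>))"
        using integrable_exp_nonneg[OF assms(1) X0, of 1] by simp
      show "expectation (\<lambda>\<omega>. X \<omega> / (\<alpha> * s) * exp (- \<xi> * X \<omega>)) = expectation (\<lambda>\<omega>. 1 * exp (- \<xi> * X \<omega>))" if "1 \<le> \<xi>" for \<xi>
        using lapX[of \<xi>] lap[of \<xi>] that True by (simp add: has_bochner_integral_iff)
    qed (use X0 in auto)
    then show ?thesis using True by (simp add: weyl_integral_def)
  next
    case False
    then have \<alpha>1: "\<alpha> < 1" using \<alpha> by simp
    interpret P: pair_sigma_finite M lborel ..
    define c where "c = 1 / Gamma (1 - \<alpha>)"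
    have G: "Gamma (1 - \<alpha>) > 0" using \<alpha>1 by simp
    have c: "c > 0" using \<alpha>1 by (simp add: c_def)
    \<comment> \<open>The convolution of the kernel with the law of \<open>X\<close>, realised on a product space. The
      absolute value and the maximum make it nonnegative everywhere; almost everywhere
      on the support of the weight neither changes it.\<close>
    define w where "w p = c * (indicator {0<..} (snd p) * snd p powr (- \<alpha>))" for p :: "'a \<times> real"
    define Z where "Z p = max 0 (X (fst p)) + \<bar>snd p\<bar>" for p :: "'a \<times> real"
    have [measurable]: "w \<in> borel_measurable (M \<Otimes>\<^sub>M lborel)" "Z \<in> borel_measurable (M \<Otimes>\<^sub>M lborel)"
      unfolding w_def[abs_def] Z_def[abs_def] by measurable
    have lapZ: "has_bochner_integral (M \<Otimes>\<^sub>M lborel) (\<lambda>p. w p * exp (- \<xi> * Z p)) (\<xi> powr (\<alpha> - 1) * exp (- s * \<xi> powr \<alpha>))"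
      if \<xi>: "\<xi> > 0" for \<xi>
    proof (rule has_bochner_integral_nn_integral)
      have "(\<integral>\<^sup>+p. ennreal (w p * exp (- \<xi> * Z p)) \<partial>(M \<Otimes>\<^sub>M lborel))
         = (\<integral>\<^sup>+\<omega>. \<integral>\<^sup>+r. ennreal (w (\<omega>, r) * exp (- \<xi> * Z (\<omega>, r))) \<partial>lborel \<partial>M)"
        by (rule lborel.nn_integral_fst[symmetric]) simp
      also have "\<dots> = (\<integral>\<^sup>+\<omega>. ennreal (\<xi> powr (\<alpha> - 1)) * ennreal (exp (- \<xi> * max 0 (X \<omega>))) \<partial>M)"
      proof (rule nn_integral_cong)
        fix \<omega>
        have "(\<integral>\<^sup>+r. ennreal (w (\<omega>, r) * exp (- \<xi> * Z (\<omega>, r))) \<partial>lborel)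
          = (\<integral>\<^sup>+r. ennreal (c * exp (- \<xi> * max 0 (X \<omega>))) * (ennreal (r powr ((1 - \<alpha>) - 1) * exp (- \<xi> * r)) * indicator {0<..} r) \<partial>lborel)"
          using c by (intro nn_integral_cong)
            (auto simp: w_def Z_def indicator_def ennreal_mult'[symmetric] exp_add[symmetric] algebra_simps)
        also have "\<dots> = ennreal (c * exp (- \<xi> * max 0 (X \<omega>))) * ennreal (Gamma (1 - \<alpha>) * \<xi> powr (- (1 - \<alpha>)))"
          using nn_integral_gamma_scaled[of "1 - \<alpha>" \<xi>] \<alpha>1 \<xi> by (subst nn_integral_cmult) auto
        also have "\<dots> = ennreal (\<xi> powr (\<alpha> - 1)) * ennreal (exp (- \<xi> * max 0 (X \<omega>)))"
          using c G by (subst (1 2) ennreal_mult'[symmetric]) (auto simp: c_def mult_ac)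
        finally show "(\<integral>\<^sup>+r. ennreal (w (\<omega>, r) * exp (- \<xi> * Z (\<omega>, r))) \<partial>lborel)
          = ennreal (\<xi> powr (\<alpha> - 1)) * ennreal (exp (- \<xi> * max 0 (X \<omega>)))" .
      qed
      also have "\<dots> = ennreal (\<xi> powr (\<alpha> - 1)) * (\<integral>\<^sup>+\<omega>. ennreal (exp (- \<xi> * X \<omega>)) \<partial>M)"
        by (subst nn_integral_cmult, simp, intro arg_cong2[of _ _ _ _ "(*)"] nn_integral_cong_AE refl)
           (use X0 in \<open>auto elim!: eventually_mono simp: max_def\<close>)
      also have "(\<integral>\<^sup>+\<omega>. ennreal (exp (- \<xi> * X \<omega>)) \<partial>M) = ennreal (exp (- s * \<xi> powr \<alpha>))"
        using lap[of \<xi>] \<xi> integrable_exp_nonneg[OF assms(1) X0, of \<xi>]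
        by (subst nn_integral_eq_integral) auto
      finally show "(\<integral>\<^sup>+p. ennreal (w p * exp (- \<xi> * Z p)) \<partial>(M \<Otimes>\<^sub>M lborel)) = ennreal (\<xi> powr (\<alpha> - 1) * exp (- s * \<xi> powr \<alpha>))"
        by (simp add: ennreal_mult')
    qed (use c in \<open>auto simp: w_def\<close>)
    have intZ: "integrable (M \<Otimes>\<^sub>M lborel) (\<lambda>p. w p * exp (- Z p))"
      using lapZ[of 1] by (simp add: has_bochner_integral_iff)
    obtain C where C: "C \<ge> 0" "\<And>x. x \<ge> 0 \<Longrightarrow> \<bar>\<psi> x\<bar> \<le> C" using vanishing_bounded[OF cont van] by metis
    have "expectation (\<lambda>\<omega>. X \<omega> / (\<alpha> * s) * \<psi> (X \<omega>)) = (\<integral>p. w p * \<psi> (Z p) \<partial>(M \<Otimes>\<^sub>M lborel))"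
    proof (rule laplace_unique_vanishing[OF _ _ _ _ nnX _ intX intZ _ cont van])
      show "expectation (\<lambda>\<omega>. X \<omega> / (\<alpha> * s) * exp (- \<xi> * X \<omega>)) = (\<integral>p. w p * exp (- \<xi> * Z p) \<partial>(M \<Otimes>\<^sub>M lborel))" if "1 \<le> \<xi>" for \<xi>
        using lapX[of \<xi>] lapZ[of \<xi>] that by (simp add: has_bochner_integral_iff)
    qed (use c in \<open>auto simp: w_def Z_def\<close>)
    also have "\<dots> = expectation (\<lambda>\<omega>. \<integral>r. w (\<omega>, r) * \<psi> (Z (\<omega>, r)) \<partial>lborel)"
    proof (rule P.integral_fst'[symmetric])
      show "integrable (M \<Otimes>\<^sub>M lborel) (\<lambda>p. w p * \<psi> (Z p))"
      proof (rule Bochner_Integration.integrable_bound[OF integrable_mult_right[OF intZ, of "C * exp R"]])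
        have "\<bar>\<psi> x\<bar> \<le> C * exp R * exp (- x)" if "x \<ge> 0" for x
        proof (cases "x \<ge> R")
          case False
          then have "1 \<le> exp R * exp (- x)" by (simp add: exp_add[symmetric])
          then show ?thesis using C that mult_left_mono[of 1 "exp R * exp (- x)" C] by (fastforce simp: mult.assoc)
        qed (use C van in simp)
        moreover have "w p \<ge> 0" "Z p \<ge> 0" for p using c by (auto simp: w_def Z_def)
        ultimately show "AE p in M \<Otimes>\<^sub>M lborel. norm (w p * \<psi> (Z p)) \<le> norm (C * exp R * (w p * exp (- Z p)))"
          using C(1) mult_left_mono[of "\<bar>\<psi> (Z p)\<bar>" "C * exp R * exp (- Z p)" "w p" for p]
          by (auto simp: abs_mult mult_ac)
      qed simp
    qed
    also have "\<dots> = expectation (\<lambda>\<omega>. weyl_integral \<alpha> \<psi> (X \<omega>))"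
    proof (intro Bochner_Integration.integral_cong refl)
      fix \<omega>
      have "(\<integral>r. w (\<omega>, r) * \<psi> (Z (\<omega>, r)) \<partial>lborel) = (\<integral>r. c * (indicator {0<..} r *\<^sub>R (r powr (- \<alpha>) * \<psi> (max 0 (X \<omega>) + r))) \<partial>lborel)"
        by (intro Bochner_Integration.integral_cong refl) (auto simp: w_def Z_def indicator_def)
      then show "(\<integral>r. w (\<omega>, r) * \<psi> (Z (\<omega>, r)) \<partial>lborel) = weyl_integral \<alpha> \<psi> (X \<omega>)"
        using False by (simp add: weyl_integral_def c_def set_lebesgue_integral_def)
    qed
    finally show ?thesis .
  qed
qed

end

section \<open>The Poisson-stable semigroup\<close>

context prob_space
begin

text \<open>Self-similarity, obtained from the one-dimensional Laplace transforms. It replaces a family of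
  random variables by the multiples of a single one, so that the dependence on \<open>s\<close> becomes explicit
  and differentiable.\<close>

lemma stable_scaling:
  fixes X Y :: "'a \<Rightarrow> real" and \<psi> :: "real \<Rightarrow> real"
  assumes [measurable]: "X \<in> borel_measurable M" "Y \<in> borel_measurable M"
    and X0: "AE \<omega> in M. 0 \<le> X \<omega>" and Y0: "AE \<omega> in M. 0 \<le> Y \<omega>"
    and lapX: "\<And>\<xi>. \<xi> \<ge> 0 \<Longrightarrow> expectation (\<lambda>\<omega>. exp (- \<xi> * X \<omega>)) = exp (- s * \<xi> powr \<alpha>)"
    and lapY: "\<And>\<xi>. \<xi> \<ge> 0 \<Longrightarrow> expectation (\<lambda>\<omega>. exp (- \<xi> * Y \<omega>)) = exp (- (\<xi> powr \<alpha>))"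
    and \<alpha>: "0 < \<alpha>" and s: "s \<ge> 0"
    and cont: "continuous_on UNIV \<psi>" and van: "\<And>x. x \<ge> R \<Longrightarrow> \<psi> x = 0"
  shows "expectation (\<lambda>\<omega>. \<psi> (X \<omega>)) = expectation (\<lambda>\<omega>. \<psi> (s powr (1 / \<alpha>) * Y \<omega>))"
proof -
  have Y0': "AE \<omega> in M. 0 \<le> s powr (1 / \<alpha>) * Y \<omega>"
    using Y0 by eventually_elim simp
  have "expectation (\<lambda>\<omega>. 1 * \<psi> (X \<omega>)) = expectation (\<lambda>\<omega>. 1 * \<psi> (s powr (1 / \<alpha>) * Y \<omega>))"
  proof (rule laplace_unique_vanishing[OF _ _ _ _ _ _ _ _ _ cont van])
    show "integrable M (\<lambda>\<omega>. 1 * exp (- X \<omega>))"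
      using integrable_exp_nonneg[OF assms(1) X0, of 1] by simp
    show "integrable M (\<lambda>\<omega>. 1 * exp (- (s powr (1 / \<alpha>) * Y \<omega>)))"
      using integrable_exp_nonneg[OF _ Y0', of 1] by simp
    show "expectation (\<lambda>\<omega>. 1 * exp (- \<xi> * X \<omega>)) = expectation (\<lambda>\<omega>. 1 * exp (- \<xi> * (s powr (1 / \<alpha>) * Y \<omega>)))" if "1 \<le> \<xi>" for \<xi>
      using lapX[of \<xi>] lapY[of "\<xi> * s powr (1 / \<alpha>)"] that \<alpha> s
      by (cases "s = 0") (simp_all add: powr_mult powr_powr mult_ac)
  qed (use X0 Y0' in auto)
  then show ?thesis by simp
qed

lemma expectation_scaled_continuous:
  fixes Y :: "'a \<Rightarrow> real"
  assumes [measurable]: "Y \<in> borel_measurable M" and Y0: "AE \<omega> in M. 0 \<le> Y \<omega>" and \<alpha>: "0 < \<alpha>"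
    and cont: "continuous_on UNIV \<eta>" and bd: "\<And>x. x \<ge> 0 \<Longrightarrow> \<bar>\<eta> x\<bar> \<le> (C::real)"
  shows "continuous_on {0..} (\<lambda>s. expectation (\<lambda>\<omega>. \<eta> (s powr \<alpha> * Y \<omega>)))"
  unfolding continuous_on_sequentially comp_def
proof (intro allI ballI impI, elim conjE)
  fix S :: "nat \<Rightarrow> real" and s :: real
  assume S: "\<forall>n. S n \<in> {0..}" "S \<longlonglongrightarrow> s" "s \<in> {0..}"
  have [measurable]: "\<eta> \<in> borel_measurable borel"
    using cont by (simp add: borel_measurable_continuous_onI)
  have "continuous_on {0..} (\<lambda>s::real. s powr \<alpha>)"
    using \<alpha> by (intro continuous_on_powr') (auto intro!: continuous_intros)
  then have Sl: "(\<lambda>n. S n powr \<alpha>) \<longlonglongrightarrow> s powr \<alpha>"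
    using S by (auto intro: continuous_on_tendsto_compose[of "{0..}" "\<lambda>s. s powr \<alpha>"])
  show "(\<lambda>n. expectation (\<lambda>\<omega>. \<eta> (S n powr \<alpha> * Y \<omega>))) \<longlonglongrightarrow> expectation (\<lambda>\<omega>. \<eta> (s powr \<alpha> * Y \<omega>))"
  proof (rule integral_dominated_convergence[where w="\<lambda>_. C"])
    show "AE \<omega> in M. (\<lambda>n. \<eta> (S n powr \<alpha> * Y \<omega>)) \<longlonglongrightarrow> \<eta> (s powr \<alpha> * Y \<omega>)"
      by (intro AE_I2 continuous_on_tendsto_compose[OF cont] tendsto_intros Sl) auto
    show "AE \<omega> in M. norm (\<eta> (S n powr \<alpha> * Y \<omega>)) \<le> C" for n
      using Y0 by eventually_elim (simp add: bd)
  qed auto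
qed

text \<open>This is the backward equation of the \<open>\<alpha>\<close>-stable semigroup. Differentiating through the scaling
  factor gives the left-hand side of \<open>stable_integration_by_parts\<close>; it is dominated although \<open>Y\<close> has
  no mean for \<open>\<alpha> < 1\<close>, since \<open>x * \<psi> x\<close> is bounded on the half line.\<close>

lemma expectation_stable_derivative:
  fixes Y :: "'a \<Rightarrow> real"
  assumes [measurable]: "Y \<in> borel_measurable M" and Y0: "AE \<omega> in M. 0 \<le> Y \<omega>"
    and lapY: "\<And>\<xi>. \<xi> \<ge> 0 \<Longrightarrow> expectation (\<lambda>\<omega>. exp (- \<xi> * Y \<omega>)) = exp (- (\<xi> powr \<alpha>))"
    and \<alpha>: "0 < \<alpha>" "\<alpha> \<le> 1" and s: "s > 0"
    and cont: "continuous_on UNIV \<psi>" and van: "\<And>x. x \<ge> R \<Longrightarrow> \<psi> x = 0"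
    and der: "\<And>x. (\<eta> has_real_derivative \<psi> x) (at x)" and van': "\<And>x. x \<ge> R \<Longrightarrow> \<eta> x = 0"
  shows "((\<lambda>s. expectation (\<lambda>\<omega>. \<eta> (s powr (1 / \<alpha>) * Y \<omega>))) has_real_derivative
      expectation (\<lambda>\<omega>. weyl_integral \<alpha> \<psi> (s powr (1 / \<alpha>) * Y \<omega>))) (at s)"
proof -
  have cont': "continuous_on UNIV \<eta>"
    using der by (meson DERIV_continuous continuous_at_imp_continuous_on)
  have [measurable]: "\<eta> \<in> borel_measurable borel" "\<psi> \<in> borel_measurable borel"
    using cont cont' by (simp_all add: borel_measurable_continuous_onI)
  obtain C where C: "C \<ge> 0" "\<And>x. x \<ge> 0 \<Longrightarrow> \<bar>\<psi> x\<bar> \<le> C" using vanishing_bounded[OF cont van] by metis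
  obtain C' where C': "C' \<ge> 0" "\<And>x. x \<ge> 0 \<Longrightarrow> \<bar>\<eta> x\<bar> \<le> C'" using vanishing_bounded[OF cont' van'] by metis
  define g' where "g' t \<omega> = \<psi> (t powr (1 / \<alpha>) * Y \<omega>) * (1 / \<alpha> * t powr (1 / \<alpha> - 1) * Y \<omega>)" for t \<omega>
  have g'_eq: "g' t \<omega> = (t powr (1 / \<alpha>) * Y \<omega>) / (\<alpha> * t) * \<psi> (t powr (1 / \<alpha>) * Y \<omega>)" if "t > 0" for t \<omega>
    using that by (simp add: g'_def powr_diff)
  have "((\<lambda>s. expectation (\<lambda>\<omega>. \<eta> (s powr (1 / \<alpha>) * Y \<omega>))) has_real_derivative expectation (g' s)) (at s)"
  proof (rule has_real_derivative_integral[where r="s / 2" and b="\<lambda>_. C * max 0 R / (\<alpha> * s / 2)"])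
    show "integrable M (\<lambda>\<omega>. \<eta> (t powr (1 / \<alpha>) * Y \<omega>))" if "\<bar>t - s\<bar> < s / 2" for t
      by (rule integrable_const_bound[where B=C'])
         (use Y0 in \<open>auto elim!: eventually_mono intro!: C'\<close>)
    show "AE \<omega> in M. \<forall>t. \<bar>t - s\<bar> < s / 2 \<longrightarrow>
       ((\<lambda>t. \<eta> (t powr (1 / \<alpha>) * Y \<omega>)) has_real_derivative g' t \<omega>) (at t) \<and> \<bar>g' t \<omega>\<bar> \<le> C * max 0 R / (\<alpha> * s / 2)"
      using Y0
    proof (eventually_elim, intro allI impI conjI)
      fix \<omega> t assume Y: "0 \<le> Y \<omega>" and t: "\<bar>t - s\<bar> < s / 2"
      then have t0: "t > s / 2" "t > 0" by (auto simp: abs_if split: if_splits)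
      show "((\<lambda>t. \<eta> (t powr (1 / \<alpha>) * Y \<omega>)) has_real_derivative g' t \<omega>) (at t)"
        unfolding g'_def
        by (rule DERIV_chain'[where f="\<lambda>t. t powr (1 / \<alpha>) * Y \<omega>", OF _ der]) (use t0 in \<open>auto intro!: derivative_eq_intros\<close>)
      define y where "y = t powr (1 / \<alpha>) * Y \<omega>"
      have y: "y \<ge> 0" using Y by (simp add: y_def)
      have "\<bar>y * \<psi> y\<bar> \<le> C * max 0 R"
        using C(2)[OF y] y van[of y] C(1) by (cases "y \<ge> R") (auto simp: abs_mult mult.commute[of C] intro!: mult_mono)
      moreover have "g' t \<omega> = (y * \<psi> y) / (\<alpha> * t)"
        using t0 by (simp add: g'_eq y_def)
      ultimately show "\<bar>g' t \<omega>\<bar> \<le> C * max 0 R / (\<alpha> * s / 2)"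
        using t0 \<alpha> s C(1) by (simp only: abs_divide, intro frac_le) auto
    qed
    show "g' s \<in> borel_measurable M" unfolding g'_def by measurable
  qed (use s in auto)
  also have "expectation (g' s) = expectation (\<lambda>\<omega>. weyl_integral \<alpha> \<psi> (s powr (1 / \<alpha>) * Y \<omega>))"
    unfolding g'_eq[OF s]
  proof (rule stable_integration_by_parts[OF _ _ _ \<alpha> s cont van])
    show "AE \<omega> in M. 0 \<le> s powr (1 / \<alpha>) * Y \<omega>" using Y0 by eventually_elim simp
    show "expectation (\<lambda>\<omega>. exp (- \<xi> * (s powr (1 / \<alpha>) * Y \<omega>))) = exp (- s * \<xi> powr \<alpha>)" if "\<xi> \<ge> 0" for \<xi>
      using lapY[of "\<xi> * s powr (1 / \<alpha>)"] that s \<alpha> by (simp add: powr_mult powr_powr mult_ac)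
  qed auto
  finally show ?thesis .
qed

end

definition poisson_weight :: "real \<Rightarrow> nat \<Rightarrow> real \<Rightarrow> real" where
  "poisson_weight lam k s = (lam * s) ^ k / fact k * exp (- (lam * s))"

text \<open>The mean of \<open>G (N\<^sub>s) (H\<^sub>s)\<close>, with \<open>H\<^sub>s\<close> replaced by a multiple of a variable \<open>Y\<close>
  that has the law of \<open>H\<^sub>1\<close>. The sum is truncated at an \<open>m\<close> from which \<open>G\<close> vanishes.\<close>

definition (in prob_space) poisson_stable_mean ::
    "real \<Rightarrow> real \<Rightarrow> ('a \<Rightarrow> real) \<Rightarrow> nat \<Rightarrow> (nat \<Rightarrow> real \<Rightarrow> real) \<Rightarrow> real \<Rightarrow> real" where
  "poisson_stable_mean \<alpha> lam Y m G s =
     (\<Sum>k<m. poisson_weight lam k s * expectation (\<lambda>\<omega>. G k (s powr (1 / \<alpha>) * Y \<omega>)))"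

text \<open>The generator of the pair of processes, where \<open>G'\<close> is the derivative of \<open>G\<close> in the real variable.\<close>

definition poisson_stable_generator ::
    "real \<Rightarrow> real \<Rightarrow> (nat \<Rightarrow> real \<Rightarrow> real) \<Rightarrow> (nat \<Rightarrow> real \<Rightarrow> real) \<Rightarrow> nat \<Rightarrow> real \<Rightarrow> real" where
  "poisson_stable_generator \<alpha> lam G G' k x = weyl_integral \<alpha> (G' k) x + lam * (G (Suc k) x - G k x)"

lemma poisson_weight_le_1: 
  assumes "lam > 0" "s \<ge> 0"
  shows "0 \<le> poisson_weight lam k s" "poisson_weight lam k s \<le> 1"
proof -
  show "0 \<le> poisson_weight lam k s" using assms by (simp add: poisson_weight_def)
  have "pmf (poisson_pmf (lam * s)) k \<le> 1" by (rule pmf_le_1)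
  then show "poisson_weight lam k s \<le> 1"
    using assms by (cases "s = 0"; cases k) (auto simp: poisson_weight_def pmf_poisson)
qed

lemma poisson_weight_derivative:
  "(poisson_weight lam k has_real_derivative
     lam * ((if k = 0 then 0 else poisson_weight lam (k - 1) s) - poisson_weight lam k s)) (at s)"
proof -
  have "((\<lambda>s. (lam * s) ^ k / fact k) has_real_derivative
      (if k = 0 then 0 else lam * ((lam * s) ^ (k - 1) / fact (k - 1)))) (at s)"
    by (cases k) (auto intro!: derivative_eq_intros simp del: of_nat_Suc power_Suc)
  moreover have "((\<lambda>s. exp (- (lam * s))) has_real_derivative - lam * exp (- (lam * s))) (at s)"
    by (auto intro!: derivative_eq_intros)
  ultimately show ?thesis
    unfolding poisson_weight_def[abs_def] by (rule DERIV_mult'[THEN DERIV_cong]) (auto simp: algebra_simps)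
qed

context prob_space
begin

lemma continuous_poisson_stable_mean:
  fixes Y :: "'a \<Rightarrow> real"
  assumes Y: "Y \<in> borel_measurable M" and Y0: "AE \<omega> in M. 0 \<le> Y \<omega>" and \<alpha>: "0 < \<alpha>"
    and cont: "\<And>k. continuous_on UNIV (G k)" and van: "\<And>k x. x \<ge> R \<Longrightarrow> G k x = 0"
  shows "continuous_on {0..} (poisson_stable_mean \<alpha> lam Y m G)"
proof -
  have "continuous_on {0..} (\<lambda>s. expectation (\<lambda>\<omega>. G k (s powr (1 / \<alpha>) * Y \<omega>)))" for k
  proof -
    obtain C where "\<And>x. x \<ge> 0 \<Longrightarrow> \<bar>G k x\<bar> \<le> C" using vanishing_bounded[OF cont van] by metis
    then show ?thesis using \<alpha> by (intro expectation_scaled_continuous[OF Y Y0 _ cont]) auto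
  qed
  then show ?thesis
    unfolding poisson_stable_mean_def[abs_def] poisson_weight_def by (intro continuous_intros) auto
qed

lemma poisson_stable_mean_bounded:
  fixes Y :: "'a \<Rightarrow> real"
  assumes [measurable]: "Y \<in> borel_measurable M" and Y0: "AE \<omega> in M. 0 \<le> Y \<omega>" and lam: "lam > 0"
    and cont: "\<And>k. continuous_on UNIV (G k)" and van: "\<And>k x. x \<ge> R \<Longrightarrow> G k x = 0"
  obtains C where "C \<ge> 0" "\<And>s. s \<ge> 0 \<Longrightarrow> \<bar>poisson_stable_mean \<alpha> lam Y m G s\<bar> \<le> C"
proof -
  have "\<exists>C. \<forall>x\<ge>0. \<bar>G k x\<bar> \<le> C" for k using vanishing_bounded[OF cont van] by metis
  then obtain C where C: "\<And>k x. x \<ge> 0 \<Longrightarrow> \<bar>G k x\<bar> \<le> C k" by metis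
  have C0: "C k \<ge> 0" for k using C[of 0 k] by auto
  have "\<bar>poisson_stable_mean \<alpha> lam Y m G s\<bar> \<le> (\<Sum>k<m. C k)" if s: "s \<ge> 0" for s
    unfolding poisson_stable_mean_def
  proof (rule order_trans[OF sum_abs], rule sum_mono)
    fix k
    have [measurable]: "G k \<in> borel_measurable borel" using cont by (simp add: borel_measurable_continuous_onI)
    have b: "AE \<omega> in M. \<bar>G k (s powr (1 / \<alpha>) * Y \<omega>)\<bar> \<le> C k"
      using Y0 by eventually_elim (simp add: C)
    have "\<bar>expectation (\<lambda>\<omega>. G k (s powr (1 / \<alpha>) * Y \<omega>))\<bar> \<le> expectation (\<lambda>_. C k)"
      using b by (intro order_trans[OF integral_abs_bound] integral_mono_AE integrable_const_bound[where B="C k"]) (auto simp: C0)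
    then show "\<bar>poisson_weight lam k s * expectation (\<lambda>\<omega>. G k (s powr (1 / \<alpha>) * Y \<omega>))\<bar> \<le> C k"
      using poisson_weight_le_1[OF lam s, of k] mult_mono[of "poisson_weight lam k s" 1 "\<bar>expectation (\<lambda>\<omega>. G k (s powr (1 / \<alpha>) * Y \<omega>))\<bar>" "C k"]
      by (simp add: abs_mult prob_space C0)
  qed
  then show ?thesis using that[of "\<Sum>k<m. C k"] C0 by (auto intro: sum_nonneg)
qed

text \<open>The derivative of the weights, \<open>lam * (p\<^sub>k\<^sub>-\<^sub>1 - p\<^sub>k)\<close>, is moved onto \<open>G\<close> by summation by parts; the
  boundary term vanishes because \<open>G m\<close> does.\<close>

lemma poisson_stable_mean_derivative:
  fixes Y :: "'a \<Rightarrow> real"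
  assumes Y: "Y \<in> borel_measurable M" and Y0: "AE \<omega> in M. 0 \<le> Y \<omega>"
    and lapY: "\<And>\<xi>. \<xi> \<ge> 0 \<Longrightarrow> expectation (\<lambda>\<omega>. exp (- \<xi> * Y \<omega>)) = exp (- (\<xi> powr \<alpha>))"
    and \<alpha>: "0 < \<alpha>" "\<alpha> \<le> 1" and s: "s > 0"
    and cont: "\<And>k. continuous_on UNIV (G' k)" and van: "\<And>k x. x \<ge> R \<Longrightarrow> G' k x = 0"
    and der: "\<And>k x. (G k has_real_derivative G' k x) (at x)" and van': "\<And>k x. x \<ge> R \<Longrightarrow> G k x = 0"
    and vanm: "\<And>x. x \<ge> 0 \<Longrightarrow> G m x = 0"
  shows "(poisson_stable_mean \<alpha> lam Y m G has_real_derivative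
      poisson_stable_mean \<alpha> lam Y m (poisson_stable_generator \<alpha> lam G G') s) (at s)"
proof -
  define h where "h k s = expectation (\<lambda>\<omega>. G k (s powr (1 / \<alpha>) * Y \<omega>))" for k s
  define h' where "h' k = expectation (\<lambda>\<omega>. weyl_integral \<alpha> (G' k) (s powr (1 / \<alpha>) * Y \<omega>))" for k
  note [measurable] = Y
  have contG: "continuous_on UNIV (G k)" for k
    using der by (meson DERIV_continuous continuous_at_imp_continuous_on)
  have hm: "h m s = 0"
    unfolding h_def using Y0 by (intro integral_eq_zero_AE) (auto elim!: eventually_mono simp: vanm)
  have int: "integrable M (\<lambda>\<omega>. F (s powr (1 / \<alpha>) * Y \<omega>))"
    if F: "continuous_on UNIV F" "\<And>x. x \<ge> R \<Longrightarrow> F x = 0" for F :: "real \<Rightarrow> real"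
  proof -
    have [measurable]: "F \<in> borel_measurable borel" using F by (simp add: borel_measurable_continuous_onI)
    obtain C where C: "\<And>x. x \<ge> 0 \<Longrightarrow> \<bar>F x\<bar> \<le> C" using vanishing_bounded[OF F] by metis
    show ?thesis
      by (rule integrable_const_bound[where B=C]) (use Y0 in \<open>auto elim!: eventually_mono simp: C\<close>)
  qed
  have gen: "expectation (\<lambda>\<omega>. poisson_stable_generator \<alpha> lam G G' k (s powr (1 / \<alpha>) * Y \<omega>))
     = h' k + lam * (h (Suc k) s - h k s)" for k
  proof -
    have "integrable M (\<lambda>\<omega>. weyl_integral \<alpha> (G' k) (s powr (1 / \<alpha>) * Y \<omega>))"
      by (intro int continuous_weyl_integral[OF \<alpha>(2) cont van] weyl_integral_vanishes[OF van])
    then show ?thesis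
      unfolding poisson_stable_generator_def h'_def h_def
      using int[OF contG van', of k] int[OF contG van', of "Suc k"] by simp
  qed
  have "(poisson_stable_mean \<alpha> lam Y m G has_real_derivative
     (\<Sum>k<m. lam * ((if k = 0 then 0 else poisson_weight lam (k - 1) s) - poisson_weight lam k s) * h k s
        + poisson_weight lam k s * h' k)) (at s)"
    unfolding poisson_stable_mean_def[abs_def] h_def h'_def
    by (intro DERIV_sum, rule DERIV_mult'[OF poisson_weight_derivative
          expectation_stable_derivative[OF Y Y0 lapY \<alpha> s cont van der van'], THEN DERIV_cong])
      (auto simp: algebra_simps)
  also have "(\<Sum>k<m. lam * ((if k = 0 then 0 else poisson_weight lam (k - 1) s) - poisson_weight lam k s) * h k s
        + poisson_weight lam k s * h' k)
     = (\<Sum>k<m. poisson_weight lam k s * (h' k + lam * (h (Suc k) s - h k s)))"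
  proof -
    have "(\<Sum>k<m. (if k = 0 then 0 else poisson_weight lam (k - 1) s) * h k s) = (\<Sum>k<m. poisson_weight lam k s * h (Suc k) s)"
    proof (cases m)
      case (Suc n)
      then show ?thesis using hm
        unfolding Suc by (subst sum.lessThan_Suc_shift) simp
    qed simp
    then have "lam * (\<Sum>k<m. (if k = 0 then 0 else poisson_weight lam (k - 1) s) * h k s) = lam * (\<Sum>k<m. poisson_weight lam k s * h (Suc k) s)"
      by simp
    then show ?thesis
      by (simp add: algebra_simps sum.distrib sum_subtractf sum_distrib_left)
  qed
  finally show ?thesis
    by (simp only: poisson_stable_mean_def[abs_def] gen)
qed

end

section \<open>Negative moments of stable laws and the Caputo kernel\<close>

text \<open>The integrand is the derivative of \<open>- exp (- (x powr \<beta>))\<close>. The bound \<open>\<eta> > 0\<close> avoids the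
  singularity at \<open>0\<close>.\<close>

lemma nn_integral_weibull_tail:
  assumes \<beta>: "0 < \<beta>" and \<eta>: "0 < (\<eta>::real)"
  shows "(\<integral>\<^sup>+x\<in>{\<eta><..}. ennreal (\<beta> * x powr (\<beta> - 1) * exp (- (x powr \<beta>))) \<partial>lborel) = ennreal (exp (- (\<eta> powr \<beta>)))"
proof -
  have "(\<integral>\<^sup>+x. ennreal (\<beta> * x powr (\<beta> - 1) * exp (- (x powr \<beta>))) * indicator {\<eta>..} x \<partial>lborel) = ennreal (0 - (- exp (- (\<eta> powr \<beta>))))"
  proof (rule nn_integral_FTC_atLeast)
    show "DERIV (\<lambda>x. - exp (- (x powr \<beta>))) x :> \<beta> * x powr (\<beta> - 1) * exp (- (x powr \<beta>))" if "\<eta> \<le> x" for x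
      using that \<eta> by (auto intro!: derivative_eq_intros)
    have "filterlim (\<lambda>x::real. x powr \<beta>) at_top at_top"
      using \<beta> by real_asymp
    then have "((\<lambda>x. exp (- (x powr \<beta>))) \<longlongrightarrow> 0) at_top"
      by (intro filterlim_compose[OF exp_at_bot] filterlim_compose[OF filterlim_uminus_at_bot_at_top])
    then show "((\<lambda>x. - exp (- (x powr \<beta>))) \<longlongrightarrow> 0) at_top"
      by (rule tendsto_minus[of _ 0, simplified])
  qed (use \<beta> in auto)
  also have "(\<integral>\<^sup>+x. ennreal (\<beta> * x powr (\<beta> - 1) * exp (- (x powr \<beta>))) * indicator {\<eta>..} x \<partial>lborel)
     = (\<integral>\<^sup>+x\<in>{\<eta><..}. ennreal (\<beta> * x powr (\<beta> - 1) * exp (- (x powr \<beta>))) \<partial>lborel)"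
    by (intro nn_integral_cong_AE, use AE_lborel_singleton[of \<eta>] in eventually_elim) (auto simp: indicator_def)
  finally show ?thesis by simp
qed

text \<open>The Beta integral, transported to \<open>{A<..<t}\<close> by \<open>u = (s - A) / (t - A)\<close>. As the two exponents add
  up to \<open>- 1\<close>, the length of the interval cancels.\<close>

lemma nn_integral_beta_interval:
  fixes A t \<beta> :: real
  assumes \<beta>: "0 < \<beta>" "\<beta> < 1" and At: "A < t"
  shows "(\<integral>\<^sup>+s\<in>{A<..<t}. ennreal ((t - s) powr (- \<beta>) * (s - A) powr (\<beta> - 1)) \<partial>lborel) = ennreal (Gamma \<beta> * Gamma (1 - \<beta>))"
proof -
  define c where "c = 1 / (t - A)"
  have c: "c > 0" using At by (simp add: c_def)
  have "((\<lambda>u. u powr (\<beta> - 1) * (1 - u) powr ((1 - \<beta>) - 1)) has_integral Beta \<beta> (1 - \<beta>)) {0..1}"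
    using \<beta> by (intro has_integral_Beta_real) auto
  from nn_integral_has_integral_lebesgue[OF _ this]
  have "ennreal (Gamma \<beta> * Gamma (1 - \<beta>)) = (\<integral>\<^sup>+u. ennreal (indicator {0..1} u * (u powr (\<beta> - 1) * (1 - u) powr (- \<beta>))) \<partial>lborel)"
    by (simp add: Beta_def)
  also have "\<dots> = ennreal \<bar>c\<bar> * (\<integral>\<^sup>+s. ennreal (indicator {0..1} (- A * c + c * s) *
      ((- A * c + c * s) powr (\<beta> - 1) * (1 - (- A * c + c * s)) powr (- \<beta>))) \<partial>lborel)"
    using c by (intro nn_integral_real_affine) auto
  also have "\<dots> = (\<integral>\<^sup>+s\<in>{A<..<t}. ennreal ((t - s) powr (- \<beta>) * (s - A) powr (\<beta> - 1)) \<partial>lborel)"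
  proof (subst nn_integral_cmult[symmetric], simp, intro nn_integral_cong_AE,
      use AE_lborel_singleton[of A] AE_lborel_singleton[of t] in eventually_elim)
    fix s assume s: "s \<noteq> A" "s \<noteq> t"
    have e1: "- A * c + c * s = c * (s - A)" by (simp add: algebra_simps)
    have e2: "1 - c * (s - A) = c * (t - s)" using At by (simp add: c_def field_simps)
    have i: "indicator {0..1} (c * (s - A)) = (indicator {A<..<t} s :: real)"
      using s c At by (auto simp: indicator_def c_def field_simps)
    have "c * ((c * (s - A)) powr (\<beta> - 1) * (c * (t - s)) powr (- \<beta>)) = (t - s) powr (- \<beta>) * (s - A) powr (\<beta> - 1)"
      if "A < s" "s < t"
    proof -
      have "c * (c powr (\<beta> - 1) * c powr (- \<beta>)) = 1"
        using c by (simp only: powr_add[symmetric]) (simp add: powr_minus)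
      then show ?thesis using that c by (simp add: powr_mult mult_ac)
    qed
    then show "ennreal \<bar>c\<bar> * ennreal (indicator {0..1} (- A * c + c * s) *
           ((- A * c + c * s) powr (\<beta> - 1) * (1 - (- A * c + c * s)) powr - \<beta>)) =
         ennreal ((t - s) powr - \<beta> * (s - A) powr (\<beta> - 1)) * indicator {A<..<t} s"
      unfolding e1 e2 i using c by (auto simp: indicator_def ennreal_mult'[symmetric])
  qed
  finally show ?thesis ..
qed

context prob_space
begin

text \<open>Write \<open>K powr (- \<beta>)\<close> as a Gamma integral of \<open>exp (- y * K)\<close> over \<open>y\<close> and exchange the integrals; the
  inner expectation is then the known Laplace transform at \<open>x = y + \<eta>\<close>.\<close>

lemma stable_negative_moment:
  fixes K :: "'a \<Rightarrow> real"
  assumes [measurable]: "K \<in> borel_measurable M" and K0: "AE \<omega> in M. 0 < K \<omega>"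
    and lap: "\<And>\<xi>. \<xi> \<ge> 0 \<Longrightarrow> expectation (\<lambda>\<omega>. exp (- \<xi> * K \<omega>)) = exp (- (\<xi> powr \<beta>))"
    and \<beta>: "0 < \<beta>" and \<eta>: "0 \<le> \<eta>"
  shows "(\<integral>\<^sup>+\<omega>. ennreal (K \<omega> powr (- \<beta>) * exp (- \<eta> * K \<omega>)) \<partial>M)
     = ennreal (1 / Gamma \<beta>) * (\<integral>\<^sup>+x\<in>{\<eta><..}. ennreal ((x - \<eta>) powr (\<beta> - 1) * exp (- (x powr \<beta>))) \<partial>lborel)"
proof -
  interpret P: pair_sigma_finite M lborel ..
  have G: "Gamma \<beta> > 0" using \<beta> by simp
  have K0': "AE \<omega> in M. 0 \<le> K \<omega>" using K0 by eventually_elim simp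
  let ?g = "\<lambda>\<omega> y. ennreal (1 / Gamma \<beta>) * (ennreal (y powr (\<beta> - 1) * exp (- (y + \<eta>) * K \<omega>)) * indicator {0<..} y)"
  have "(\<integral>\<^sup>+\<omega>. ennreal (K \<omega> powr (- \<beta>) * exp (- \<eta> * K \<omega>)) \<partial>M) = (\<integral>\<^sup>+\<omega>. \<integral>\<^sup>+y. ?g \<omega> y \<partial>lborel \<partial>M)"
  proof (rule nn_integral_cong_AE, use K0 in eventually_elim)
    fix \<omega> assume K: "0 < K \<omega>"
    have "(\<integral>\<^sup>+y. ?g \<omega> y \<partial>lborel) = (\<integral>\<^sup>+y. ennreal (1 / Gamma \<beta> * exp (- \<eta> * K \<omega>)) * (ennreal (y powr (\<beta> - 1) * exp (- K \<omega> * y)) * indicator {0<..} y) \<partial>lborel)"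
      using G by (intro nn_integral_cong) (auto simp: indicator_def ennreal_mult'[symmetric] exp_add[symmetric] algebra_simps)
    also have "\<dots> = ennreal (1 / Gamma \<beta> * exp (- \<eta> * K \<omega>)) * ennreal (Gamma \<beta> * K \<omega> powr (- \<beta>))"
      using nn_integral_gamma_scaled[OF \<beta> K] by (subst nn_integral_cmult) auto
    also have "\<dots> = ennreal (K \<omega> powr (- \<beta>) * exp (- \<eta> * K \<omega>))"
      using G by (subst ennreal_mult'[symmetric]) (auto simp: mult_ac)
    finally show "ennreal (K \<omega> powr (- \<beta>) * exp (- \<eta> * K \<omega>)) = (\<integral>\<^sup>+y. ?g \<omega> y \<partial>lborel)" ..
  qed
  also have "\<dots> = (\<integral>\<^sup>+y. \<integral>\<^sup>+\<omega>. ?g \<omega> y \<partial>M \<partial>lborel)"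
    by (rule P.Fubini'[symmetric]) simp
  also have "\<dots> = (\<integral>\<^sup>+y. ennreal (1 / Gamma \<beta>) * (ennreal (y powr (\<beta> - 1) * exp (- ((y + \<eta>) powr \<beta>))) * indicator {0<..} y) \<partial>lborel)"
  proof (rule nn_integral_cong)
    fix y :: real
    show "(\<integral>\<^sup>+\<omega>. ?g \<omega> y \<partial>M) = ennreal (1 / Gamma \<beta>) * (ennreal (y powr (\<beta> - 1) * exp (- ((y + \<eta>) powr \<beta>))) * indicator {0<..} y)"
    proof (cases "y > 0")
      case True
      have "(\<integral>\<^sup>+\<omega>. ennreal (exp (- (y + \<eta>) * K \<omega>)) \<partial>M) = ennreal (exp (- ((y + \<eta>) powr \<beta>)))"
        using lap[of "y + \<eta>"] True \<eta> integrable_exp_nonneg[OF assms(1) K0', of "y + \<eta>"]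
        by (subst nn_integral_eq_integral) auto
      then have "(\<integral>\<^sup>+\<omega>. ennreal (1 / Gamma \<beta> * y powr (\<beta> - 1)) * ennreal (exp (- (y + \<eta>) * K \<omega>)) \<partial>M)
        = ennreal (1 / Gamma \<beta> * y powr (\<beta> - 1)) * ennreal (exp (- ((y + \<eta>) powr \<beta>)))"
        by (subst nn_integral_cmult) auto
      then show ?thesis
        using True G by (simp add: ennreal_mult'[symmetric] mult.assoc)
    qed simp
  qed
  also have "\<dots> = ennreal (1 / Gamma \<beta>) * (\<integral>\<^sup>+y. ennreal (y powr (\<beta> - 1) * exp (- ((y + \<eta>) powr \<beta>))) * indicator {0<..} y \<partial>lborel)"
    by (rule nn_integral_cmult) simp
  also have "(\<integral>\<^sup>+y. ennreal (y powr (\<beta> - 1) * exp (- ((y + \<eta>) powr \<beta>))) * indicator {0<..} y \<partial>lborel)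
    = (\<integral>\<^sup>+x\<in>{\<eta><..}. ennreal ((x - \<eta>) powr (\<beta> - 1) * exp (- (x powr \<beta>))) \<partial>lborel)"
    by (subst nn_integral_real_affine[where c=1 and t="- \<eta>"]) (auto intro!: nn_integral_cong simp: indicator_def)
  finally show ?thesis .
qed

lemma stable_negative_moment_integrable:
  fixes K :: "'a \<Rightarrow> real"
  assumes [measurable]: "K \<in> borel_measurable M" and K0: "AE \<omega> in M. 0 < K \<omega>"
    and lap: "\<And>\<xi>. \<xi> \<ge> 0 \<Longrightarrow> expectation (\<lambda>\<omega>. exp (- \<xi> * K \<omega>)) = exp (- (\<xi> powr \<beta>))"
    and \<beta>: "0 < \<beta>"
  shows "integrable M (\<lambda>\<omega>. K \<omega> powr (- \<beta>))"
proof (rule integrableI_nonneg)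
  \<comment> \<open>Near \<open>0\<close> the power is integrable, away from \<open>0\<close> the tail integral applies.\<close>
  have le: "ennreal (x powr (\<beta> - 1) * exp (- (x powr \<beta>))) * indicator {0<..} x
      \<le> ennreal (indicator {0<..1} x * x powr (\<beta> - 1))
       + ennreal (1 / \<beta>) * (ennreal (\<beta> * x powr (\<beta> - 1) * exp (- (x powr \<beta>))) * indicator {1<..} x)" for x
    using \<beta> by (auto simp: indicator_def ennreal_mult'[symmetric] intro!: ennreal_leI mult_left_le)
  have "integrable lborel (\<lambda>r. indicator {0<..1} r * r powr (- (1 - \<beta>)))"
    using \<beta> by (intro integrable_powr_cutoff) auto
  then have "(\<integral>\<^sup>+x. ennreal (norm (indicator {0<..1} x * x powr (\<beta> - 1))) \<partial>lborel) < \<infinity>"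
    by (simp add: integrable_iff_bounded)
  then have fin: "(\<integral>\<^sup>+x. ennreal (indicator {0<..1} x * x powr (\<beta> - 1)) \<partial>lborel) < \<infinity>"
    by (simp add: abs_mult)
  have "(\<integral>\<^sup>+x\<in>{0<..}. ennreal (x powr (\<beta> - 1) * exp (- (x powr \<beta>))) \<partial>lborel)
    \<le> (\<integral>\<^sup>+x. ennreal (indicator {0<..1} x * x powr (\<beta> - 1)) \<partial>lborel)
       + ennreal (1 / \<beta>) * (\<integral>\<^sup>+x\<in>{1<..}. ennreal (\<beta> * x powr (\<beta> - 1) * exp (- (x powr \<beta>))) \<partial>lborel)"
    by (subst nn_integral_cmult[symmetric], simp, subst nn_integral_add[symmetric], simp, simp, rule nn_integral_mono, rule le)
  also have "\<dots> < \<infinity>"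
    using fin \<beta> by (subst nn_integral_weibull_tail) (auto simp: ennreal_mult'[symmetric])
  finally have "ennreal (1 / Gamma \<beta>) * (\<integral>\<^sup>+x\<in>{0<..}. ennreal ((x - 0) powr (\<beta> - 1) * exp (- (x powr \<beta>))) \<partial>lborel) < \<infinity>"
    by (simp add: ennreal_mult_less_top)
  then show "(\<integral>\<^sup>+\<omega>. ennreal (K \<omega> powr (- \<beta>)) \<partial>M) < \<infinity>"
    using stable_negative_moment[OF assms(1) K0 lap \<beta>, of 0] by simp
qed auto

text \<open>The Laplace transform, at \<open>\<xi>\<close>, of \<open>K / s\<close> with \<open>s\<close> weighted by the Caputo kernel and the
  probability by \<open>K powr (- \<beta>)\<close>. After
  \<open>stable_negative_moment\<close> with \<open>\<eta> = \<xi> / s\<close> and an exchange of the integrals over \<open>s\<close> and \<open>x\<close>, the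
  \<open>s\<close>-integral is a Beta integral over \<open>{\<xi> / x<..<t}\<close>, whose value does not depend on \<open>x\<close>; what remains is
  the tail integral of \<open>nn_integral_weibull_tail\<close>. The result is the Laplace transform of \<open>K / t\<close>.\<close>

lemma caputo_kernel_laplace:
  fixes K :: "'a \<Rightarrow> real"
  assumes [measurable]: "K \<in> borel_measurable M" and K0: "AE \<omega> in M. 0 < K \<omega>"
    and lap: "\<And>\<xi>. \<xi> \<ge> 0 \<Longrightarrow> expectation (\<lambda>\<omega>. exp (- \<xi> * K \<omega>)) = exp (- (\<xi> powr \<beta>))"
    and \<beta>: "0 < \<beta>" "\<beta> < 1" and t: "t > 0" and \<xi>: "\<xi> > 0"
  shows "(\<integral>\<^sup>+s. \<integral>\<^sup>+\<omega>. ennreal (\<beta> / Gamma (1 - \<beta>) * (indicator {0<..<t} s * ((t - s) powr (- \<beta>) * s powr (\<beta> - 1)))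
             * K \<omega> powr (- \<beta>) * exp (- \<xi> * (K \<omega> / s))) \<partial>M \<partial>lborel) = ennreal (exp (- ((\<xi> / t) powr \<beta>)))"
proof -
  have G: "Gamma \<beta> > 0" "Gamma (1 - \<beta>) > 0" using \<beta> by auto
  let ?k = "\<lambda>s. \<beta> / Gamma (1 - \<beta>) * (indicator {0<..<t} s * ((t - s) powr (- \<beta>) * s powr (\<beta> - 1)))"
  have k0: "?k s \<ge> 0" for s using \<beta> G by auto
  let ?h = "\<lambda>x s. ennreal (\<beta> / (Gamma \<beta> * Gamma (1 - \<beta>)) * (x powr (\<beta> - 1) * exp (- (x powr \<beta>)))) * indicator {\<xi> / t<..} x *
      (ennreal ((t - s) powr (- \<beta>) * (s - \<xi> / x) powr (\<beta> - 1)) * indicator {\<xi> / x<..<t} s)"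
  have "(\<integral>\<^sup>+s. \<integral>\<^sup>+\<omega>. ennreal (?k s * K \<omega> powr (- \<beta>) * exp (- \<xi> * (K \<omega> / s))) \<partial>M \<partial>lborel)
     = (\<integral>\<^sup>+s. \<integral>\<^sup>+x. ?h x s \<partial>lborel \<partial>lborel)"
  proof (rule nn_integral_cong)
    fix s :: real
    show "(\<integral>\<^sup>+\<omega>. ennreal (?k s * K \<omega> powr (- \<beta>) * exp (- \<xi> * (K \<omega> / s))) \<partial>M) = (\<integral>\<^sup>+x. ?h x s \<partial>lborel)"
    proof (cases "0 < s \<and> s < t")
      case False
      have h0: "?h x s = 0" for x
      proof (cases "x > \<xi> / t")
        case True
        then have "x > 0" using \<xi> t by (meson divide_pos_pos less_trans)
        then have "\<not> (\<xi> / x < s \<and> s < t)" using False \<xi> by (meson divide_pos_pos less_trans)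
        then show ?thesis by simp
      qed simp
      have "indicator {0<..<t} s = (0::real)" using False by simp
      then show ?thesis unfolding h0 by simp
    next
      case True
      then have s: "0 < s" "s < t" by auto
      have "(\<integral>\<^sup>+\<omega>. ennreal (?k s * K \<omega> powr (- \<beta>) * exp (- \<xi> * (K \<omega> / s))) \<partial>M)
        = (\<integral>\<^sup>+\<omega>. ennreal (?k s) * ennreal (K \<omega> powr (- \<beta>) * exp (- (\<xi> / s) * K \<omega>)) \<partial>M)"
        using k0[of s] by (intro nn_integral_cong) (simp add: ennreal_mult'[symmetric] mult_ac)
      also have "\<dots> = ennreal (?k s) * (ennreal (1 / Gamma \<beta>) * (\<integral>\<^sup>+x\<in>{\<xi> / s<..}. ennreal ((x - \<xi> / s) powr (\<beta> - 1) * exp (- (x powr \<beta>))) \<partial>lborel))"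
        using s \<xi> by (subst nn_integral_cmult, simp, subst stable_negative_moment[OF assms(1) K0 lap \<beta>(1)]) auto
      also have "\<dots> = (\<integral>\<^sup>+x. ennreal (?k s) * (ennreal (1 / Gamma \<beta>) * (ennreal ((x - \<xi> / s) powr (\<beta> - 1) * exp (- (x powr \<beta>))) * indicator {\<xi> / s<..} x)) \<partial>lborel)"
        by (simp add: nn_integral_cmult)
      also have "\<dots> = (\<integral>\<^sup>+x. ?h x s \<partial>lborel)"
      proof (rule nn_integral_cong)
        fix x :: real
        show "ennreal (?k s) * (ennreal (1 / Gamma \<beta>) * (ennreal ((x - \<xi> / s) powr (\<beta> - 1) * exp (- (x powr \<beta>))) * indicator {\<xi> / s<..} x)) = ?h x s"
        proof (cases "x > \<xi> / s")
          case True
          have "\<xi> / s > \<xi> / t" "\<xi> / s > 0" using s \<xi> by (auto simp: field_simps)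
          then have x: "x > \<xi> / t" "x > 0" using True by auto
          have x': "\<xi> / x < s" using True s x by (simp add: field_simps)
          have "s powr (\<beta> - 1) * (x - \<xi> / s) powr (\<beta> - 1) = (s * x - \<xi>) powr (\<beta> - 1)"
            using s True by (subst powr_mult[symmetric]) (auto simp: right_diff_distrib)
          also have "\<dots> = x powr (\<beta> - 1) * (s - \<xi> / x) powr (\<beta> - 1)"
            using x x' by (subst powr_mult[symmetric]) (auto simp: right_diff_distrib mult.commute)
          finally have e: "s powr (\<beta> - 1) * (x - \<xi> / s) powr (\<beta> - 1) = x powr (\<beta> - 1) * (s - \<xi> / x) powr (\<beta> - 1)" .
          have "?k s * (1 / Gamma \<beta> * ((x - \<xi> / s) powr (\<beta> - 1) * exp (- (x powr \<beta>))))
            = \<beta> / (Gamma \<beta> * Gamma (1 - \<beta>)) * (t - s) powr (- \<beta>) * exp (- (x powr \<beta>)) * (s powr (\<beta> - 1) * (x - \<xi> / s) powr (\<beta> - 1))"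
            using s by (simp add: mult_ac)
          also have "\<dots> = \<beta> / (Gamma \<beta> * Gamma (1 - \<beta>)) * (x powr (\<beta> - 1) * exp (- (x powr \<beta>))) * ((t - s) powr (- \<beta>) * (s - \<xi> / x) powr (\<beta> - 1))"
            unfolding e by (simp only: mult_ac)
          finally have "?k s * (1 / Gamma \<beta> * ((x - \<xi> / s) powr (\<beta> - 1) * exp (- (x powr \<beta>)))) = \<dots>" .
          then show ?thesis
            using True x x' s G \<beta> k0[of s] by (simp add: ennreal_mult'[symmetric])
        next
          case False
          have "\<not> \<xi> / x < s" if "x > \<xi> / t"
          proof -
            have "x > 0" using that \<xi> t by (meson divide_pos_pos less_trans)
            then show ?thesis using False s by (simp add: field_simps)
          qed
          then show ?thesis using False by (auto simp: indicator_def)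
        qed
      qed
      finally show ?thesis .
    qed
  qed
  also have "\<dots> = (\<integral>\<^sup>+x. \<integral>\<^sup>+s. ?h x s \<partial>lborel \<partial>lborel)"
  proof (rule lborel_pair.Fubini')
    have "indicator {\<xi> / x<..<t} s = (indicator {0<..} (s - \<xi> / x) * indicator {..<t} s :: ennreal)" for x s
      by (auto simp: indicator_def)
    then show "(\<lambda>(x, s). ?h x s) \<in> borel_measurable (lborel \<Otimes>\<^sub>M lborel)"
      by simp
  qed
  also have "\<dots> = (\<integral>\<^sup>+x\<in>{\<xi> / t<..}. ennreal (\<beta> * x powr (\<beta> - 1) * exp (- (x powr \<beta>))) \<partial>lborel)"
  proof (rule nn_integral_cong)
    fix x :: real
    show "(\<integral>\<^sup>+s. ?h x s \<partial>lborel) = ennreal (\<beta> * x powr (\<beta> - 1) * exp (- (x powr \<beta>))) * indicator {\<xi> / t<..} x"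
    proof (cases "x > \<xi> / t")
      case True
      have "x > 0" using True \<xi> t by (meson divide_pos_pos less_trans)
      then have "\<xi> / x < t" using True t by (simp add: field_simps)
      then have "(\<integral>\<^sup>+s. ?h x s \<partial>lborel) = ennreal (\<beta> / (Gamma \<beta> * Gamma (1 - \<beta>)) * (x powr (\<beta> - 1) * exp (- (x powr \<beta>)))) * ennreal (Gamma \<beta> * Gamma (1 - \<beta>))"
        using True nn_integral_beta_interval[OF \<beta>, of "\<xi> / x" t] by (subst nn_integral_cmult) auto
      then show ?thesis using True \<beta> G by (simp add: ennreal_mult'[symmetric])
    qed simp
  qed
  also have "\<dots> = ennreal (exp (- ((\<xi> / t) powr \<beta>)))"
    using \<beta> \<xi> t by (intro nn_integral_weibull_tail) auto
  finally show ?thesis .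
qed

end

section \<open>The Caputo derivative along the inverse clock\<close>

lemma powr_neg_div:
  fixes k t \<beta> :: real
  assumes "k > 0" "t > 0"
  shows "(k / t) powr (- \<beta>) = t powr \<beta> * k powr (- \<beta>)"
  using assms by (simp add: powr_divide powr_minus field_simps)

context prob_space
begin

text \<open>With \<open>\<psi> x = v (x powr (- \<beta>))\<close> the expectation on the right is that of \<open>\<psi> (K / t)\<close> and the integrand on
  the left involves \<open>\<psi> (K / s)\<close>. Expressing both through \<open>K\<close>, whose Laplace transform is elementary,
  avoids the Mittag-Leffler transform of \<open>K powr (- \<beta>)\<close>: the identity follows from
  \<open>caputo_kernel_laplace\<close> by uniqueness.\<close>

lemma caputo_kernel_identity:
  fixes K :: "'a \<Rightarrow> real" and v :: "real \<Rightarrow> real"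
  assumes [measurable]: "K \<in> borel_measurable M" and K0: "AE \<omega> in M. 0 < K \<omega>"
    and lap: "\<And>\<xi>. \<xi> \<ge> 0 \<Longrightarrow> expectation (\<lambda>\<omega>. exp (- \<xi> * K \<omega>)) = exp (- (\<xi> powr \<beta>))"
    and \<beta>: "0 < \<beta>" "\<beta> < 1" and t: "t > 0"
    and cont: "continuous_on {0..} v" and bd: "\<And>x. x \<ge> 0 \<Longrightarrow> \<bar>v x\<bar> \<le> C"
  shows "has_bochner_integral lborel
     (\<lambda>s. indicator {0<..<t} s * (\<beta> * s powr (\<beta> - 1) * expectation (\<lambda>\<omega>. K \<omega> powr (- \<beta>) * v (s powr \<beta> * K \<omega> powr (- \<beta>))) / (t - s) powr \<beta>))
     (Gamma (1 - \<beta>) * expectation (\<lambda>\<omega>. v (t powr \<beta> * K \<omega> powr (- \<beta>))))"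
proof -
  interpret P: pair_sigma_finite lborel M ..
  have G: "Gamma (1 - \<beta>) > 0" using \<beta> by auto
  define \<psi> where "\<psi> x = v (max 0 (x powr (- \<beta>)))" for x
  have contm: "continuous_on UNIV (\<lambda>x. v (max 0 x))"
    by (intro continuous_on_compose2[OF cont] continuous_intros) auto
  have [measurable]: "(\<lambda>x. v (max 0 x)) \<in> borel_measurable borel"
    using contm by (simp add: borel_measurable_continuous_onI)
  have v_eq: "v (x powr a * y powr b) = v (max 0 (x powr a * y powr b))" for x a y b by simp
  have [measurable]: "\<psi> \<in> borel_measurable borel"
    unfolding \<psi>_def by measurable
  have \<psi>_eq: "v (s powr \<beta> * K \<omega> powr (- \<beta>)) = \<psi> (K \<omega> / s)" if "K \<omega> > 0" "s > 0" for s \<omega>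
    using that by (simp add: \<psi>_def powr_neg_div)
  define k where "k s = \<beta> / Gamma (1 - \<beta>) * (indicator {0<..<t} s * ((t - s) powr (- \<beta>) * s powr (\<beta> - 1)))" for s
  have k0: "k s \<ge> 0" for s using \<beta> G by (simp add: k_def)
  have [measurable]: "k \<in> borel_measurable borel" unfolding k_def by measurable
  define w where "w p = k (fst p) * K (snd p) powr (- \<beta>)" for p :: "real \<times> 'a"
  \<comment> \<open>The value \<open>1\<close> for \<open>s \<le> 0\<close> only keeps \<open>X\<close> positive; the weight is zero there.\<close>
  define X where "X p = (if 0 < fst p then max 0 (K (snd p)) / fst p else 1)" for p :: "real \<times> 'a"
  have [measurable]: "w \<in> borel_measurable (lborel \<Otimes>\<^sub>M M)" "X \<in> borel_measurable (lborel \<Otimes>\<^sub>M M)"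
    unfolding w_def[abs_def] X_def[abs_def] by measurable
  have w0: "w p \<ge> 0" for p by (simp add: w_def k0)
  have intZ: "integrable M (\<lambda>\<omega>. K \<omega> powr (- \<beta>))"
    by (rule stable_negative_moment_integrable[OF assms(1) K0 lap \<beta>(1)])
  have intw: "integrable (lborel \<Otimes>\<^sub>M M) w"
  proof (rule integrableI_nonneg)
    have "(\<integral>\<^sup>+p. ennreal (w p) \<partial>(lborel \<Otimes>\<^sub>M M)) = (\<integral>\<^sup>+s. \<integral>\<^sup>+\<omega>. ennreal (w (s, \<omega>)) \<partial>M \<partial>lborel)"
      by (rule nn_integral_fst[symmetric]) simp
    also have "\<dots> = (\<integral>\<^sup>+s. ennreal (k s) * ennreal (expectation (\<lambda>\<omega>. K \<omega> powr (- \<beta>))) \<partial>lborel)"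
      using intZ k0 by (intro nn_integral_cong) (simp add: w_def ennreal_mult' nn_integral_cmult nn_integral_eq_integral)
    also have "\<dots> = (\<integral>\<^sup>+s. ennreal (\<beta> / Gamma (1 - \<beta>)) * (ennreal ((t - s) powr (- \<beta>) * (s - 0) powr (\<beta> - 1)) * indicator {0<..<t} s) \<partial>lborel)
         * ennreal (expectation (\<lambda>\<omega>. K \<omega> powr (- \<beta>)))"
      using \<beta> G by (subst nn_integral_multc, simp, intro arg_cong2[of _ _ _ _ "(*)"] nn_integral_cong refl)
        (auto simp: k_def indicator_def ennreal_mult'[symmetric])
    also have "\<dots> = ennreal (\<beta> / Gamma (1 - \<beta>)) * ennreal (Gamma \<beta> * Gamma (1 - \<beta>)) * ennreal (expectation (\<lambda>\<omega>. K \<omega> powr (- \<beta>)))"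
      using nn_integral_beta_interval[OF \<beta>, of 0 t] t by (subst nn_integral_cmult) auto
    also have "\<dots> < \<infinity>" by (simp add: ennreal_mult_less_top)
    finally show "(\<integral>\<^sup>+p. ennreal (w p) \<partial>(lborel \<Otimes>\<^sub>M M)) < \<infinity>" .
  qed (use w0 in auto)
  have AE2: "AE p in lborel \<Otimes>\<^sub>M M. 0 < K (snd p)"
  proof (rule P.AE_pair_measure)
    show "{p \<in> space (lborel \<Otimes>\<^sub>M M). 0 < K (snd p)} \<in> sets (lborel \<Otimes>\<^sub>M M)" by measurable
  qed (use K0 in auto)
  have bdint: "integrable (lborel \<Otimes>\<^sub>M M) (\<lambda>p. w p * \<psi> (X p))"
  proof (rule Bochner_Integration.integrable_bound[OF integrable_mult_right[OF intw, of C]])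
    have "\<bar>w p * \<psi> (X p)\<bar> \<le> \<bar>C * w p\<bar>" for p
      using mult_left_mono[OF bd[of "max 0 (X p powr (- \<beta>))"] w0[of p]] w0[of p] 
        order_trans[OF abs_ge_zero bd[of 0]]
      by (simp add: \<psi>_def abs_mult mult.commute)
    then show "AE p in lborel \<Otimes>\<^sub>M M. norm (w p * \<psi> (X p)) \<le> norm (C * w p)" by simp
  qed simp
  have "expectation (\<lambda>\<omega>. 1 * \<psi> (K \<omega> / t)) = (\<integral>p. w p * \<psi> (X p) \<partial>(lborel \<Otimes>\<^sub>M M))"
  proof (rule laplace_unique_bounded[where C=C and \<psi>=\<psi> and XA="\<lambda>\<omega>. K \<omega> / t" and XB=X])
    show "AE \<omega> in M. 0 \<le> (1::real) \<and> 0 < K \<omega> / t"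
      using K0 by eventually_elim (use t in auto)
    show "AE p in lborel \<Otimes>\<^sub>M M. 0 \<le> w p \<and> 0 < X p"
      using AE2 by eventually_elim (auto simp: w0 X_def)
    show "continuous_on {0<..} \<psi>"
      unfolding \<psi>_def by (intro continuous_on_compose2[OF cont] continuous_intros) auto
    show "\<bar>\<psi> x\<bar> \<le> C" for x unfolding \<psi>_def by (rule bd) simp
    fix \<xi> :: real assume \<xi>: "\<xi> \<ge> 1"
    have "(\<integral>p. w p * exp (- \<xi> * X p) \<partial>(lborel \<Otimes>\<^sub>M M)) = exp (- ((\<xi> / t) powr \<beta>))"
    proof (rule integral_eq_nn_integral[THEN trans])
      have "(\<integral>\<^sup>+p. ennreal (w p * exp (- \<xi> * X p)) \<partial>(lborel \<Otimes>\<^sub>M M)) = (\<integral>\<^sup>+s. \<integral>\<^sup>+\<omega>. ennreal (w (s, \<omega>) * exp (- \<xi> * X (s, \<omega>))) \<partial>M \<partial>lborel)"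
        by (rule nn_integral_fst[symmetric]) simp
      also have "\<dots> = (\<integral>\<^sup>+s. \<integral>\<^sup>+\<omega>. ennreal (\<beta> / Gamma (1 - \<beta>) * (indicator {0<..<t} s * ((t - s) powr (- \<beta>) * s powr (\<beta> - 1)))
             * K \<omega> powr (- \<beta>) * exp (- \<xi> * (K \<omega> / s))) \<partial>M \<partial>lborel)"
        by (rule nn_integral_cong, rule nn_integral_cong_AE, use K0 in eventually_elim)
           (auto simp: w_def X_def k_def indicator_def)
      also have "\<dots> = ennreal (exp (- ((\<xi> / t) powr \<beta>)))"
        using \<xi> by (intro caputo_kernel_laplace[OF assms(1) K0 lap \<beta> t]) auto
      finally show "enn2real (\<integral>\<^sup>+p. ennreal (w p * exp (- \<xi> * X p)) \<partial>(lborel \<Otimes>\<^sub>M M)) = exp (- ((\<xi> / t) powr \<beta>))"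
        by simp
    qed (use w0 in auto)
    then show "expectation (\<lambda>\<omega>. 1 * exp (- \<xi> * (K \<omega> / t))) = (\<integral>p. w p * exp (- \<xi> * X p) \<partial>(lborel \<Otimes>\<^sub>M M))"
      using lap[of "\<xi> / t"] \<xi> t by simp
  qed (use intw in auto)
  moreover have "expectation (\<lambda>\<omega>. 1 * \<psi> (K \<omega> / t)) = expectation (\<lambda>\<omega>. v (t powr \<beta> * K \<omega> powr (- \<beta>)))"
  proof (rule integral_cong_AE)
    show "(\<lambda>\<omega>. v (t powr \<beta> * K \<omega> powr - \<beta>)) \<in> borel_measurable M" unfolding v_eq by measurable
    show "AE \<omega> in M. 1 * \<psi> (K \<omega> / t) = v (t powr \<beta> * K \<omega> powr (- \<beta>))"
      using K0 by eventually_elim (simp add: \<psi>_eq t)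
  qed simp
  ultimately have main: "(\<integral>p. w p * \<psi> (X p) \<partial>(lborel \<Otimes>\<^sub>M M)) = expectation (\<lambda>\<omega>. v (t powr \<beta> * K \<omega> powr (- \<beta>)))"
    by simp
  have fb: "has_bochner_integral lborel (\<lambda>s. Gamma (1 - \<beta>) * (\<integral>\<omega>. w (s, \<omega>) * \<psi> (X (s, \<omega>)) \<partial>M))
      (Gamma (1 - \<beta>) * expectation (\<lambda>\<omega>. v (t powr \<beta> * K \<omega> powr (- \<beta>))))"
    using P.integrable_fst'[OF bdint] P.integral_fst'[OF bdint] main
    by (intro has_bochner_integral_mult_right) (simp add: has_bochner_integral_iff)
  have "Gamma (1 - \<beta>) * (\<integral>\<omega>. w (s, \<omega>) * \<psi> (X (s, \<omega>)) \<partial>M) = 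
     indicator {0<..<t} s * (\<beta> * s powr (\<beta> - 1) * expectation (\<lambda>\<omega>. K \<omega> powr (- \<beta>) * v (s powr \<beta> * K \<omega> powr (- \<beta>))) / (t - s) powr \<beta>)" for s
  proof (cases "0 < s \<and> s < t")
    case True
    have "(\<integral>\<omega>. w (s, \<omega>) * \<psi> (X (s, \<omega>)) \<partial>M) = (\<integral>\<omega>. k s * (K \<omega> powr (- \<beta>) * v (s powr \<beta> * K \<omega> powr (- \<beta>))) \<partial>M)"
    proof (rule integral_cong_AE)
      show "(\<lambda>\<omega>. k s * (K \<omega> powr (- \<beta>) * v (s powr \<beta> * K \<omega> powr (- \<beta>)))) \<in> borel_measurable M"
        unfolding v_eq by measurable
      show "AE \<omega> in M. w (s, \<omega>) * \<psi> (X (s, \<omega>)) = k s * (K \<omega> powr (- \<beta>) * v (s powr \<beta> * K \<omega> powr (- \<beta>)))"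
        using K0 by eventually_elim (use True in \<open>simp add: \<psi>_eq w_def X_def\<close>)
    qed simp
    moreover define e where "e = expectation (\<lambda>\<omega>. K \<omega> powr (- \<beta>) * v (s powr \<beta> * K \<omega> powr (- \<beta>)))"
    then have "(\<integral>\<omega>. k s * (K \<omega> powr (- \<beta>) * v (s powr \<beta> * K \<omega> powr (- \<beta>))) \<partial>M) = k s * e"
      by simp
    ultimately have "(\<integral>\<omega>. w (s, \<omega>) * \<psi> (X (s, \<omega>)) \<partial>M) = k s * e"
      by simp
    then show ?thesis
      unfolding e_def[symmetric] using True G by (simp add: k_def powr_minus field_simps)
  qed (auto simp: w_def k_def)
  then show ?thesis using fb by simp
qed

lemma inverse_stable_derivative:
  fixes K :: "'a \<Rightarrow> real" and u v :: "real \<Rightarrow> real"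
  assumes [measurable]: "K \<in> borel_measurable M" and K0: "AE \<omega> in M. 0 < K \<omega>"
    and lap: "\<And>\<xi>. \<xi> \<ge> 0 \<Longrightarrow> expectation (\<lambda>\<omega>. exp (- \<xi> * K \<omega>)) = exp (- (\<xi> powr \<beta>))"
    and \<beta>: "0 < \<beta>" "\<beta> \<le> 1" and t: "t > 0"
    and contu: "continuous_on {0..} u" and bdu: "\<And>x. x \<ge> 0 \<Longrightarrow> \<bar>u x\<bar> \<le> C'"
    and der: "\<And>x. x > 0 \<Longrightarrow> (u has_real_derivative v x) (at x)"
    and cont: "continuous_on {0..} v" and bd: "\<And>x. x \<ge> 0 \<Longrightarrow> \<bar>v x\<bar> \<le> C"
  shows "((\<lambda>t. expectation (\<lambda>\<omega>. u (t powr \<beta> * K \<omega> powr (- \<beta>)))) has_real_derivative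
     \<beta> * t powr (\<beta> - 1) * expectation (\<lambda>\<omega>. K \<omega> powr (- \<beta>) * v (t powr \<beta> * K \<omega> powr (- \<beta>)))) (at t)"
proof -
  define Z where "Z \<omega> = K \<omega> powr (- \<beta>)" for \<omega>
  have [measurable]: "Z \<in> borel_measurable M" unfolding Z_def[abs_def] by measurable
  have Z0: "Z \<omega> \<ge> 0" for \<omega> by (simp add: Z_def)
  have contm: "continuous_on UNIV (\<lambda>x. v (max 0 x))" "continuous_on UNIV (\<lambda>x. u (max 0 x))"
    by (intro continuous_on_compose2[OF cont] continuous_on_compose2[OF contu] continuous_intros; auto)+
  have [measurable]: "(\<lambda>x. v (max 0 x)) \<in> borel_measurable borel" "(\<lambda>x. u (max 0 x)) \<in> borel_measurable borel"
    using contm by (simp_all add: borel_measurable_continuous_onI)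
  have eq: "F (x powr a * Z \<omega>) = F (max 0 (x powr a * Z \<omega>))" for F :: "real \<Rightarrow> real" and x a \<omega> by (simp add: Z0)
  have intZ: "integrable M Z"
    unfolding Z_def by (rule stable_negative_moment_integrable[OF assms(1) K0 lap \<beta>(1)])
  have C0: "C \<ge> 0" using bd[of 0] by auto
  define g' where "g' t \<omega> = v (t powr \<beta> * Z \<omega>) * (\<beta> * t powr (\<beta> - 1) * Z \<omega>)" for t \<omega>
  have "((\<lambda>t. expectation (\<lambda>\<omega>. u (t powr \<beta> * Z \<omega>))) has_real_derivative expectation (g' t)) (at t)"
  proof (rule has_real_derivative_integral[where r="t / 2" and b="\<lambda>\<omega>. C * (\<beta> * (t / 2) powr (\<beta> - 1)) * Z \<omega>"])
    show "integrable M (\<lambda>\<omega>. u (x powr \<beta> * Z \<omega>))" for x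
      by (rule integrable_const_bound[where B=C'], simp add: bdu Z0, subst eq, measurable)
    show "g' t \<in> borel_measurable M" unfolding g'_def eq[of v] by measurable
    show "AE \<omega> in M. \<forall>x. \<bar>x - t\<bar> < t / 2 \<longrightarrow>
       ((\<lambda>t. u (t powr \<beta> * Z \<omega>)) has_real_derivative g' x \<omega>) (at x) \<and> \<bar>g' x \<omega>\<bar> \<le> C * (\<beta> * (t / 2) powr (\<beta> - 1)) * Z \<omega>"
      using K0
    proof (eventually_elim, intro allI impI conjI)
      fix \<omega> x assume K: "0 < K \<omega>" and x: "\<bar>x - t\<bar> < t / 2"
      then have x0: "x > t / 2" "x > 0" by (auto simp: abs_if split: if_splits)
      have Zp: "Z \<omega> > 0" using K by (simp add: Z_def)
      show "((\<lambda>t. u (t powr \<beta> * Z \<omega>)) has_real_derivative g' x \<omega>) (at x)"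
        unfolding g'_def
        by (rule DERIV_chain'[where f="\<lambda>t. t powr \<beta> * Z \<omega>", OF _ der]) (use x0 Zp in \<open>auto intro!: derivative_eq_intros\<close>)
      have "\<bar>g' x \<omega>\<bar> = \<bar>v (x powr \<beta> * Z \<omega>)\<bar> * (\<beta> * x powr (\<beta> - 1)) * Z \<omega>"
        using Zp \<beta> by (simp add: g'_def abs_mult)
      also have "\<dots> \<le> C * (\<beta> * (t / 2) powr (\<beta> - 1)) * Z \<omega>"
        using \<beta> x0 t Z0 C0 by (intro mult_mono bd powr_mono2') auto
      finally show "\<bar>g' x \<omega>\<bar> \<le> C * (\<beta> * (t / 2) powr (\<beta> - 1)) * Z \<omega>" .
    qed
  qed (use t intZ in auto)
  moreover have "expectation (g' t) = \<beta> * t powr (\<beta> - 1) * expectation (\<lambda>\<omega>. Z \<omega> * v (t powr \<beta> * Z \<omega>))"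
    unfolding g'_def by (subst integral_mult_right_zero[symmetric], intro Bochner_Integration.integral_cong) (auto simp: mult_ac)
  ultimately show ?thesis by (simp add: Z_def)
qed

text \<open>For \<open>\<beta> < 1\<close> the fractional integral of the derivative is \<open>caputo_kernel_identity\<close>. For \<open>\<beta> = 1\<close> there
  is no fractional integral, and the factor \<open>1 / K\<close> in the derivative is removed by comparing Laplace
  transforms once more; this expresses that \<open>K = 1\<close> almost surely.\<close>

lemma caputo_inverse_stable:
  fixes K :: "'a \<Rightarrow> real" and u v f :: "real \<Rightarrow> real"
  assumes [measurable]: "K \<in> borel_measurable M" and K0: "AE \<omega> in M. 0 < K \<omega>"
    and lap: "\<And>\<xi>. \<xi> \<ge> 0 \<Longrightarrow> expectation (\<lambda>\<omega>. exp (- \<xi> * K \<omega>)) = exp (- (\<xi> powr \<beta>))"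
    and \<beta>: "0 < \<beta>" "\<beta> \<le> 1" and t: "t > 0"
    and contu: "continuous_on {0..} u" and bdu: "\<And>x. x \<ge> 0 \<Longrightarrow> \<bar>u x\<bar> \<le> C'"
    and der: "\<And>x. x > 0 \<Longrightarrow> (u has_real_derivative v x) (at x)"
    and cont: "continuous_on {0..} v" and bd: "\<And>x. x \<ge> 0 \<Longrightarrow> \<bar>v x\<bar> \<le> C"
    and f: "\<And>t. t > 0 \<Longrightarrow> f t = expectation (\<lambda>\<omega>. u (t powr \<beta> * K \<omega> powr (- \<beta>)))"
  shows "caputo_deriv_exists \<beta> f t"
    and "caputo_deriv \<beta> f t = expectation (\<lambda>\<omega>. v (t powr \<beta> * K \<omega> powr (- \<beta>)))"
proof -
  let ?D = "\<lambda>t. \<beta> * t powr (\<beta> - 1) * expectation (\<lambda>\<omega>. K \<omega> powr (- \<beta>) * v (t powr \<beta> * K \<omega> powr (- \<beta>)))"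
  have D: "(f has_real_derivative ?D s) (at s)" if "s > 0" for s
    by (rule has_field_derivative_transform_within_open[where S="{0<..}",
          OF inverse_stable_derivative[OF assms(1) K0 lap \<beta> that contu bdu der cont bd]])
       (use that f in auto)
  then have df: "deriv f s = ?D s" if "s > 0" for s using that by (intro DERIV_imp_deriv) auto
  have diff: "f differentiable (at s)" if "s > 0" for s
    using D[OF that] real_differentiable_def by blast
  have "caputo_deriv_exists \<beta> f t \<and> caputo_deriv \<beta> f t = expectation (\<lambda>\<omega>. v (t powr \<beta> * K \<omega> powr (- \<beta>)))"
  proof (cases "\<beta> = 1")
    case False
    then have \<beta>1: "\<beta> < 1" using \<beta> by simp
    then have G: "Gamma (1 - \<beta>) > 0" by simp
    have e: "indicator {0<..<t} s *\<^sub>R (deriv f s / (t - s) powr \<beta>) = indicator {0<..<t} s * (?D s / (t - s) powr \<beta>)" for s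
      by (auto simp: indicator_def df)
    show ?thesis
      using caputo_kernel_identity[OF assms(1) K0 lap \<beta>(1) \<beta>1 t cont bd] False diff G
      unfolding caputo_deriv_exists_def caputo_deriv_def set_integrable_def set_lebesgue_integral_def e
      by (simp add: has_bochner_integral_iff)
  next
    case True
    define \<psi> where "\<psi> x = v (max 0 (x powr (- 1)))" for x :: real
    have contm: "continuous_on UNIV (\<lambda>x. v (max 0 x))"
      by (intro continuous_on_compose2[OF cont] continuous_intros) auto
    have [measurable]: "(\<lambda>x. v (max 0 x)) \<in> borel_measurable borel"
      using contm by (simp add: borel_measurable_continuous_onI)
    have [measurable]: "\<psi> \<in> borel_measurable borel" unfolding \<psi>_def by measurable
    have AEt: "AE \<omega> in M. v (t powr \<beta> * K \<omega> powr (- \<beta>)) = \<psi> (K \<omega> / t)"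
      using K0 by eventually_elim (use t True powr_neg_div[OF _ t, of _ 1] in \<open>simp add: \<psi>_def\<close>)
    have v_eq: "v (x powr a * y powr b) = v (max 0 (x powr a * y powr b))" for x a y b by simp
    have [measurable]: "(\<lambda>\<omega>. v (t powr \<beta> * K \<omega> powr (- \<beta>))) \<in> borel_measurable M"
      unfolding v_eq by measurable
    have "expectation (\<lambda>\<omega>. K \<omega> powr (- 1) * \<psi> (K \<omega> / t)) = expectation (\<lambda>\<omega>. 1 * \<psi> (K \<omega> / t))"
    proof (rule laplace_unique_bounded[where C=C and \<psi>=\<psi> and XA="\<lambda>\<omega>. K \<omega> / t" and XB="\<lambda>\<omega>. K \<omega> / t"])
      show "AE \<omega> in M. 0 \<le> K \<omega> powr - 1 \<and> 0 < K \<omega> / t" "AE \<omega> in M. 0 \<le> (1::real) \<and> 0 < K \<omega> / t"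
        using K0 t by (auto elim!: eventually_mono)
      show "integrable M (\<lambda>\<omega>. K \<omega> powr - 1)"
        using stable_negative_moment_integrable[OF assms(1) K0 lap \<beta>(1)] True by simp
      show "continuous_on {0<..} \<psi>"
        unfolding \<psi>_def by (intro continuous_on_compose2[OF cont] continuous_intros) auto
      show "\<bar>\<psi> x\<bar> \<le> C" for x unfolding \<psi>_def by (rule bd) simp
      fix \<xi> :: real assume \<xi>: "1 \<le> \<xi>"
      have "expectation (\<lambda>\<omega>. K \<omega> powr (- 1) * exp (- \<xi> * (K \<omega> / t))) = exp (- (\<xi> / t))"
      proof (rule integral_eq_nn_integral[THEN trans])
        have "(\<integral>\<^sup>+\<omega>. ennreal (K \<omega> powr (- 1) * exp (- \<xi> * (K \<omega> / t))) \<partial>M)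
          = (\<integral>\<^sup>+\<omega>. ennreal (K \<omega> powr (- \<beta>) * exp (- (\<xi> / t) * K \<omega>)) \<partial>M)"
          by (simp add: True)
        also have "\<dots> = ennreal (1 / Gamma \<beta>) * (\<integral>\<^sup>+x\<in>{\<xi> / t<..}. ennreal ((x - \<xi> / t) powr (\<beta> - 1) * exp (- (x powr \<beta>))) \<partial>lborel)"
          using \<xi> t by (intro stable_negative_moment[OF assms(1) K0 lap \<beta>(1)]) auto
        also have "\<dots> = (\<integral>\<^sup>+x\<in>{\<xi> / t<..}. ennreal (\<beta> * x powr (\<beta> - 1) * exp (- (x powr \<beta>))) \<partial>lborel)"
        proof -
          have "\<xi> / t > 0" using \<xi> t by simp
          then show ?thesis
            by (simp add: True) (intro nn_integral_cong, auto simp: indicator_def)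
        qed
        also have "\<dots> = ennreal (exp (- ((\<xi> / t) powr \<beta>)))"
          using \<xi> t \<beta> by (intro nn_integral_weibull_tail) auto
        finally show "enn2real (\<integral>\<^sup>+\<omega>. ennreal (K \<omega> powr (- 1) * exp (- \<xi> * (K \<omega> / t))) \<partial>M) = exp (- (\<xi> / t))"
          using \<xi> t by (simp add: True)
      qed auto
      then show "expectation (\<lambda>\<omega>. K \<omega> powr (- 1) * exp (- \<xi> * (K \<omega> / t))) = expectation (\<lambda>\<omega>. 1 * exp (- \<xi> * (K \<omega> / t)))"
        using lap[of "\<xi> / t"] \<xi> t True by simp
    qed auto
    moreover have "expectation (\<lambda>\<omega>. v (t powr \<beta> * K \<omega> powr (- \<beta>))) = expectation (\<lambda>\<omega>. 1 * \<psi> (K \<omega> / t))"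
      by (rule integral_cong_AE) (use AEt in auto)
    moreover have "expectation (\<lambda>\<omega>. K \<omega> powr (- \<beta>) * v (t powr \<beta> * K \<omega> powr (- \<beta>))) = expectation (\<lambda>\<omega>. K \<omega> powr (- 1) * \<psi> (K \<omega> / t))"
    proof (rule integral_cong_AE)
      show "(\<lambda>\<omega>. K \<omega> powr (- \<beta>) * v (t powr \<beta> * K \<omega> powr (- \<beta>))) \<in> borel_measurable M" by measurable
      show "AE \<omega> in M. K \<omega> powr (- \<beta>) * v (t powr \<beta> * K \<omega> powr (- \<beta>)) = K \<omega> powr (- 1) * \<psi> (K \<omega> / t)"
        using AEt by eventually_elim (simp add: True)
    qed measurable
    ultimately have "?D t = expectation (\<lambda>\<omega>. v (t powr \<beta> * K \<omega> powr (- \<beta>)))"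
      using True t by simp
    then show ?thesis
      using df[OF t] diff unfolding caputo_deriv_exists_def caputo_deriv_def using True by simp
  qed
  then show "caputo_deriv_exists \<beta> f t"
    and "caputo_deriv \<beta> f t = expectation (\<lambda>\<omega>. v (t powr \<beta> * K \<omega> powr (- \<beta>)))" by auto
qed

end

section \<open>The law of the inverse subordinator\<close>

lemma inverse_subordinator_nonneg: "0 \<le> inverse_subordinator K t \<omega>"
  unfolding inverse_subordinator_def Let_def by (auto intro!: cInf_greatest)

lemma inverse_subordinator_0: "inverse_subordinator K 0 \<omega> = 0"
proof -
  have "{s::real. 0 < s \<and> K s \<omega> \<notin> {0<..<0}} = {0<..}" by auto
  then show ?thesis unfolding inverse_subordinator_def Let_def by simp
qed

text \<open>The set in the infimum is closed upwards by monotonicity and contains its infimum by right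
  continuity. Positivity for \<open>s > 0\<close> excludes that it is entered through the value \<open>0\<close>.\<close>

lemma inverse_subordinator_le_iff:
  assumes mono: "mono_on {0..} (\<lambda>s. K s \<omega>)" and rc: "\<And>s. s \<ge> 0 \<Longrightarrow> continuous (at_right s) (\<lambda>s. K s \<omega>)"
    and zero: "K 0 \<omega> = 0" and pos: "\<And>s. s > 0 \<Longrightarrow> K s \<omega> > 0" and ex: "s0 > 0" "K s0 \<omega> \<ge> t" and t: "t > 0"
  shows "inverse_subordinator K t \<omega> \<le> l \<longleftrightarrow> 0 < l \<and> t \<le> K l \<omega>"
proof -
  define S where "S = {s. 0 < s \<and> K s \<omega> \<notin> {0<..<t}}"
  have S: "S = {s. 0 < s \<and> t \<le> K s \<omega>}" by (auto simp: S_def pos)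
  have ne: "S \<noteq> {}" using ex by (auto simp: S)
  have bb: "bdd_below S" by (rule bdd_belowI[of _ 0]) (auto simp: S)
  have L: "inverse_subordinator K t \<omega> = Inf S"
    using ne unfolding inverse_subordinator_def Let_def S_def[symmetric] by simp
  show ?thesis
  proof
    assume "0 < l \<and> t \<le> K l \<omega>"
    then show "inverse_subordinator K t \<omega> \<le> l" unfolding L by (intro cInf_lower bb) (auto simp: S)
  next
    assume le: "inverse_subordinator K t \<omega> \<le> l"
    have l0: "l \<ge> 0" using le inverse_subordinator_nonneg[of K t \<omega>] by simp
    have above: "t \<le> K s \<omega>" if sl: "s > l" for s
    proof -
      obtain x where x: "x \<in> S" "x < s" using cInf_lessD[OF ne, of s] le sl unfolding L by force
      then have "K x \<omega> \<le> K s \<omega>" by (intro mono_onD[OF mono]) (auto simp: S)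
      then show ?thesis using x by (auto simp: S)
    qed
    have "((\<lambda>s. K s \<omega>) \<longlongrightarrow> K l \<omega>) (at_right l)" using rc[OF l0] by (simp add: continuous_within)
    then have tl: "t \<le> K l \<omega>"
      by (rule tendsto_lowerbound) (auto simp: eventually_at_right_less above intro!: eventually_mono[OF eventually_at_right_less])
    then have "l \<noteq> 0" using zero t by auto
    then show "0 < l \<and> t \<le> K l \<omega>" using l0 tl by simp
  qed
qed

context prob_space
begin

lemma exp_tail_prob_le:
  fixes X :: "'a \<Rightarrow> real"
  assumes [measurable]: "X \<in> borel_measurable M" and X0: "AE \<omega> in M. 0 \<le> X \<omega>" and \<xi>: "\<xi> \<ge> 0"
  shows "prob {\<omega> \<in> space M. X \<omega> \<le> x} \<le> exp (\<xi> * x) * expectation (\<lambda>\<omega>. exp (- \<xi> * X \<omega>))"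
proof -
  have "prob {\<omega> \<in> space M. X \<omega> \<le> x} = expectation (indicator {\<omega> \<in> space M. X \<omega> \<le> x})"
    by simp
  also have "\<dots> \<le> expectation (\<lambda>\<omega>. exp (\<xi> * x) * exp (- \<xi> * X \<omega>))"
  proof (rule integral_mono)
    show "integrable M (\<lambda>\<omega>. exp (\<xi> * x) * exp (- \<xi> * X \<omega>))"
      by (intro integrable_mult_right integrable_exp_nonneg X0 \<xi>) simp
    show "indicator {\<omega> \<in> space M. X \<omega> \<le> x} \<omega> \<le> exp (\<xi> * x) * exp (- \<xi> * X \<omega>)" for \<omega>
      using \<xi> mult_left_mono[of "X \<omega>" x \<xi>] by (auto simp: indicator_def exp_add[symmetric])
  qed (simp_all add: emeasure_eq_measure)
  finally show ?thesis by simp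
qed

text \<open>The probability of \<open>X \<le> 0\<close> is at most the Laplace transform at every \<open>\<xi>\<close>, which tends to \<open>0\<close>.\<close>

lemma stable_pos:
  fixes X :: "'a \<Rightarrow> real"
  assumes [measurable]: "X \<in> borel_measurable M" and X0: "AE \<omega> in M. 0 \<le> X \<omega>"
    and lap: "\<And>\<xi>. \<xi> \<ge> 0 \<Longrightarrow> expectation (\<lambda>\<omega>. exp (- \<xi> * X \<omega>)) = exp (- s * \<xi> powr \<beta>)"
    and \<beta>: "0 < \<beta>" and s: "s > 0"
  shows "AE \<omega> in M. 0 < X \<omega>"
proof -
  have "((\<lambda>\<xi>::real. exp (- s * \<xi> powr \<beta>)) \<longlongrightarrow> 0) at_top" using \<beta> s by real_asymp
  moreover have "\<forall>\<^sub>F \<xi> in at_top. prob {\<omega> \<in> space M. X \<omega> \<le> 0} \<le> exp (- s * \<xi> powr \<beta>)"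
    using eventually_ge_at_top[of 0]
  proof eventually_elim
    fix \<xi> :: real assume "0 \<le> \<xi>"
    then show "prob {\<omega> \<in> space M. X \<omega> \<le> 0} \<le> exp (- s * \<xi> powr \<beta>)"
      using exp_tail_prob_le[OF assms(1) X0, of \<xi> 0] lap[of \<xi>] by simp
  qed
  ultimately have "prob {\<omega> \<in> space M. X \<omega> \<le> 0} \<le> 0"
    by (rule tendsto_lowerbound) simp
  then have "prob {\<omega> \<in> space M. X \<omega> \<le> 0} = 0" by (simp add: antisym)
  then have "AE \<omega> in M. \<not> X \<omega> \<le> 0"
    by (subst (asm) prob_eq_0) (auto elim: eventually_mono)
  then show ?thesis by eventually_elim simp
qed

lemma stable_subordinatorD:
  assumes "stable_subordinator \<alpha> H"
  shows "\<And>t. t \<ge> 0 \<Longrightarrow> H t \<in> borel_measurable M"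
    and "\<And>\<omega>. \<omega> \<in> space M \<Longrightarrow> H 0 \<omega> = 0"
    and "\<And>\<omega>. \<omega> \<in> space M \<Longrightarrow> mono_on {0..} (\<lambda>t. H t \<omega>)"
    and "\<And>\<omega> t. \<omega> \<in> space M \<Longrightarrow> t \<ge> 0 \<Longrightarrow> continuous (at_right t) (\<lambda>s. H s \<omega>)"
    and "\<And>t \<xi>. t \<ge> 0 \<Longrightarrow> \<xi> \<ge> 0 \<Longrightarrow> expectation (\<lambda>\<omega>. exp (- \<xi> * H t \<omega>)) = exp (- t * \<xi> powr \<alpha>)"
    and "\<And>\<omega> t. \<omega> \<in> space M \<Longrightarrow> t \<ge> 0 \<Longrightarrow> H t \<omega> \<ge> 0"
proof -
  show mono: "\<And>\<omega>. \<omega> \<in> space M \<Longrightarrow> mono_on {0..} (\<lambda>t. H t \<omega>)" and z: "\<And>\<omega>. \<omega> \<in> space M \<Longrightarrow> H 0 \<omega> = 0"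
    using assms by (auto simp: stable_subordinator_def)
  show "H t \<omega> \<ge> 0" if "\<omega> \<in> space M" "t \<ge> 0" for \<omega> t
    using mono_onD[OF mono[OF that(1)], of 0 t] z that by auto
qed (use assms in \<open>auto simp: stable_subordinator_def\<close>)

text \<open>Compare distribution functions: almost surely \<open>L\<^sub>t \<le> l\<close> means \<open>K\<^sub>l \<ge> t\<close>, which by scaling has the
  probability of \<open>l powr (1 / \<beta>) * K\<^sub>1 \<ge> t\<close>, that is, of \<open>t powr \<beta> * K\<^sub>1 powr (- \<beta>) \<le> l\<close>.\<close>

lemma inverse_stable_subordinator_law:
  assumes K: "stable_subordinator \<beta> K" and \<beta>: "0 < \<beta>" and t: "t > 0"
    and Lm [measurable]: "inverse_subordinator K t \<in> borel_measurable M"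
  shows "distr M borel (inverse_subordinator K t) = distr M borel (\<lambda>\<omega>. t powr \<beta> * K 1 \<omega> powr (- \<beta>))"
proof -
  note D = stable_subordinatorD[OF K]
  have Km: "K s \<in> borel_measurable M" if "s \<ge> 0" for s using D(1) that .
  note [measurable] = Km[of 1, simplified]
  have AE0: "AE \<omega> in M. 0 \<le> K s \<omega>" if "s \<ge> 0" for s using D(6)[OF _ that] by auto
  have lap1: "expectation (\<lambda>\<omega>. exp (- \<xi> * K 1 \<omega>)) = exp (- (\<xi> powr \<beta>))" if "\<xi> \<ge> 0" for \<xi>
    using D(5)[of 1 \<xi>] that by simp
  have AEpos: "AE \<omega> in M. 0 < K s \<omega>" if "s > 0" for s
    using stable_pos[OF Km AE0 D(5) \<beta> that] that by simp
  have pos: "AE \<omega> in M. \<forall>s>0. 0 < K s \<omega>"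
  proof -
    have "AE \<omega> in M. \<forall>n::nat. 0 < K (1 / real (Suc n)) \<omega>"
      unfolding AE_all_countable by (intro allI AEpos) simp
    then show ?thesis
      using AE_space
    proof eventually_elim
      fix \<omega> assume *: "\<forall>n::nat. 0 < K (1 / real (Suc n)) \<omega>" "\<omega> \<in> space M"
      show "\<forall>s>0. 0 < K s \<omega>"
      proof (intro allI impI)
        fix s :: real assume "0 < s"
        then obtain n where n: "1 / real (Suc n) < s" using nat_approx_posE by blast
        have "K (1 / real (Suc n)) \<omega> \<le> K s \<omega>" using n \<open>0 < s\<close> by (intro mono_onD[OF D(3)[OF *(2)]]) auto
        then show "0 < K s \<omega>" using *(1)[rule_format, of n] by linarith
      qed
    qed
  qed
  have ex: "AE \<omega> in M. \<exists>s>0. t \<le> K s \<omega>"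
  proof -
    have Sm [measurable]: "{\<omega> \<in> space M. \<forall>n::nat. K (real n) \<omega> \<le> t} \<in> sets M"
      using Km by (intro sets.sets_Collect_countable_All) (measurable, simp)
    have "prob {\<omega> \<in> space M. \<forall>n::nat. K (real n) \<omega> \<le> t} \<le> exp t * exp (- real n)" for n
    proof -
      have "prob {\<omega> \<in> space M. \<forall>n::nat. K (real n) \<omega> \<le> t} \<le> prob {\<omega> \<in> space M. K (real n) \<omega> \<le> t}"
        using Km[of "real n"] by (intro finite_measure_mono) auto
      also have "\<dots> \<le> exp t * exp (- real n)"
        using exp_tail_prob_le[OF Km AE0, of "real n" 1 t] D(5)[of "real n" 1] by simp
      finally show ?thesis .
    qed
    then have "prob {\<omega> \<in> space M. \<forall>n::nat. K (real n) \<omega> \<le> t} \<le> 0"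
      by (intro LIMSEQ_le_const[of "\<lambda>n. exp t * exp (- real n)"]) (real_asymp, auto)
    then have "prob {\<omega> \<in> space M. \<forall>n::nat. K (real n) \<omega> \<le> t} = 0" by (simp add: antisym)
    then have "AE \<omega> in M. \<not> (\<forall>n::nat. K (real n) \<omega> \<le> t)"
      by (subst (asm) prob_eq_0) (auto elim: eventually_mono)
    then show ?thesis
      using AE_space
    proof eventually_elim
      fix \<omega> assume "\<not> (\<forall>n::nat. K (real n) \<omega> \<le> t)" "\<omega> \<in> space M"
      then obtain n :: nat where n: "t < K (real n) \<omega>" by (auto simp: not_le)
      have "n \<noteq> 0"
      proof
        assume "n = 0"
        then show False using n D(2)[OF \<open>\<omega> \<in> space M\<close>] t by simp
      qed
      then show "\<exists>s>0. t \<le> K s \<omega>" using n by (intro exI[of _ "real n"]) auto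
    qed
  qed
  have iff: "AE \<omega> in M. \<forall>l. inverse_subordinator K t \<omega> \<le> l \<longleftrightarrow> 0 < l \<and> t \<le> K l \<omega>"
    using pos ex AE_space
    by eventually_elim (use D t in \<open>auto simp: inverse_subordinator_le_iff\<close>)
  have scale: "prob {\<omega> \<in> space M. K l \<omega> < t} = prob {\<omega> \<in> space M. l powr (1 / \<beta>) * K 1 \<omega> < t}" if l: "l > 0" for l
  proof -
    \<comment> \<open>Continuous functions increasing to the indicator of \<open>{..<t}\<close>; continuity is what the
      scaling lemma asks for.\<close>
    define \<psi> where "\<psi> n r = min 1 (max 0 (real n * (t - r)))" for n r
    have cont: "continuous_on UNIV (\<psi> n)" for n unfolding \<psi>_def by (intro continuous_intros)
    have van: "\<psi> n x = 0" if "x \<ge> t" for n x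
      using that by (simp add: \<psi>_def mult_nonneg_nonpos)
    have [measurable]: "\<psi> n \<in> borel_measurable borel" for n
      using cont by (simp add: borel_measurable_continuous_onI)
    have lim: "(\<lambda>n. expectation (\<lambda>\<omega>. \<psi> n (X \<omega>))) \<longlonglongrightarrow> prob {\<omega> \<in> space M. X \<omega> < t}"
      if [measurable]: "X \<in> borel_measurable M" for X
    proof -
      have "(\<lambda>n. expectation (\<lambda>\<omega>. \<psi> n (X \<omega>))) \<longlonglongrightarrow> expectation (indicator {\<omega> \<in> space M. X \<omega> < t})"
      proof (rule integral_dominated_convergence[where w="\<lambda>_. 1"])
        show "AE \<omega> in M. (\<lambda>n. \<psi> n (X \<omega>)) \<longlonglongrightarrow> indicator {\<omega> \<in> space M. X \<omega> < t} \<omega>"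
          using AE_space
        proof eventually_elim
          fix \<omega> assume \<omega>: "\<omega> \<in> space M"
          show "(\<lambda>n. \<psi> n (X \<omega>)) \<longlonglongrightarrow> indicator {\<omega> \<in> space M. X \<omega> < t} \<omega>"
          proof (cases "X \<omega> < t")
            case True
            obtain n0 :: nat where n0: "real n0 \<ge> 1 / (t - X \<omega>)" using real_arch_simple by blast
            have "\<psi> n (X \<omega>) = 1" if "n \<ge> n0" for n
            proof -
              have "real n \<ge> 1 / (t - X \<omega>)" using n0 that by linarith
              then have "real n * (t - X \<omega>) \<ge> 1" using True by (simp add: field_simps)
              then show ?thesis by (simp add: \<psi>_def)
            qed
            then show ?thesis using True \<omega>
              by (intro tendsto_eventually) (auto simp: eventually_sequentially)
          qed (simp add: van)
        qed
      qed (auto simp: \<psi>_def)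
      then show ?thesis by simp
    qed
    have "expectation (\<lambda>\<omega>. \<psi> n (K l \<omega>)) = expectation (\<lambda>\<omega>. \<psi> n (l powr (1 / \<beta>) * K 1 \<omega>))" for n
      using l by (intro stable_scaling[OF Km Km AE0 AE0 D(5) lap1 \<beta> _ cont van]) auto
    then show ?thesis
      using lim[of "K l"] lim[of "\<lambda>\<omega>. l powr (1 / \<beta>) * K 1 \<omega>"] Km[of l] l LIMSEQ_unique by auto
  qed
  have Zpos: "AE \<omega> in M. 0 < t powr \<beta> * K 1 \<omega> powr (- \<beta>)"
    using AEpos[OF zero_less_one] by eventually_elim (use t in simp)
  have cdf_eq: "prob {\<omega> \<in> space M. inverse_subordinator K t \<omega> \<le> l} = prob {\<omega> \<in> space M. t powr \<beta> * K 1 \<omega> powr (- \<beta>) \<le> l}" for l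
  proof (cases "l > 0")
    case False
    have "prob {\<omega> \<in> space M. inverse_subordinator K t \<omega> \<le> l} = prob {}"
      using iff False by (intro finite_measure_eq_AE) (auto elim!: eventually_mono)
    also have "\<dots> = prob {\<omega> \<in> space M. t powr \<beta> * K 1 \<omega> powr (- \<beta>) \<le> l}"
      using Zpos False by (intro finite_measure_eq_AE) (auto elim!: eventually_mono)
    finally show ?thesis .
  next
    case l: True
    have [measurable]: "K l \<in> borel_measurable M" using Km[of l] l by simp
    have "prob {\<omega> \<in> space M. inverse_subordinator K t \<omega> \<le> l} = prob {\<omega> \<in> space M. \<not> K l \<omega> < t}"
    proof (rule finite_measure_eq_AE)
      show "AE \<omega> in M. (\<omega> \<in> {\<omega> \<in> space M. inverse_subordinator K t \<omega> \<le> l}) =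
          (\<omega> \<in> {\<omega> \<in> space M. \<not> K l \<omega> < t})"
        using iff by eventually_elim (use l in \<open>simp add: not_less\<close>)
    qed measurable
    also have "\<dots> = 1 - prob {\<omega> \<in> space M. K l \<omega> < t}"
      by (rule prob_neg) simp
    also have "\<dots> = 1 - prob {\<omega> \<in> space M. l powr (1 / \<beta>) * K 1 \<omega> < t}"
      using scale[OF l] by simp
    also have "\<dots> = prob {\<omega> \<in> space M. \<not> l powr (1 / \<beta>) * K 1 \<omega> < t}"
      by (rule prob_neg[symmetric]) simp
    also have "\<dots> = prob {\<omega> \<in> space M. t powr \<beta> * K 1 \<omega> powr (- \<beta>) \<le> l}"
    proof (rule finite_measure_eq_AE)
      show "AE \<omega> in M. (\<omega> \<in> {\<omega> \<in> space M. \<not> l powr (1 / \<beta>) * K 1 \<omega> < t}) =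
        (\<omega> \<in> {\<omega> \<in> space M. t powr \<beta> * K 1 \<omega> powr (- \<beta>) \<le> l})"
        using AEpos[of 1, simplified] AE_space
      proof eventually_elim
        fix \<omega> assume k: "0 < K 1 \<omega>"
        have "\<not> l powr (1 / \<beta>) * K 1 \<omega> < t \<longleftrightarrow> t powr \<beta> \<le> (l powr (1 / \<beta>) * K 1 \<omega>) powr \<beta>"
          using k l t \<beta> powr_mono2[of \<beta> t "l powr (1 / \<beta>) * K 1 \<omega>"]
            powr_less_mono2[of \<beta> "l powr (1 / \<beta>) * K 1 \<omega>" t] by fastforce
        also have "(l powr (1 / \<beta>) * K 1 \<omega>) powr \<beta> = l * K 1 \<omega> powr \<beta>"
          using k l \<beta> by (simp add: powr_mult powr_powr)
        also have "t powr \<beta> \<le> l * K 1 \<omega> powr \<beta> \<longleftrightarrow> t powr \<beta> * K 1 \<omega> powr (- \<beta>) \<le> l"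
          using k by (simp add: powr_minus field_simps)
        finally show "(\<omega> \<in> {\<omega> \<in> space M. \<not> l powr (1 / \<beta>) * K 1 \<omega> < t}) =
           (\<omega> \<in> {\<omega> \<in> space M. t powr \<beta> * K 1 \<omega> powr (- \<beta>) \<le> l})" by simp
      qed
    qed auto
    finally show ?thesis .
  qed
  show ?thesis
  proof (rule cdf_unique)
    show "real_distribution (distr M borel (inverse_subordinator K t))"
      "real_distribution (distr M borel (\<lambda>\<omega>. t powr \<beta> * K 1 \<omega> powr (- \<beta>)))"
      by simp_all
    show "cdf (distr M borel (inverse_subordinator K t)) = cdf (distr M borel (\<lambda>\<omega>. t powr \<beta> * K 1 \<omega> powr (- \<beta>)))"
    proof
      fix l
      show "cdf (distr M borel (inverse_subordinator K t)) l = cdf (distr M borel (\<lambda>\<omega>. t powr \<beta> * K 1 \<omega> powr (- \<beta>))) l"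
        using cdf_eq[of l] by (simp add: cdf_def measure_distr vimage_def Int_def conj_commute)
    qed
  qed
qed

end

section \<open>Evaluating the processes at the independent clock\<close>

lemma tendsto_at_right_seq:
  fixes F :: "real \<Rightarrow> 'b::topological_space"
  assumes "continuous (at_right t) F" "X \<longlonglongrightarrow> t" "\<And>n. X n > t"
  shows "(\<lambda>n. F (X n)) \<longlonglongrightarrow> F t"
proof -
  have "(F \<longlongrightarrow> F t) (at_right t)" using assms(1) by (simp add: continuous_within)
  moreover have "filterlim X (at_right t) sequentially"
    using assms(2,3) by (intro filterlim_at_withinI) auto
  ultimately show ?thesis by (rule filterlim_compose)
qed

text \<open>The largest \<open>j\<close> with \<open>j / (n + 1) \<le> x\<close>, for \<open>x \<ge> 0\<close>.\<close>

definition upper_grid :: "nat \<Rightarrow> real \<Rightarrow> nat" where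
  "upper_grid n x = nat \<lfloor>real (Suc n) * x\<rfloor>"

lemma upper_grid_measurable [measurable]: "upper_grid n \<in> measurable borel (count_space UNIV)"
  unfolding upper_grid_def[abs_def] by measurable

text \<open>The offset \<open>Suc\<close> makes the approximation strict from above, as right continuity needs.\<close>

lemma upper_grid_approx:
  assumes "x \<ge> 0"
  shows "x < real (Suc (upper_grid n x)) / real (Suc n)" 
    and "real (Suc (upper_grid n x)) / real (Suc n) \<le> x + 1 / real (Suc n)"
proof -
  have "real (upper_grid n x) = of_int \<lfloor>real (Suc n) * x\<rfloor>"
    using assms unfolding upper_grid_def by (subst of_nat_nat) auto
  then have "real (Suc n) * x < real (Suc (upper_grid n x))" "real (upper_grid n x) \<le> real (Suc n) * x"
    by linarith+
  then show "x < real (Suc (upper_grid n x)) / real (Suc n)" 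
    and "real (Suc (upper_grid n x)) / real (Suc n) \<le> x + 1 / real (Suc n)"
    by (simp_all add: field_simps del: of_nat_Suc)
qed

lemma upper_grid_tendsto:
  assumes "x \<ge> 0"
  shows "(\<lambda>n. real (Suc (upper_grid n x)) / real (Suc n)) \<longlonglongrightarrow> x"
proof (rule tendsto_sandwich[of "\<lambda>_. x" _ _ "\<lambda>n. x + 1 / real (Suc n)"])
  show "(\<lambda>n. x + 1 / real (Suc n)) \<longlonglongrightarrow> x" by real_asymp
qed (use upper_grid_approx[OF assms] in \<open>auto intro: less_imp_le always_eventually\<close>)

lemma random_time_measurable:
  fixes F :: "real \<Rightarrow> 'a \<Rightarrow> real"
  assumes Fm: "\<And>s. s \<ge> 0 \<Longrightarrow> F s \<in> borel_measurable M"
    and [measurable]: "T \<in> borel_measurable M" and T0: "\<And>\<omega>. \<omega> \<in> space M \<Longrightarrow> T \<omega> \<ge> 0"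
    and rc: "\<And>\<omega> s. \<omega> \<in> space M \<Longrightarrow> s \<ge> 0 \<Longrightarrow> continuous (at_right s) (\<lambda>s. F s \<omega>)"
  shows "(\<lambda>\<omega>. F (T \<omega>) \<omega>) \<in> borel_measurable M"
proof (rule borel_measurable_LIMSEQ_real)
  show "(\<lambda>n. F (real (Suc (upper_grid n (T \<omega>))) / real (Suc n)) \<omega>) \<longlonglongrightarrow> F (T \<omega>) \<omega>" if "\<omega> \<in> space M" for \<omega>
    by (rule tendsto_at_right_seq[OF rc[OF that T0[OF that]] upper_grid_tendsto[OF T0[OF that]] upper_grid_approx(1)[OF T0[OF that]]])
  show "(\<lambda>\<omega>. F (real (Suc (upper_grid n (T \<omega>))) / real (Suc n)) \<omega>) \<in> borel_measurable M" for n
    by (rule measurable_compose_countable[where f="\<lambda>j \<omega>. F (real (Suc j) / real (Suc n)) \<omega>" and g="\<lambda>\<omega>. upper_grid n (T \<omega>)"])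
       (auto intro!: Fm)
qed

context prob_space
begin

text \<open>Conditioning on the value of a discrete time. The hypothesis \<open>eq\<close> is what independence of \<open>J\<close> and
  \<open>\<Phi> j\<close> provides, with \<open>U j\<close> the mean of \<open>\<Phi> j\<close>.\<close>

lemma expectation_discrete_mixture:
  fixes J :: "'a \<Rightarrow> nat" and \<Phi> :: "nat \<Rightarrow> 'a \<Rightarrow> real" and U :: "nat \<Rightarrow> real"
  assumes [measurable]: "J \<in> measurable M (count_space UNIV)" "\<And>j. \<Phi> j \<in> borel_measurable M"
    and bd: "\<And>j. AE \<omega> in M. \<bar>\<Phi> j \<omega>\<bar> \<le> C" and bdU: "\<And>j. \<bar>U j\<bar> \<le> C"
    and eq: "\<And>j. expectation (\<lambda>\<omega>. indicator {j} (J \<omega>) * \<Phi> j \<omega>) = expectation (\<lambda>\<omega>. indicator {j} (J \<omega>)) * U j"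
  shows "expectation (\<lambda>\<omega>. \<Phi> (J \<omega>) \<omega>) = expectation (\<lambda>\<omega>. U (J \<omega>))"
proof -
  have sum_eq: "(\<Sum>j<n. indicator {j} i * f j) = (if i < n then f i else (0::real))" for n i and f :: "nat \<Rightarrow> real"
  proof -
    have "(\<Sum>j<n. indicator {j} i * f j) = (\<Sum>j<n. if i = j then f j else 0)"
      by (intro sum.cong) (auto simp: indicator_def)
    then show ?thesis by simp
  qed
  have conv: "(\<lambda>n. \<Sum>j<n. expectation (\<lambda>\<omega>. indicator {j} (J \<omega>) * f j \<omega>)) \<longlonglongrightarrow> expectation (\<lambda>\<omega>. f (J \<omega>) \<omega>)"
    if f [measurable]: "\<And>j. f j \<in> borel_measurable M" and b: "\<And>j. AE \<omega> in M. \<bar>f j \<omega>\<bar> \<le> C" for f :: "nat \<Rightarrow> 'a \<Rightarrow> real"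
  proof -
    have ball: "AE \<omega> in M. \<forall>j. \<bar>f j \<omega>\<bar> \<le> C" using b by (simp add: AE_all_countable)
    have ind [measurable]: "(\<lambda>\<omega>. indicator {j} (J \<omega>) :: real) \<in> borel_measurable M" for j
      by (rule measurable_compose[OF assms(1)]) simp
    have int: "integrable M (\<lambda>\<omega>. indicator {j} (J \<omega>) * f j \<omega>)" for j
    proof (rule integrable_const_bound[where B=C])
      show "AE \<omega> in M. norm (indicator {j} (J \<omega>) * f j \<omega>) \<le> C"
        using b[of j] by eventually_elim (auto simp: indicator_def)
    qed (intro borel_measurable_times ind f)
    have [measurable]: "(\<lambda>\<omega>. f (J \<omega>) \<omega>) \<in> borel_measurable M"
      by (rule measurable_compose_countable[where f=f and g=J]) auto
    have "(\<lambda>n. expectation (\<lambda>\<omega>. \<Sum>j<n. indicator {j} (J \<omega>) * f j \<omega>)) \<longlonglongrightarrow> expectation (\<lambda>\<omega>. f (J \<omega>) \<omega>)"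
    proof (rule integral_dominated_convergence[where w="\<lambda>_. C"])
      show "AE \<omega> in M. (\<lambda>n. \<Sum>j<n. indicator {j} (J \<omega>) * f j \<omega>) \<longlonglongrightarrow> f (J \<omega>) \<omega>"
        unfolding sum_eq
        by (intro AE_I2 tendsto_eventually eventually_mono[OF eventually_gt_at_top]) auto
      show "AE \<omega> in M. norm (\<Sum>j<n. indicator {j} (J \<omega>) * f j \<omega>) \<le> C" for n
        using ball unfolding sum_eq by eventually_elim (auto intro: order_trans[OF abs_ge_zero])
    qed auto
    moreover have "expectation (\<lambda>\<omega>. \<Sum>j<n. indicator {j} (J \<omega>) * f j \<omega>) = (\<Sum>j<n. expectation (\<lambda>\<omega>. indicator {j} (J \<omega>) * f j \<omega>))" for n
      by (rule Bochner_Integration.integral_sum) (rule int)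
    ultimately show ?thesis by (simp only:)
  qed
  have "(\<lambda>n. \<Sum>j<n. expectation (\<lambda>\<omega>. indicator {j} (J \<omega>) * U j)) \<longlonglongrightarrow> expectation (\<lambda>\<omega>. \<Phi> (J \<omega>) \<omega>)"
    using conv[of \<Phi>] bd eq by simp
  moreover have "(\<lambda>n. \<Sum>j<n. expectation (\<lambda>\<omega>. indicator {j} (J \<omega>) * U j)) \<longlonglongrightarrow> expectation (\<lambda>\<omega>. U (J \<omega>))"
    using conv[of "\<lambda>j _. U j"] bdU by simp
  ultimately show ?thesis by (rule LIMSEQ_unique)
qed

text \<open>Independence of the processes is used only through three evaluations at fixed times.\<close>

lemma indep_processes_expectation:
  fixes X0 X1 X2 :: "real \<Rightarrow> 'a \<Rightarrow> real" and f0 f1 f2 :: "real \<Rightarrow> real"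
  assumes ind: "indep_processes [X0, X1, X2]" and s: "s \<ge> 0" "t \<ge> 0"
    and [measurable]: "f0 \<in> borel_measurable borel" "f1 \<in> borel_measurable borel" "f2 \<in> borel_measurable borel"
    and int: "integrable M (\<lambda>\<omega>. f0 (X0 s \<omega>))" "integrable M (\<lambda>\<omega>. f1 (X1 s \<omega>))" "integrable M (\<lambda>\<omega>. f2 (X2 t \<omega>))"
  shows "expectation (\<lambda>\<omega>. f0 (X0 s \<omega>) * f1 (X1 s \<omega>) * f2 (X2 t \<omega>)) =
    expectation (\<lambda>\<omega>. f0 (X0 s \<omega>)) * expectation (\<lambda>\<omega>. f1 (X1 s \<omega>)) * expectation (\<lambda>\<omega>. f2 (X2 t \<omega>))"
proof -
  let ?P = "\<Pi>\<^sub>M t\<in>{0::real..}. (borel :: real measure)"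
  define Y where "Y i x = (if i = 0 then f0 (x s) else if i = 1 then f1 (x s) else f2 (x t))" for i :: nat and x :: "real \<Rightarrow> real"
  have [measurable]: "(\<lambda>x. x u) \<in> measurable ?P borel" if "u \<ge> 0" for u
    using that by (intro measurable_component_singleton) auto
  have Ym: "Y i \<in> borel_measurable ?P" for i
    unfolding Y_def using s by (cases "i = 0"; cases "i = 1") (simp_all, measurable)
  have iv: "indep_vars (\<lambda>_. borel) (\<lambda>i \<omega>. Y i (\<lambda>t\<in>{0..}. ([X0, X1, X2] ! i) t \<omega>)) {..<3}"
  proof (rule indep_vars_compose2[OF _ Ym])
    show "indep_vars (\<lambda>_. ?P) (\<lambda>i \<omega>. \<lambda>t\<in>{0..}. ([X0, X1, X2] ! i) t \<omega>) {..<3}"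
      using ind unfolding indep_processes_def by (simp add: numeral_3_eq_3)
  qed
  have "integrable M (\<lambda>\<omega>. Y i (\<lambda>t\<in>{0..}. ([X0, X1, X2] ! i) t \<omega>))" if "i \<in> {..<3}" for i
  proof -
    have "i = 0 \<or> i = 1 \<or> i = 2" using that by auto
    then show ?thesis using int s by (auto simp: Y_def)
  qed
  then have "expectation (\<lambda>\<omega>. \<Prod>i\<in>{..<3}. Y i (\<lambda>t\<in>{0..}. ([X0, X1, X2] ! i) t \<omega>)) =
     (\<Prod>i\<in>{..<3}. expectation (\<lambda>\<omega>. Y i (\<lambda>t\<in>{0..}. ([X0, X1, X2] ! i) t \<omega>)))"
    by (intro indep_vars_lebesgue_integral iv) auto
  then show ?thesis
    using s by (simp add: Y_def eval_nat_numeral lessThan_Suc mult_ac)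
qed

lemma indep_processes_measurable:
  fixes X0 X1 X2 :: "real \<Rightarrow> 'a \<Rightarrow> real"
  assumes ind: "indep_processes [X0, X1, X2]" and t: "t \<ge> 0"
  shows "X2 t \<in> borel_measurable M"
proof -
  have "\<forall>i\<in>{..<length [X0, X1, X2]}. (\<lambda>\<omega>. \<lambda>t\<in>{0..}. ([X0, X1, X2] ! i) t \<omega>) \<in> measurable M (\<Pi>\<^sub>M t\<in>{0::real..}. borel)"
    using ind unfolding indep_processes_def indep_vars_def by (rule conjunct1)
  from bspec[OF this, of 2]
  have "(\<lambda>\<omega>. \<lambda>t\<in>{0..}. ([X0, X1, X2] ! 2) t \<omega>) \<in> measurable M (\<Pi>\<^sub>M t\<in>{0::real..}. borel)"
    by simp
  then have "(\<lambda>\<omega>. (\<lambda>t\<in>{0..}. ([X0, X1, X2] ! 2) t \<omega>) t) \<in> measurable M borel"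
    by (rule measurable_compose[OF _ measurable_component_singleton]) (use t in simp)
  then show ?thesis using t by simp
qed

lemma poisson_processD:
  assumes "poisson_process lam N"
  shows "\<And>t. t \<ge> 0 \<Longrightarrow> N t \<in> measurable M (count_space UNIV)"
    and "\<And>\<omega>. \<omega> \<in> space M \<Longrightarrow> N 0 \<omega> = 0"
    and "\<And>\<omega> t. \<omega> \<in> space M \<Longrightarrow> t \<ge> 0 \<Longrightarrow> continuous (at_right t) (\<lambda>s. N s \<omega>)"
  using assms by (auto simp: poisson_process_def)

lemma poisson_process_weight:
  assumes N: "poisson_process lam N" and lam: "lam > 0" and s: "s \<ge> 0"
  shows "expectation (\<lambda>\<omega>. indicator {real k} (real (N s \<omega>))) = poisson_weight lam k s"
proof (cases "s = 0")
  case True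
  have "expectation (\<lambda>\<omega>. indicator {real k} (real (N s \<omega>))) = expectation (\<lambda>\<omega>. (indicator {k} (0::nat)) :: real)"
    using poisson_processD(2)[OF N] True by (intro Bochner_Integration.integral_cong) (auto simp: indicator_def)
  then show ?thesis using True by (cases k) (auto simp: poisson_weight_def prob_space)
next
  case False
  then have s: "s > 0" using s by simp
  note [measurable] = poisson_processD(1)[OF N]
  have m: "N s \<in> measurable M (count_space UNIV)" using poisson_processD(1)[OF N] s by simp
  have "distr M (count_space UNIV) (\<lambda>\<omega>. N s \<omega> - N 0 \<omega>) = measure_pmf (poisson_pmf (lam * (s - 0)))"
    using N s by (auto simp: poisson_process_def)
  moreover have "distr M (count_space UNIV) (\<lambda>\<omega>. N s \<omega> - N 0 \<omega>) = distr M (count_space UNIV) (N s)"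
    using poisson_processD(2)[OF N] by (intro distr_cong) auto
  ultimately have d: "distr M (count_space UNIV) (N s) = measure_pmf (poisson_pmf (lam * s))" by simp
  have "expectation (\<lambda>\<omega>. indicator {real k} (real (N s \<omega>))) = expectation (\<lambda>\<omega>. indicator {k} (N s \<omega>) :: real)"
    by (intro Bochner_Integration.integral_cong) (auto simp: indicator_def)
  also have "\<dots> = (\<integral>n. indicator {k} n \<partial>distr M (count_space UNIV) (N s))"
    by (rule integral_distr[OF m, symmetric]) simp
  also have "\<dots> = pmf (poisson_pmf (lam * s)) k"
    unfolding d by (simp add: pmf.rep_eq)
  also have "\<dots> = poisson_weight lam k s"
    using lam s by (simp add: poisson_weight_def pmf_poisson)
  finally show ?thesis .
qed

text \<open>Evaluation of a path at a real argument is not measurable on the product space of paths, so Fubini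
  does not apply directly to the random time. For a time on the grid of mesh \<open>1 / (n + 1)\<close> above \<open>L\<^sub>t\<close> the
  identity is conditioning on countably many values; letting \<open>n\<close> grow, the left-hand side converges
  by right continuity of the paths and the right-hand side by continuity of the semigroup.\<close>

lemma expectation_random_time:
  fixes H :: "real \<Rightarrow> 'a \<Rightarrow> real" and G :: "nat \<Rightarrow> real \<Rightarrow> real"
  assumes N: "poisson_process lam N" and lam: "lam > 0" and H: "stable_subordinator \<alpha> H" and \<alpha>: "0 < \<alpha>"
    and ind: "indep_processes [\<lambda>t \<omega>. real (N t \<omega>), H, L]" and t: "t \<ge> 0"
    and L0: "\<And>\<omega>. L t \<omega> \<ge> 0"
    and cont: "\<And>k. continuous_on UNIV (G k)" and van: "\<And>k x. x \<ge> R \<Longrightarrow> G k x = 0"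
    and vanm: "\<And>k x. k \<ge> m \<Longrightarrow> x \<ge> 0 \<Longrightarrow> G k x = 0"
  shows "expectation (\<lambda>\<omega>. G (N (L t \<omega>) \<omega>) (H (L t \<omega>) \<omega>)) = expectation (\<lambda>\<omega>. poisson_stable_mean \<alpha> lam (H 1) m G (L t \<omega>))"
proof -
  define U where "U = poisson_stable_mean \<alpha> lam (H 1) m G"
  note ND = poisson_processD[OF N] and HD = stable_subordinatorD[OF H]
  have [measurable]: "L t \<in> borel_measurable M" by (rule indep_processes_measurable[OF ind t])
  have Hm: "H s \<in> borel_measurable M" if "s \<ge> 0" for s using HD(1) that .
  have H1: "H 1 \<in> borel_measurable M" using Hm by simp
  have H0: "AE \<omega> in M. 0 \<le> H s \<omega>" if "s \<ge> 0" for s using HD(6)[OF _ that] by auto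
  have [measurable]: "G k \<in> borel_measurable borel" for k
    using cont by (simp add: borel_measurable_continuous_onI)
  obtain CU where CU: "CU \<ge> 0" "\<And>s. s \<ge> 0 \<Longrightarrow> \<bar>U s\<bar> \<le> CU"
    unfolding U_def by (rule poisson_stable_mean_bounded[where \<alpha>=\<alpha> and m=m and G=G and R=R, OF H1 H0[OF zero_le_one] lam cont])
      (auto simp: van)
  have "\<exists>C\<ge>0. \<forall>x\<ge>0. \<bar>G k x\<bar> \<le> C" for k using vanishing_bounded[where \<psi>="G k" and R=R, OF cont van] by metis
  then obtain c where c0: "\<And>k. c k \<ge> 0" and c: "\<And>k x. x \<ge> 0 \<Longrightarrow> \<bar>G k x\<bar> \<le> c k" by metis
  define C where "C = CU + (\<Sum>k<m. c k)"
  have GC: "\<bar>G k x\<bar> \<le> C" if "x \<ge> 0" for k x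
  proof (cases "k < m")
    case True
    have "\<bar>G k x\<bar> \<le> c k" using c that by simp
    also have "\<dots> \<le> (\<Sum>k<m. c k)" using True c0 by (intro member_le_sum) auto
    finally show ?thesis using CU(1) by (simp add: C_def)
  next
    case False
    then show ?thesis using vanm[of k x] that CU(1) c0 by (auto simp: C_def intro!: add_nonneg_nonneg sum_nonneg)
  qed
  have UC: "\<bar>U s\<bar> \<le> C" if "s \<ge> 0" for s
    using CU(2)[OF that] c0 by (auto simp: C_def intro!: sum_nonneg add_increasing2)
  have fixed: "expectation (\<lambda>\<omega>. f (L t \<omega>) * G (N s \<omega>) (H s \<omega>)) = expectation (\<lambda>\<omega>. f (L t \<omega>)) * U s"
    if s: "s \<ge> 0" and [measurable]: "f \<in> borel_measurable borel" and fb: "\<And>x. \<bar>f x\<bar> \<le> 1" for s and f :: "real \<Rightarrow> real"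
  proof -
    have Nm [measurable]: "N s \<in> measurable M (count_space UNIV)" using ND(1)[OF s] .
    have [measurable]: "H s \<in> borel_measurable M" using Hm[OF s] .
    have intf: "integrable M (\<lambda>\<omega>. f (L t \<omega>))"
      by (rule integrable_const_bound[where B=1]) (auto simp: fb)
    have intG: "integrable M (\<lambda>\<omega>. G k (H s \<omega>))" for k
      by (rule integrable_const_bound[where B=C]) (use H0[OF s] in \<open>auto elim!: eventually_mono intro: GC\<close>)
    have intN: "integrable M (\<lambda>\<omega>. indicator {real k} (real (N s \<omega>)) :: real)" for k
      by (rule integrable_const_bound[where B=1]) (auto simp: indicator_def)
    have prod: "expectation (\<lambda>\<omega>. indicator {real k} (real (N s \<omega>)) * G k (H s \<omega>) * f (L t \<omega>))
       = poisson_weight lam k s * expectation (\<lambda>\<omega>. G k (H s \<omega>)) * expectation (\<lambda>\<omega>. f (L t \<omega>))" for k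
      using indep_processes_expectation[OF ind s t, of "indicator {real k}" "G k" f] intf intG intN
        poisson_process_weight[OF N lam s] by simp
    have intp: "integrable M (\<lambda>\<omega>. indicator {real k} (real (N s \<omega>)) * G k (H s \<omega>) * f (L t \<omega>))" for k
    proof (rule integrable_const_bound[where B=C])
      show "AE \<omega> in M. norm (indicator {real k} (real (N s \<omega>)) * G k (H s \<omega>) * f (L t \<omega>)) \<le> C"
        using H0[OF s]
      proof eventually_elim
        fix \<omega> assume "0 \<le> H s \<omega>"
        then have "\<bar>G k (H s \<omega>)\<bar> * \<bar>f (L t \<omega>)\<bar> \<le> C * 1"
          using GC fb by (intro mult_mono) (auto intro: order_trans[OF abs_ge_zero])
        moreover have "0 \<le> C" using GC[of 0 0] by auto
        ultimately show "norm (indicator {real k} (real (N s \<omega>)) * G k (H s \<omega>) * f (L t \<omega>)) \<le> C"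
          by (auto simp: indicator_def abs_mult)
      qed
    qed measurable
    have "expectation (\<lambda>\<omega>. f (L t \<omega>) * G (N s \<omega>) (H s \<omega>))
      = expectation (\<lambda>\<omega>. \<Sum>k<m. indicator {real k} (real (N s \<omega>)) * G k (H s \<omega>) * f (L t \<omega>))"
    proof (rule Bochner_Integration.integral_cong[OF refl])
      fix \<omega> assume \<omega>: "\<omega> \<in> space M"
      have "(\<Sum>k<m. indicator {real k} (real (N s \<omega>)) * G k (H s \<omega>) * f (L t \<omega>))
        = (\<Sum>k<m. if k = N s \<omega> then G k (H s \<omega>) * f (L t \<omega>) else 0)"
        by (intro sum.cong) (auto simp: indicator_def)
      also have "\<dots> = f (L t \<omega>) * G (N s \<omega>) (H s \<omega>)"
        using vanm[of "N s \<omega>" "H s \<omega>"] HD(6)[OF \<omega> s] by (auto simp: not_less)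
      finally show "f (L t \<omega>) * G (N s \<omega>) (H s \<omega>) = (\<Sum>k<m. indicator {real k} (real (N s \<omega>)) * G k (H s \<omega>) * f (L t \<omega>))" ..
    qed
    also have "\<dots> = (\<Sum>k<m. poisson_weight lam k s * expectation (\<lambda>\<omega>. G k (H s \<omega>)) * expectation (\<lambda>\<omega>. f (L t \<omega>)))"
      using intp by (simp add: prod)
    also have "\<dots> = (\<Sum>k<m. poisson_weight lam k s * expectation (\<lambda>\<omega>. G k (s powr (1 / \<alpha>) * H 1 \<omega>)) * expectation (\<lambda>\<omega>. f (L t \<omega>)))"
    proof -
      have "expectation (\<lambda>\<omega>. G k (H s \<omega>)) = expectation (\<lambda>\<omega>. G k (s powr (1 / \<alpha>) * H 1 \<omega>))" for k
      proof (rule stable_scaling[OF Hm[OF s] H1 H0[OF s] H0 HD(5)[OF s] _ \<alpha> s cont van])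
        show "expectation (\<lambda>\<omega>. exp (- \<xi> * H 1 \<omega>)) = exp (- (\<xi> powr \<alpha>))" if "\<xi> \<ge> 0" for \<xi>
          using HD(5)[of 1 \<xi>] that by simp
      qed auto
      then show ?thesis by simp
    qed
    finally show ?thesis by (simp add: U_def poisson_stable_mean_def sum_distrib_left mult_ac)
  qed
  have NHm: "(\<lambda>\<omega>. G (N s \<omega>) (H s \<omega>)) \<in> borel_measurable M" if s: "s \<ge> 0" for s
  proof (rule measurable_compose_countable[OF _ ND(1)[OF s]])
    show "(\<lambda>\<omega>. G k (H s \<omega>)) \<in> borel_measurable M" for k
      by (rule measurable_compose[OF Hm[OF s]]) simp
  qed
  define grid where "grid n \<omega> = real (Suc (upper_grid n (L t \<omega>))) / real (Suc n)" for n \<omega>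
  have step: "expectation (\<lambda>\<omega>. G (N (grid n \<omega>) \<omega>) (H (grid n \<omega>) \<omega>)) = expectation (\<lambda>\<omega>. U (grid n \<omega>))" for n
    unfolding grid_def
  proof (rule expectation_discrete_mixture[where J="\<lambda>\<omega>. upper_grid n (L t \<omega>)" and C=C
        and \<Phi>="\<lambda>j \<omega>. G (N (real (Suc j) / real (Suc n)) \<omega>) (H (real (Suc j) / real (Suc n)) \<omega>)"
        and U="\<lambda>j. U (real (Suc j) / real (Suc n))"])
    fix j
    let ?s = "real (Suc j) / real (Suc n)"
    have s: "?s \<ge> 0" by simp
    show "(\<lambda>\<omega>. G (N ?s \<omega>) (H ?s \<omega>)) \<in> borel_measurable M"
      by (rule NHm[OF s])
    show "AE \<omega> in M. \<bar>G (N ?s \<omega>) (H ?s \<omega>)\<bar> \<le> C"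
      using H0[OF s] by eventually_elim (rule GC)
    show "\<bar>U ?s\<bar> \<le> C" by (rule UC[OF s])
    show "expectation (\<lambda>\<omega>. indicator {j} (upper_grid n (L t \<omega>)) * G (N ?s \<omega>) (H ?s \<omega>))
      = expectation (\<lambda>\<omega>. indicator {j} (upper_grid n (L t \<omega>))) * U ?s"
      by (rule fixed[OF s, of "\<lambda>x. indicator {j} (upper_grid n x)"]) (auto simp: indicator_def)
  qed measurable
  have grid0: "grid n \<omega> \<ge> 0" and grid_gt: "grid n \<omega> > L t \<omega>" and grid_lim: "(\<lambda>n. grid n \<omega>) \<longlonglongrightarrow> L t \<omega>" for n \<omega>
    using upper_grid_approx[OF L0] upper_grid_tendsto[OF L0] by (auto simp: grid_def)
  have contU: "continuous_on {0..} U"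
    unfolding U_def by (rule continuous_poisson_stable_mean[OF H1 H0 \<alpha> cont van]) auto
  have contUm: "continuous_on UNIV (\<lambda>x. U (max 0 x))"
    by (intro continuous_on_compose2[OF contU] continuous_intros) auto
  have [measurable]: "(\<lambda>x. U (max 0 x)) \<in> borel_measurable borel"
    using contUm by (simp add: borel_measurable_continuous_onI)
  have [measurable]: "grid n \<in> borel_measurable M" for n unfolding grid_def by measurable
  have U_eq: "U (grid n \<omega>) = U (max 0 (grid n \<omega>))" "U (L t \<omega>) = U (max 0 (L t \<omega>))" for n \<omega>
    using grid0 L0 by simp_all
  have limU: "(\<lambda>n. expectation (\<lambda>\<omega>. U (grid n \<omega>))) \<longlonglongrightarrow> expectation (\<lambda>\<omega>. U (L t \<omega>))"
  proof (rule integral_dominated_convergence[where w="\<lambda>_. C"])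
    show "AE \<omega> in M. (\<lambda>n. U (grid n \<omega>)) \<longlonglongrightarrow> U (L t \<omega>)"
      by (intro AE_I2 continuous_on_tendsto_compose[OF contU grid_lim]) (auto simp: grid0 L0)
    show "AE \<omega> in M. norm (U (grid n \<omega>)) \<le> C" for n using UC grid0 by simp
    show "(\<lambda>\<omega>. U (grid n \<omega>)) \<in> borel_measurable M" for n unfolding U_eq by measurable
    show "(\<lambda>\<omega>. U (L t \<omega>)) \<in> borel_measurable M" unfolding U_eq by measurable
  qed simp
  have lim: "(\<lambda>n. G (N (grid n \<omega>) \<omega>) (H (grid n \<omega>) \<omega>)) \<longlonglongrightarrow> G (N (L t \<omega>) \<omega>) (H (L t \<omega>) \<omega>)" if "\<omega> \<in> space M" for \<omega>
  proof -
    have "(\<lambda>n. N (grid n \<omega>) \<omega>) \<longlonglongrightarrow> N (L t \<omega>) \<omega>"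
      by (rule tendsto_at_right_seq[OF ND(3)[OF that L0] grid_lim grid_gt])
    then have ev: "\<forall>\<^sub>F n in sequentially. N (grid n \<omega>) \<omega> = N (L t \<omega>) \<omega>"
      by (simp add: tendsto_discrete)
    have "(\<lambda>n. H (grid n \<omega>) \<omega>) \<longlonglongrightarrow> H (L t \<omega>) \<omega>"
      by (rule tendsto_at_right_seq[OF HD(4)[OF that L0] grid_lim grid_gt])
    then have "(\<lambda>n. G (N (L t \<omega>) \<omega>) (H (grid n \<omega>) \<omega>)) \<longlonglongrightarrow> G (N (L t \<omega>) \<omega>) (H (L t \<omega>) \<omega>)"
      by (intro continuous_on_tendsto_compose[OF cont]) auto
    then show ?thesis
      by (rule Lim_transform_eventually) (use ev in \<open>auto elim!: eventually_mono\<close>)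
  qed
  have gm: "(\<lambda>\<omega>. G (N (grid n \<omega>) \<omega>) (H (grid n \<omega>) \<omega>)) \<in> borel_measurable M" for n
    unfolding grid_def
  proof (rule measurable_compose_countable[where g="\<lambda>\<omega>. upper_grid n (L t \<omega>)"
        and f="\<lambda>j \<omega>. G (N (real (Suc j) / real (Suc n)) \<omega>) (H (real (Suc j) / real (Suc n)) \<omega>)"])
    fix j
    let ?s = "real (Suc j) / real (Suc n)"
    have s: "?s \<ge> 0" by simp
    show "(\<lambda>\<omega>. G (N ?s \<omega>) (H ?s \<omega>)) \<in> borel_measurable M"
      by (rule NHm[OF s])
  qed measurable
  have "(\<lambda>n. expectation (\<lambda>\<omega>. G (N (grid n \<omega>) \<omega>) (H (grid n \<omega>) \<omega>))) \<longlonglongrightarrow> expectation (\<lambda>\<omega>. G (N (L t \<omega>) \<omega>) (H (L t \<omega>) \<omega>))"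
  proof (rule integral_dominated_convergence[where w="\<lambda>_. C"])
    show "AE \<omega> in M. (\<lambda>n. G (N (grid n \<omega>) \<omega>) (H (grid n \<omega>) \<omega>)) \<longlonglongrightarrow> G (N (L t \<omega>) \<omega>) (H (L t \<omega>) \<omega>)"
      using lim by auto
    show "AE \<omega> in M. norm (G (N (grid n \<omega>) \<omega>) (H (grid n \<omega>) \<omega>)) \<le> C" for n
      using HD(6)[OF _ grid0] GC by auto
    show "(\<lambda>\<omega>. G (N (L t \<omega>) \<omega>) (H (L t \<omega>) \<omega>)) \<in> borel_measurable M"
      by (rule borel_measurable_LIMSEQ_real[OF lim gm])
  qed (use gm in auto)
  then show ?thesis
    using limU unfolding step by (simp add: LIMSEQ_unique U_def)
qed

end

section \<open>Test functions and the equation\<close>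

lemma test_function_differentiable:
  assumes "test_function \<phi>"
  shows "\<phi> differentiable (at x)" and "continuous_on UNIV (partial k \<phi>)"
proof -
  have "k_smooth (Suc 0) \<phi>" using assms unfolding test_function_def by blast
  then show "\<phi> differentiable (at x)" and "continuous_on UNIV (partial k \<phi>)"
    by (auto simp: differentiable_on_def)
qed

lemma test_function_support:
  assumes "test_function \<phi>"
  obtains R where "R > 0" "\<And>x. norm x \<ge> R \<Longrightarrow> \<phi> x = 0"
proof -
  have "bounded {x. \<phi> x \<noteq> 0}"
    using assms bounded_subset[OF compact_imp_bounded closure_subset] unfolding test_function_def by blast
  then obtain B where B: "B > 0" "\<And>x. \<phi> x \<noteq> 0 \<Longrightarrow> norm x \<le> B" by (auto simp: bounded_pos)
  show ?thesis
  proof (rule that[of "B + 1"])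
    show "\<phi> x = 0" if "norm x \<ge> B + 1" for x using B(2)[of x] that by force
  qed (use B in simp)
qed

lemma sum_partial_eq_frechet:
  fixes \<phi> :: "real ^ 'n \<Rightarrow> real"
  assumes "\<phi> differentiable (at x)"
  shows "(\<Sum>k\<in>UNIV. a $ k * partial k \<phi> x) = frechet_derivative \<phi> (at x) a"
proof -
  have lin: "linear (frechet_derivative \<phi> (at x))" by (rule linear_frechet_derivative[OF assms])
  have "frechet_derivative \<phi> (at x) a = frechet_derivative \<phi> (at x) (\<Sum>k\<in>UNIV. a $ k *\<^sub>R axis k 1)"
    using basis_expansion[of a] by (simp add: scalar_mult_eq_scaleR)
  also have "\<dots> = (\<Sum>k\<in>UNIV. a $ k * partial k \<phi> x)"
    by (simp add: linear_sum[OF lin] linear_scale[OF lin] partial_def)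
  finally show ?thesis ..
qed

lemma sum_partial_line_derivative:
  fixes \<phi> :: "real ^ 'n \<Rightarrow> real"
  assumes "test_function \<phi>"
  shows "((\<lambda>r. \<phi> (b + r *\<^sub>R a)) has_real_derivative (\<Sum>k\<in>UNIV. a $ k * partial k \<phi> (b + r *\<^sub>R a))) (at r)"
proof -
  let ?D = "frechet_derivative \<phi> (at (b + r *\<^sub>R a))"
  have d: "\<phi> differentiable (at (b + r *\<^sub>R a))" by (rule test_function_differentiable[OF assms])
  have "((\<lambda>r. b + r *\<^sub>R a) has_derivative (\<lambda>h. h *\<^sub>R a)) (at r)"
    by (auto intro!: derivative_eq_intros)
  from diff_chain_at[OF this frechet_derivative_works[THEN iffD1, OF d]]
  have "((\<lambda>r. \<phi> (b + r *\<^sub>R a)) has_derivative (\<lambda>h. ?D (h *\<^sub>R a))) (at r)" by (simp add: comp_def)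
  moreover have "(\<lambda>h. ?D (h *\<^sub>R a)) = (*) (\<Sum>k\<in>UNIV. a $ k * partial k \<phi> (b + r *\<^sub>R a))"
    using linear_scale[OF linear_frechet_derivative[OF d]] sum_partial_eq_frechet[OF d, of a]
    by (auto simp: mult.commute)
  ultimately show ?thesis by (simp add: has_field_derivative_def)
qed

lemma sum_partial_vanishes:
  fixes \<phi> :: "real ^ 'n \<Rightarrow> real"
  assumes "\<And>x. norm x \<ge> R \<Longrightarrow> \<phi> x = 0" "norm x > R"
  shows "partial k \<phi> x = 0"
proof -
  have "(\<phi> has_derivative (\<lambda>_. 0)) (at x)"
  proof (rule has_derivative_transform_within_open[of "\<lambda>_. 0" "\<lambda>_. 0" x UNIV "{y. R < norm y}"])
    show "open {y::real ^ 'n. R < norm y}" by (intro open_Collect_less continuous_intros)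
  qed (use assms in auto)
  then have "frechet_derivative \<phi> (at x) = (\<lambda>_. 0)" by (rule frechet_derivative_at[symmetric])
  then show ?thesis by (simp add: partial_def)
qed

lemma continuous_vanishing_bounded:
  fixes F :: "real ^ 'n \<Rightarrow> real"
  assumes "continuous_on UNIV F" "\<And>x. norm x \<ge> R \<Longrightarrow> F x = 0"
  obtains C where "C \<ge> 0" "\<And>x. \<bar>F x\<bar> \<le> C"
proof -
  have "compact (F ` cball 0 R)"
    by (intro compact_continuous_image continuous_on_subset[OF assms(1)]) auto
  then obtain C where C: "\<And>x. x \<in> cball 0 R \<Longrightarrow> \<bar>F x\<bar> \<le> C"
    by (force dest!: compact_imp_bounded simp: bounded_iff)
  have "\<bar>F x\<bar> \<le> max 0 C" for x
    using C[of x] assms(2)[of x] by (cases "norm x \<le> R") auto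
  then show ?thesis using that[of "max 0 C"] by auto
qed

text \<open>Pair with \<open>a\<close> and apply the Cauchy-Schwarz inequality. A compactly supported function therefore
  vanishes on \<open>x + s a\<close> for large \<open>s\<close>, uniformly in the orthant.\<close>

lemma norm_orthant_ge:
  fixes a :: "real ^ 'n"
  assumes a: "\<And>k. 0 \<le> a $ k" "norm a = 1" and x: "\<And>k. 0 \<le> x $ k" and s: "s \<ge> 0"
  shows "norm (x + s *\<^sub>R a) \<ge> s"
proof -
  have "x \<bullet> a \<ge> 0" unfolding inner_vec_def using a x by (auto intro!: sum_nonneg)
  then have "s \<le> (x + s *\<^sub>R a) \<bullet> a"
    using a by (simp add: inner_add_left dot_square_norm)
  also have "\<dots> \<le> norm (x + s *\<^sub>R a) * norm a" by (rule norm_cauchy_schwarz)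
  finally show ?thesis using a by simp
qed

context prob_space
begin

lemma dist_of_distr:
  fixes Y :: "'a \<Rightarrow> real ^ 'n"
  assumes "Y \<in> borel_measurable M" "F \<in> borel_measurable borel"
  shows "dist_of (distr M borel Y) F = expectation (\<lambda>\<omega>. F (Y \<omega>))"
  unfolding dist_of_def using assms by (rule integral_distr)

text \<open>The hypothesis \<open>far\<close> confines the \<open>s\<close>-integral to \<open>{0<..R}\<close>, where the kernel is integrable.\<close>

lemma frac_kernel_fubini:
  fixes Y :: "'a \<Rightarrow> real ^ 'n" and F :: "real ^ 'n \<Rightarrow> real"
  assumes [measurable]: "Y \<in> borel_measurable M" and \<alpha>: "\<alpha> < 1"
    and cont: "continuous_on UNIV F" and van: "\<And>x. norm x \<ge> R \<Longrightarrow> F x = 0"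
    and far: "\<And>\<omega> s. \<omega> \<in> space M \<Longrightarrow> s \<ge> 0 \<Longrightarrow> norm (Y \<omega> + s *\<^sub>R a) \<ge> s"
  shows "set_integrable lborel {0<..} (\<lambda>s. s powr (- \<alpha>) * expectation (\<lambda>\<omega>. F (Y \<omega> + s *\<^sub>R a)))"
    and "(LBINT s:{0<..}. s powr (- \<alpha>) * expectation (\<lambda>\<omega>. F (Y \<omega> + s *\<^sub>R a)))
      = expectation (\<lambda>\<omega>. LBINT s:{0<..}. s powr (- \<alpha>) * F (Y \<omega> + s *\<^sub>R a))"
    and "integrable M (\<lambda>\<omega>. LBINT s:{0<..}. s powr (- \<alpha>) * F (Y \<omega> + s *\<^sub>R a))"
proof -
  interpret P: pair_sigma_finite lborel M ..
  have [measurable]: "F \<in> borel_measurable borel"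
    using cont by (simp add: borel_measurable_continuous_onI)
  obtain C where C: "C \<ge> 0" "\<And>x. \<bar>F x\<bar> \<le> C" using continuous_vanishing_bounded[OF cont van] by metis
  define f where "f s \<omega> = indicator {0<..} s * (s powr (- \<alpha>) * F (Y \<omega> + s *\<^sub>R a))" for s \<omega>
  have fb: "\<bar>f s \<omega>\<bar> \<le> C * (indicator {0<..R} s * s powr (- \<alpha>))" if "\<omega> \<in> space M" for s \<omega>
    using C(2)[of "Y \<omega> + s *\<^sub>R a"] van[of "Y \<omega> + s *\<^sub>R a"] far[OF that, of s]
    by (cases "s \<le> R") (auto simp: f_def indicator_def abs_mult mult.commute[of C] intro!: mult_left_mono)
  have fm [measurable]: "case_prod f \<in> borel_measurable (lborel \<Otimes>\<^sub>M M)"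
    unfolding f_def by measurable
  have fm' [measurable]: "f s \<in> borel_measurable M" for s unfolding f_def by measurable
  have intf: "integrable M (f s)" for s
    by (rule integrable_const_bound[where B="C * (indicator {0<..R} s * s powr (- \<alpha>))"]) (use fb in auto)
  have int: "integrable (lborel \<Otimes>\<^sub>M M) (case_prod f)"
  proof (rule P.Fubini_integrable)
    show "integrable lborel (\<lambda>s. \<integral>\<omega>. norm (case (s, \<omega>) of (x, xa) \<Rightarrow> f x xa) \<partial>M)"
    proof (rule Bochner_Integration.integrable_bound[OF integrable_mult_right[OF integrable_powr_cutoff[OF \<alpha>, of R], of C]])
      have "expectation (\<lambda>\<omega>. \<bar>f s \<omega>\<bar>) \<le> C * (indicator {0<..R} s * s powr (- \<alpha>))" for s
      proof -
        have "expectation (\<lambda>\<omega>. \<bar>f s \<omega>\<bar>) \<le> expectation (\<lambda>\<omega>. C * (indicator {0<..R} s * s powr (- \<alpha>)))"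
          using fb intf by (intro integral_mono) auto
        then show ?thesis by (simp add: prob_space)
      qed
      then show "AE s in lborel. norm (\<integral>\<omega>. norm (case (s, \<omega>) of (x, xa) \<Rightarrow> f x xa) \<partial>M)
        \<le> norm (C * (indicator {0<..R} s * s powr (- \<alpha>)))"
        using C(1) by (auto intro!: AE_I2 simp: abs_of_nonneg)
    qed measurable
  qed (use intf in auto)
  have e1: "expectation (f s) = indicator {0<..} s *\<^sub>R (s powr (- \<alpha>) * expectation (\<lambda>\<omega>. F (Y \<omega> + s *\<^sub>R a)))" for s
    unfolding f_def by simp
  have e2: "(\<integral>s. f s \<omega> \<partial>lborel) = (LBINT s:{0<..}. s powr (- \<alpha>) * F (Y \<omega> + s *\<^sub>R a))" for \<omega>
    unfolding f_def set_lebesgue_integral_def by simp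
  show "set_integrable lborel {0<..} (\<lambda>s. s powr (- \<alpha>) * expectation (\<lambda>\<omega>. F (Y \<omega> + s *\<^sub>R a)))"
    unfolding set_integrable_def e1[symmetric] using P.integrable_fst[OF int] .
  show "(LBINT s:{0<..}. s powr (- \<alpha>) * expectation (\<lambda>\<omega>. F (Y \<omega> + s *\<^sub>R a)))
      = expectation (\<lambda>\<omega>. LBINT s:{0<..}. s powr (- \<alpha>) * F (Y \<omega> + s *\<^sub>R a))"
  proof -
    have "(LBINT s:{0<..}. s powr (- \<alpha>) * expectation (\<lambda>\<omega>. F (Y \<omega> + s *\<^sub>R a))) = (\<integral>s. expectation (f s) \<partial>lborel)"
      by (simp only: set_lebesgue_integral_def e1)
    also have "\<dots> = expectation (\<lambda>\<omega>. \<integral>s. f s \<omega> \<partial>lborel)"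
      by (rule P.Fubini_integral[OF int, symmetric])
    finally show ?thesis by (simp only: e2)
  qed
  show "integrable M (\<lambda>\<omega>. LBINT s:{0<..}. s powr (- \<alpha>) * F (Y \<omega> + s *\<^sub>R a))"
    using P.integrable_snd[OF int] by (simp only: e2)
qed

end

theorem theorem5:
  fixes M :: "'w measure"
    and N :: "real \<Rightarrow> 'w \<Rightarrow> nat"
    and H K L :: "real \<Rightarrow> 'w \<Rightarrow> real"
    and a :: "real ^ 'n"
    and \<alpha> \<beta> lam :: real
  assumes "0 < \<alpha>" "\<alpha> \<le> 1" and "0 < \<beta>" "\<beta> \<le> 1" and "0 < lam"
    and "\<forall>k. 0 \<le> a $ k" and "norm a = 1"
    and "prob_space M"
    and "prob_space.poisson_process M lam N"
    and "prob_space.stable_subordinator M \<alpha> H"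
    and "prob_space.stable_subordinator M \<beta> K"
    and "L = inverse_subordinator K"
    and "prob_space.indep_processes M [\<lambda>t \<omega>. real (N t \<omega>), H, L]"
  shows "prob_space.stochastic_solution M \<alpha> \<beta> lam a
           (\<lambda>t \<omega>. real (N (L t \<omega>) \<omega>) *\<^sub>R 1 + H (L t \<omega>) \<omega> *\<^sub>R a)"
proof -
  interpret prob_space M by fact
  note \<alpha> = assms(1,2) and \<beta> = assms(3,4) and lam = assms(5)
  have a: "\<And>k. 0 \<le> a $ k" "norm a = 1" using assms(6,7) by auto
  note N = assms(9) and H = assms(10) and K = assms(11) and L = assms(12) and ind = assms(13)
  note ND = poisson_processD[OF N] and HD = stable_subordinatorD[OF H] and KD = stable_subordinatorD[OF K]
  have L0: "L t \<omega> \<ge> 0" for t \<omega> unfolding L by (rule inverse_subordinator_nonneg)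
  have Lm: "L t \<in> borel_measurable M" if "t \<ge> 0" for t by (rule indep_processes_measurable[OF ind that])
  have K1: "K 1 \<in> borel_measurable M" and H1: "H 1 \<in> borel_measurable M" using KD(1) HD(1) by simp_all
  have K1_nn: "AE \<omega> in M. 0 \<le> K 1 \<omega>" and H1_nn: "AE \<omega> in M. 0 \<le> H 1 \<omega>" using KD(6) HD(6) by auto
  have lapK: "expectation (\<lambda>\<omega>. exp (- \<xi> * K 1 \<omega>)) = exp (- (\<xi> powr \<beta>))"
    and lapH: "expectation (\<lambda>\<omega>. exp (- \<xi> * H 1 \<omega>)) = exp (- (\<xi> powr \<alpha>))" if "\<xi> \<ge> 0" for \<xi>
    using KD(5)[of 1 \<xi>] HD(5)[of 1 \<xi>] that by simp_all
  have K1_pos: "AE \<omega> in M. 0 < K 1 \<omega>"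
    using stable_pos[OF K1 K1_nn _ \<beta>(1) zero_less_one] KD(5)[of 1] by simp
  define NL where "NL t \<omega> = N (L t \<omega>) \<omega>" for t \<omega>
  define HL where "HL t \<omega> = H (L t \<omega>) \<omega>" for t \<omega>
  define Y :: "real \<Rightarrow> 'w \<Rightarrow> real ^ 'n" where "Y t \<omega> = real (NL t \<omega>) *\<^sub>R 1 + HL t \<omega> *\<^sub>R a" for t \<omega>
  have HL0: "HL t \<omega> \<ge> 0" if "\<omega> \<in> space M" for t \<omega> unfolding HL_def using HD(6)[OF that L0] .
  have HLm: "HL t \<in> borel_measurable M" if t: "t \<ge> 0" for t
    unfolding HL_def[abs_def] by (rule random_time_measurable[OF HD(1) Lm[OF t] L0 HD(4)])
  have NLm: "(\<lambda>\<omega>. real (NL t \<omega>)) \<in> borel_measurable M" if t: "t \<ge> 0" for t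
    unfolding NL_def
  proof (rule random_time_measurable[OF _ Lm[OF t] L0])
    show "(\<lambda>\<omega>. real (N s \<omega>)) \<in> borel_measurable M" if "s \<ge> 0" for s
      by (rule measurable_compose[OF ND(1)[OF that]]) simp
    show "continuous (at_right s) (\<lambda>s. real (N s \<omega>))" if "\<omega> \<in> space M" "s \<ge> 0" for \<omega> s
      using ND(3)[OF that] unfolding continuous_within by (rule tendsto_compose[rotated]) (simp add: at_discrete)
  qed
  have Ym: "Y t \<in> borel_measurable M" if t: "t \<ge> 0" for t
    unfolding Y_def[abs_def] using NLm[OF t] HLm[OF t] by measurable
  have Y_nn: "0 \<le> Y t \<omega> $ k" if "\<omega> \<in> space M" for t \<omega> k
    using HL0[OF that] a(1) by (simp add: Y_def)
  have Y0: "Y 0 \<omega> = 0" if "\<omega> \<in> space M" for \<omega>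
    using ND(2)[OF that] HD(2)[OF that] by (simp add: Y_def NL_def HL_def L inverse_subordinator_0)
  have far: "norm (Y t \<omega> + s *\<^sub>R a) \<ge> s" if "\<omega> \<in> space M" "s \<ge> 0" for t \<omega> s
    using norm_orthant_ge[OF a Y_nn[OF that(1)] that(2)] .
  have law: "expectation (\<lambda>\<omega>. U (L t \<omega>)) = expectation (\<lambda>\<omega>. U (t powr \<beta> * K 1 \<omega> powr (- \<beta>)))"
    if t: "t \<ge> 0" and cU: "continuous_on {0..} U" for t and U :: "real \<Rightarrow> real"
  proof (cases "t = 0")
    case True
    then show ?thesis by (simp add: L inverse_subordinator_0)
  next
    case False
    have "continuous_on UNIV (\<lambda>x. U (max 0 x))"
      by (intro continuous_on_compose2[OF cU] continuous_intros) auto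
    then have Um [measurable]: "(\<lambda>x. U (max 0 x)) \<in> borel_measurable borel"
      by (simp add: borel_measurable_continuous_onI)
    have d: "distr M borel (L t) = distr M borel (\<lambda>\<omega>. t powr \<beta> * K 1 \<omega> powr (- \<beta>))"
      using inverse_stable_subordinator_law[OF K \<beta>(1), of t] Lm[OF t] t False unfolding L by simp
    have "expectation (\<lambda>\<omega>. U (max 0 (L t \<omega>))) = (\<integral>x. U (max 0 x) \<partial>distr M borel (L t))"
      by (rule integral_distr[OF Lm[OF t] Um, symmetric])
    also have "\<dots> = expectation (\<lambda>\<omega>. U (max 0 (t powr \<beta> * K 1 \<omega> powr (- \<beta>))))"
      unfolding d using K1 by (intro integral_distr Um) measurable
    finally show ?thesis by (simp add: L0)
  qed
  have equation: "continuous_on {0..} (\<lambda>t. dist_of (distr M borel (Y t)) \<phi>) \<and>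
      (\<forall>t>0. caputo_deriv_exists \<beta> (\<lambda>t. dist_of (distr M borel (Y t)) \<phi>) t \<and>
           caputo_deriv \<beta> (\<lambda>t. dist_of (distr M borel (Y t)) \<phi>) t =
             - (frac_dir_deriv \<alpha> a (dist_of (distr M borel (Y t))) \<phi>
                + lam * (dist_of (distr M borel (Y t)) \<phi> - shift_op 1 (dist_of (distr M borel (Y t))) \<phi>)))"
    if \<phi>: "test_function \<phi>" for \<phi>
  proof -
    obtain R where R: "R > 0" "\<And>x. norm x \<ge> R \<Longrightarrow> \<phi> x = 0" using test_function_support[OF \<phi>] by metis
    define \<psi> where "\<psi> x = (\<Sum>k\<in>UNIV. a $ k * partial k \<phi> x)" for x
    have \<psi>_eq: "(\<Sum>k\<in>UNIV. a $ k * partial k \<phi> x) = \<psi> x" for x by (simp add: \<psi>_def)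
    have cont\<phi>: "continuous_on UNIV \<phi>"
      using \<phi> unfolding test_function_def by (metis k_smooth.simps(1))
    have cont\<psi>: "continuous_on UNIV \<psi>"
      unfolding \<psi>_def by (intro continuous_intros test_function_differentiable(2)[OF \<phi>])
    have van\<psi>: "\<psi> x = 0" if "norm x \<ge> R + 1" for x
      unfolding \<psi>_def using sum_partial_vanishes[where x=x, OF R(2)] that by simp
    have [measurable]: "\<phi> \<in> borel_measurable borel" "\<psi> \<in> borel_measurable borel"
      using cont\<phi> cont\<psi> by (simp_all add: borel_measurable_continuous_onI)
    define m where "m = nat \<lceil>R + 1\<rceil>"
    \<comment> \<open>Restriction of \<open>\<phi>\<close> and of its derivative along \<open>a\<close> to the half lines that carry \<open>Y\<^sub>t\<close>. On
      \<open>r \<ge> 0\<close> both vanish for \<open>k \<ge> m\<close> and for \<open>r \<ge> R + 1\<close>.\<close>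
    define G where "G k r = \<phi> (real k *\<^sub>R 1 + r *\<^sub>R a)" for k r
    define G' where "G' k r = \<psi> (real k *\<^sub>R 1 + r *\<^sub>R a)" for k r
    define A where "A = poisson_stable_generator \<alpha> lam G G'"
    define U where "U = poisson_stable_mean \<alpha> lam (H 1) m G"
    define V where "V = poisson_stable_mean \<alpha> lam (H 1) m A"
    have contG: "continuous_on UNIV (G k)" and contG': "continuous_on UNIV (G' k)" for k
      unfolding G_def G'_def
      by (intro continuous_on_compose2[OF cont\<phi>] continuous_on_compose2[OF cont\<psi>] continuous_intros; simp)+
    have norm1: "norm (real k *\<^sub>R 1 + x *\<^sub>R a) \<ge> x" if "x \<ge> 0" for k x
      using norm_orthant_ge[OF a, of "real k *\<^sub>R 1"] that by simp
    have norm2: "norm (real k *\<^sub>R 1 + x *\<^sub>R a) \<ge> real k" if "x \<ge> 0" for k x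
    proof -
      fix i :: 'n
      have "real k \<le> (real k *\<^sub>R 1 + x *\<^sub>R a) $ i" using a that by simp
      also have "\<dots> \<le> norm (real k *\<^sub>R 1 + x *\<^sub>R a)"
        using component_le_norm_cart[of "real k *\<^sub>R 1 + x *\<^sub>R a" i] by linarith
      finally show ?thesis .
    qed
    have km: "real k \<ge> R + 1" if "k \<ge> m" for k
      using that unfolding m_def by linarith
    have vanG: "G k x = 0" and vanG': "G' k x = 0" if "x \<ge> R + 1" for k x
      using norm1[of x k] R that by (auto simp: G_def G'_def intro!: R(2) van\<psi>)
    have contA: "continuous_on UNIV (A k)" for k
      unfolding A_def poisson_stable_generator_def
      by (intro continuous_intros contG, rule continuous_weyl_integral[OF \<alpha>(2) contG' vanG'])
    have vanmG: "G k x = 0" and vanmG': "G' k x = 0" if "k \<ge> m" "x \<ge> 0" for k x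
      using norm2[of x k] km[of k] that by (auto simp: G_def G'_def intro!: R(2) van\<psi>)
    have vanA: "A k x = 0" if "x \<ge> R + 1" for k x
      using that weyl_integral_vanishes[OF vanG' that] by (simp add: A_def poisson_stable_generator_def vanG)
    have vanmA: "A k x = 0" if "k \<ge> m" "x \<ge> 0" for k x
    proof -
      have "weyl_integral \<alpha> (G' k) x = 0"
      proof (rule weyl_integral_vanishes[of 0])
        show "G' k y = 0" if "y \<ge> 0" for y using vanmG'[OF \<open>k \<ge> m\<close> that] .
      qed fact
      then show ?thesis using that by (simp add: A_def poisson_stable_generator_def vanmG)
    qed
    have contU: "continuous_on {0..} U"
      unfolding U_def by (rule continuous_poisson_stable_mean[OF H1 H1_nn \<alpha>(1) contG vanG])
    have contV: "continuous_on {0..} V"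
      unfolding V_def by (rule continuous_poisson_stable_mean[OF H1 H1_nn \<alpha>(1) contA vanA])
    obtain CU where CU: "\<And>s. s \<ge> 0 \<Longrightarrow> \<bar>U s\<bar> \<le> CU"
      unfolding U_def by (rule poisson_stable_mean_bounded[where \<alpha>=\<alpha> and m=m and G=G and R="R + 1", OF H1 H1_nn lam contG])
        (auto simp: vanG)
    obtain CV where CV: "\<And>s. s \<ge> 0 \<Longrightarrow> \<bar>V s\<bar> \<le> CV"
      unfolding V_def by (rule poisson_stable_mean_bounded[where \<alpha>=\<alpha> and m=m and G=A and R="R + 1", OF H1 H1_nn lam contA])
        (auto simp: vanA)
    have derG: "(G k has_real_derivative G' k x) (at x)" for k x
      unfolding G_def[abs_def] G'_def \<psi>_def by (rule sum_partial_line_derivative[OF \<phi>])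
    have derU: "(U has_real_derivative V s) (at s)" if "s > 0" for s
      unfolding U_def V_def A_def
      by (rule poisson_stable_mean_derivative[OF H1 H1_nn lapH \<alpha> that contG' vanG' derG vanG vanmG]) simp_all
    have Y_G: "G (NL t \<omega>) (HL t \<omega>) = \<phi> (Y t \<omega>)" for t \<omega> by (simp add: G_def Y_def)
    have f_eq: "dist_of (distr M borel (Y t)) \<phi> = expectation (\<lambda>\<omega>. U (t powr \<beta> * K 1 \<omega> powr (- \<beta>)))" if t: "t \<ge> 0" for t
    proof -
      have "dist_of (distr M borel (Y t)) \<phi> = expectation (\<lambda>\<omega>. G (NL t \<omega>) (HL t \<omega>))"
        unfolding Y_G by (rule dist_of_distr[OF Ym[OF t]]) simp
      also have "\<dots> = expectation (\<lambda>\<omega>. U (L t \<omega>))"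
        unfolding NL_def HL_def U_def
        by (rule expectation_random_time[OF N lam H \<alpha>(1) ind t L0 contG vanG vanmG])
      also have "\<dots> = expectation (\<lambda>\<omega>. U (t powr \<beta> * K 1 \<omega> powr (- \<beta>)))"
        by (rule law[OF t contU])
      finally show ?thesis .
    qed
    have cont_f: "continuous_on {0..} (\<lambda>t. dist_of (distr M borel (Y t)) \<phi>)"
    proof -
      have "continuous_on {0..} (\<lambda>t. expectation (\<lambda>\<omega>. U (max 0 (t powr \<beta> * K 1 \<omega> powr (- \<beta>)))))"
      proof (rule expectation_scaled_continuous[OF _ _ \<beta>(1)])
        show "(\<lambda>\<omega>. K 1 \<omega> powr (- \<beta>)) \<in> borel_measurable M" using K1 by measurable
        show "continuous_on UNIV (\<lambda>x. U (max 0 x))"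
          by (intro continuous_on_compose2[OF contU] continuous_intros) auto
        show "\<bar>U (max 0 x)\<bar> \<le> CU" for x by (rule CU) simp
      qed simp
      then show ?thesis by (rule continuous_on_cong[THEN iffD1, rotated 2]) (auto simp: f_eq)
    qed
    have rhs: "- (frac_dir_deriv \<alpha> a (dist_of (distr M borel (Y t))) \<phi>
          + lam * (dist_of (distr M borel (Y t)) \<phi> - shift_op 1 (dist_of (distr M borel (Y t))) \<phi>))
        = expectation (\<lambda>\<omega>. V (t powr \<beta> * K 1 \<omega> powr (- \<beta>)))" if "t > 0" for t
    proof -
      have t: "t \<ge> 0" using that by simp
      note [measurable] = Ym[OF t] HLm[OF t]
      \<comment> \<open>Minus the transposed fractional derivative, applied to \<open>\<phi>\<close>: at \<open>Y\<^sub>t\<close> it is the fractional part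
        of \<open>A\<close>, and its expectation is minus the fractional term of the equation.\<close>
      define W where "W x = (if \<alpha> = 1 then \<psi> x else 1 / Gamma (1 - \<alpha>) * (LBINT s:{0<..}. s powr (- \<alpha>) * \<psi> (x + s *\<^sub>R a)))" for x
      have A_Y: "A (NL t \<omega>) (HL t \<omega>) = W (Y t \<omega>) + lam * (\<phi> (Y t \<omega> + 1) - \<phi> (Y t \<omega>))" if "\<omega> \<in> space M" for \<omega>
      proof -
        have "G' (NL t \<omega>) (max 0 (HL t \<omega>) + s) = \<psi> (Y t \<omega> + s *\<^sub>R a)" for s
          using HL0[OF that, of t] by (simp add: G'_def Y_def scaleR_add_left add.assoc)
        moreover have "G' (NL t \<omega>) (HL t \<omega>) = \<psi> (Y t \<omega>)" by (simp add: G'_def Y_def)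
        ultimately have "weyl_integral \<alpha> (G' (NL t \<omega>)) (HL t \<omega>) = W (Y t \<omega>)"
          unfolding weyl_integral_def W_def by simp
        moreover have "G (Suc (NL t \<omega>)) (HL t \<omega>) = \<phi> (Y t \<omega> + 1)"
          by (simp add: G_def Y_def scaleR_add_left add_ac)
        ultimately show ?thesis by (simp add: A_def poisson_stable_generator_def Y_G)
      qed
      obtain C where C: "\<And>x. \<bar>\<phi> x\<bar> \<le> C" using continuous_vanishing_bounded[OF cont\<phi> R(2)] by metis
      have i1: "integrable M (\<lambda>\<omega>. \<phi> (Y t \<omega>))" and i2: "integrable M (\<lambda>\<omega>. \<phi> (Y t \<omega> + 1))"
        by (rule integrable_const_bound[where B=C]; simp add: C)+
      have frac: "frac_dir_deriv \<alpha> a (dist_of (distr M borel (Y t))) \<phi> = - expectation (\<lambda>\<omega>. W (Y t \<omega>))"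
      proof (cases "\<alpha> = 1")
        case True
        then show ?thesis
          using dist_of_distr[OF Ym[OF t], of \<psi>]
          unfolding frac_dir_deriv_def dir_deriv_def W_def by (simp add: \<psi>_eq)
      next
        case False
        then have "\<alpha> < 1" using \<alpha> by simp
        have "dist_of (distr M borel (Y t)) (\<lambda>x. \<psi> (x + s *\<^sub>R a)) = expectation (\<lambda>\<omega>. \<psi> (Y t \<omega> + s *\<^sub>R a))" for s
          by (rule dist_of_distr[OF Ym[OF t]]) measurable
        moreover have "(LBINT s:{0<..}. s powr - \<alpha> * expectation (\<lambda>\<omega>. \<psi> (Y t \<omega> + s *\<^sub>R a)))
            = expectation (\<lambda>\<omega>. LBINT s:{0<..}. s powr - \<alpha> * \<psi> (Y t \<omega> + s *\<^sub>R a))"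
          by (rule frac_kernel_fubini(2)[OF Ym[OF t] \<open>\<alpha> < 1\<close> cont\<psi> van\<psi> far])
        ultimately show ?thesis
          using False
          unfolding frac_dir_deriv_def dir_deriv_def W_def shift_op_def by (simp add: \<psi>_eq)
      qed
      have shift: "shift_op 1 (dist_of (distr M borel (Y t))) \<phi> = expectation (\<lambda>\<omega>. \<phi> (Y t \<omega> + 1))"
        unfolding shift_op_def by (rule dist_of_distr[OF Ym[OF t]]) measurable
      have "expectation (\<lambda>\<omega>. V (t powr \<beta> * K 1 \<omega> powr (- \<beta>))) = expectation (\<lambda>\<omega>. V (L t \<omega>))"
        by (rule law[OF t contV, symmetric])
      also have "\<dots> = expectation (\<lambda>\<omega>. A (NL t \<omega>) (HL t \<omega>))"
        unfolding NL_def HL_def V_def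
        by (rule expectation_random_time[OF N lam H \<alpha>(1) ind t L0 contA vanA vanmA, symmetric])
      also have "\<dots> = expectation (\<lambda>\<omega>. W (Y t \<omega>) + lam * (\<phi> (Y t \<omega> + 1) - \<phi> (Y t \<omega>)))"
        using A_Y by (intro Bochner_Integration.integral_cong) auto
      also have "\<dots> = expectation (\<lambda>\<omega>. W (Y t \<omega>)) + lam * (expectation (\<lambda>\<omega>. \<phi> (Y t \<omega> + 1)) - expectation (\<lambda>\<omega>. \<phi> (Y t \<omega>)))"
      proof -
        have "integrable M (\<lambda>\<omega>. W (Y t \<omega>))"
        proof (cases "\<alpha> = 1")
          case True
          obtain C where C: "\<And>x. \<bar>\<psi> x\<bar> \<le> C" using continuous_vanishing_bounded[OF cont\<psi> van\<psi>] by metis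
          have "integrable M (\<lambda>\<omega>. \<psi> (Y t \<omega>))"
            by (rule integrable_const_bound[where B=C]) (simp_all add: C)
          then show ?thesis using True by (simp add: W_def)
        next
          case False
          then have "\<alpha> < 1" using \<alpha> by simp
          have "integrable M (\<lambda>\<omega>. LBINT s:{0<..}. s powr - \<alpha> * \<psi> (Y t \<omega> + s *\<^sub>R a))"
            by (rule frac_kernel_fubini(3)[OF Ym[OF t] \<open>\<alpha> < 1\<close> cont\<psi> van\<psi> far])
          then show ?thesis using False unfolding W_def by simp
        qed
        then show ?thesis using i1 i2 by simp
      qed
      finally show ?thesis
        unfolding frac shift dist_of_distr[OF Ym[OF t], of \<phi>, simplified] by (simp add: algebra_simps)
    qed
    show ?thesis
      using cont_f caputo_inverse_stable[OF K1 K1_pos lapK \<beta> _ contU CU derU contV CV f_eq] rhs by auto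
  qed
  have "frac_dir_deriv_exists \<alpha> a (dist_of (distr M borel (Y t)))" if "t > 0" for t
    unfolding frac_dir_deriv_exists_def
  proof (intro impI allI)
    fix \<phi> :: "real ^ 'n \<Rightarrow> real" assume "\<alpha> \<noteq> 1" and \<phi>: "test_function \<phi>"
    then have "\<alpha> < 1" using \<alpha> by simp
    have t: "t \<ge> 0" using that by simp
    obtain R where R: "R > 0" "\<And>x. norm x \<ge> R \<Longrightarrow> \<phi> x = 0" using test_function_support[OF \<phi>] by metis
    have cont\<phi>: "continuous_on UNIV \<phi>"
      using \<phi> unfolding test_function_def by (metis k_smooth.simps(1))
    then have [measurable]: "\<phi> \<in> borel_measurable borel" by (simp add: borel_measurable_continuous_onI)
    have "dist_of (distr M borel (Y t)) (\<lambda>x. \<phi> (x + s *\<^sub>R a)) = expectation (\<lambda>\<omega>. \<phi> (Y t \<omega> + s *\<^sub>R a))" for s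
      by (rule dist_of_distr[OF Ym[OF t]]) measurable
    then show "set_integrable lborel {0<..} (\<lambda>s. s powr - \<alpha> * shift_op (s *\<^sub>R a) (dist_of (distr M borel (Y t))) \<phi>)"
      using frac_kernel_fubini(1)[OF Ym[OF t] \<open>\<alpha> < 1\<close> cont\<phi> R(2) far] unfolding shift_op_def by simp
  qed
  moreover have "AE x in distr M borel (Y t). \<forall>k. 0 \<le> x $ k" if t: "t \<ge> 0" for t
    by (subst AE_distr_iff[OF Ym[OF t]]) (use Y_nn in auto)
  moreover have "distr M borel (Y 0) = return borel 0"
  proof -
    have "distr M borel (Y 0) = distr M borel (\<lambda>_. 0)" using Y0 by (intro distr_cong) auto
    also have "\<dots> = return borel 0" by (rule distr_const) simp
    finally show ?thesis .
  qed
  ultimately have "stochastic_solution \<alpha> \<beta> lam a Y"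
    using Ym equation unfolding stochastic_solution_def solves_equation_def by auto
  then show ?thesis
    unfolding Y_def[abs_def] NL_def HL_def .
qed

end
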